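(* Let $1\le p,q<\infty$, $0\le\theta,\nu<1$ and $1\le r<\infty$ satisfy $\frac1r+\frac{1-\theta}{p}+\frac{1-\nu}{q}=1$. Then $\left[\mathcal{D}^L_{(p,\theta,q,\nu)},D^L_{(p,\theta,q,\nu)}\right]$ is a Banach nonlinear ideal.
   Context: Metric spaces are pointed with distinguished point $0$ (the origin in a Banach space). $\mathrm{Lip}(X,F)$ is the Banach space of Lipschitz maps $T:X\to F$ with $T0=0$, normed by the Lipschitz constant $\mathrm{Lip}(T)$; for pointed metric spaces $X_0,X$, $\mathrm{Lip}(X_0,X)$ is the set of base-point preserving Lipschitz maps; $X^{\#}$ is the Banach space of scalar-valued Lipschitz functions on $X$ vanishing at $0$, with closed unit ball $B_{X^{\#}}$. For $g\in X^{\#}$, $e\in F$, $(g\boxdot e)(x)=g(x)e$. $\mathfrak{L}(F,F_0)$ denotes bounded linear operators. Banach nonlinear ideal $[\mathfrak{A}^L,\mathbf{A}^L]$: for every metric space $X$ and Banach space $F$ a subset $\mathfrak{A}^L(X,F)\subseteq\mathrm{Lip}(X,F)$, and a function $\mathbf{A}^L:\mathfrak{A}^L\to[0,\infty)$, such that (0) $g\boxdot e\in\mathfrak{A}^L(X,F)$ and $\mathbf{A}^L(g\boxdot e)=\mathrm{Lip}(g)\|e\|$ for $g\in X^{\#}$, $e\in F$; (1) $S+T\in\mathfrak{A}^L(X,F)$ and $\mathbf{A}^L(S+T)\le\mathbf{A}^L(S)+\mathbf{A}^L(T)$ for $S,T\in\mathfrak{A}^L(X,F)$; (2) $BTA\in\mathfrak{A}^L(X_0,F_0)$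 and $\mathbf{A}^L(BTA)\le\|B\|\mathbf{A}^L(T)\mathrm{Lip}(A)$ for $A\in\mathrm{Lip}(X_0,X)$, $T\in\mathfrak{A}^L(X,F)$, $B\in\mathfrak{L}(F,F_0)$; (3) every linear space $\mathfrak{A}^L(X,F)$ is complete with respect to $\mathbf{A}^L$. $\Pi_q(E,H)$ denotes the absolutely $q$-summing operators between Banach spaces, with $q$-summing norm $\pi_q$. A map $S\in\mathrm{Lip}(X,G)$ is Lipschitz $p$-summing, $S\in\Pi^L_p(X,G)$, if there is $C\ge0$ such that for all finite sequences $x',x''$ in $X$ and $\lambda$ in $\mathbb{R}^+$, $[\sum_j\lambda_j^p\|Sx'_j-Sx''_j\|^p]^{1/p}\le C\sup_{f\in B_{X^{\#}}}[\sum_j\lambda_j^p|f(x'_j)-f(x''_j)|^p]^{1/p}$; $\pi_p^L(S)$ is the infimum of such $C$. $T\in\mathrm{Lip}(X,F)$ belongs to $\mathcal{D}^{L}_{(p,\theta,q,\nu)}(X,F)$ (Lipschitz $(p,\theta,q,\nu)$-dominated) if there exist Banach spaces $G,H$, $S\in\Pi^L_p(X,G)$, $R\in\Pi_q(F^*,H)$ and a constant $C>0$ such that $$|\langle Tx'-Tx'',b^*\rangle|\le C\,d_X(x',x'')^{\theta}\|Sx'-Sx''\|^{1-\theta}\|b^*\|^{\nu}\|Rb^*\|^{1-\nu}$$ for all $x',x''\in X$, $b^*\in F^*$; and $D^{L}_{(p,\theta,q,\nu)}(T)=\inf\{C\,\pi^L_p(S)^{1-\theta}\,\pi_q(R)^{1-\nu}\}$,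 the infimum over all admissible $C,S,R$. *)

theory Defs
  imports "HOL-Analysis.Analysis"
begin

section \<open>Pointed metric spaces and Banach spaces with explicit carriers\<close>

text \<open>
  The definition of a dominated map quantifies existentially over Banach spaces, and the definition of
  an ideal quantifies over all metric and Banach spaces.  Types cannot be quantified inside a formula,
  so spaces are values with explicit carrier sets rather than instances of type classes.  Maps between
  spaces are \<^const>\<open>extensional\<close> functions on the carrier of their domain.
\<close>

type_synonym 'x pointed = "'x metric \<times> 'x"

abbreviation points :: "'x pointed \<Rightarrow> 'x set" where
  "points X \<equiv> mspace (fst X)"

abbreviation pdist :: "'x pointed \<Rightarrow> 'x \<Rightarrow> 'x \<Rightarrow> real" where
  "pdist X \<equiv> mdist (fst X)"

abbreviation base :: "'x pointed \<Rightarrow> 'x" where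
  "base X \<equiv> snd X"

definition pointed_metric_space :: "'x pointed \<Rightarrow> bool" where
  "pointed_metric_space X \<longleftrightarrow> base X \<in> points X"

record ('k, 'v) nspace =
  carr :: "'v set"
  vadd :: "'v \<Rightarrow> 'v \<Rightarrow> 'v"
  vzero :: "'v"
  vscale :: "'k \<Rightarrow> 'v \<Rightarrow> 'v"
  vnorm :: "'v \<Rightarrow> real"

locale normed_space =
  fixes V :: "('k :: real_normed_field, 'v) nspace"
  assumes zero_closed: "vzero V \<in> carr V"
    and add_closed: "\<lbrakk>u \<in> carr V; v \<in> carr V\<rbrakk> \<Longrightarrow> vadd V u v \<in> carr V"
    and scale_closed: "u \<in> carr V \<Longrightarrow> vscale V a u \<in> carr V"
    and add_assoc: "\<lbrakk>u \<in> carr V; v \<in> carr V; w \<in> carr V\<rbrakk> \<Longrightarrow>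
      vadd V (vadd V u v) w = vadd V u (vadd V v w)"
    and add_commute: "\<lbrakk>u \<in> carr V; v \<in> carr V\<rbrakk> \<Longrightarrow> vadd V u v = vadd V v u"
    and add_zero: "u \<in> carr V \<Longrightarrow> vadd V u (vzero V) = u"
    and add_inverse: "u \<in> carr V \<Longrightarrow> \<exists>v\<in>carr V. vadd V u v = vzero V"
    and scale_add_right: "\<lbrakk>u \<in> carr V; v \<in> carr V\<rbrakk> \<Longrightarrow>
      vscale V a (vadd V u v) = vadd V (vscale V a u) (vscale V a v)"
    and scale_add_left: "u \<in> carr V \<Longrightarrow>
      vscale V (a + b) u = vadd V (vscale V a u) (vscale V b u)"
    and scale_scale: "u \<in> carr V \<Longrightarrow> vscale V a (vscale V b u) = vscale V (a * b) u"
    and scale_one: "u \<in> carr V \<Longrightarrow> vscale V 1 u = u"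
    and norm_nonneg: "u \<in> carr V \<Longrightarrow> 0 \<le> vnorm V u"
    and norm_eq_zero: "u \<in> carr V \<Longrightarrow> vnorm V u = 0 \<longleftrightarrow> u = vzero V"
    and norm_scale: "u \<in> carr V \<Longrightarrow> vnorm V (vscale V a u) = norm a * vnorm V u"
    and norm_triangle: "\<lbrakk>u \<in> carr V; v \<in> carr V\<rbrakk> \<Longrightarrow> vnorm V (vadd V u v) \<le> vnorm V u + vnorm V v"

definition vsub :: "('k :: real_normed_field, 'v) nspace \<Rightarrow> 'v \<Rightarrow> 'v \<Rightarrow> 'v" where
  "vsub V u v = vadd V u (vscale V (-1) v)"

text \<open>
  The locale \<^locale>\<open>Metric_space\<close> demands symmetry and nonnegativity also outside the carrier.
\<close>

definition norm_metric :: "('k :: real_normed_field, 'v) nspace \<Rightarrow> 'v metric" where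
  "norm_metric V =
     metric (carr V, \<lambda>u v. if u \<in> carr V \<and> v \<in> carr V then vnorm V (vsub V u v) else 0)"

abbreviation origin_pointed :: "('k :: real_normed_field, 'v) nspace \<Rightarrow> 'v pointed" where
  "origin_pointed V \<equiv> (norm_metric V, vzero V)"

definition banach_space :: "('k :: real_normed_field, 'v) nspace \<Rightarrow> bool" where
  "banach_space V \<longleftrightarrow> normed_space V \<and> mcomplete_of (norm_metric V)"

definition scalars :: "('k :: real_normed_field, 'k) nspace" where
  "scalars = \<lparr>carr = UNIV, vadd = (+), vzero = 0, vscale = (*), vnorm = norm\<rparr>"

definition function_space ::
  "'d set \<Rightarrow> ('k, 'v) nspace \<Rightarrow> ('d \<Rightarrow> 'v) set \<Rightarrow> (('d \<Rightarrow> 'v) \<Rightarrow> real) \<Rightarrow> ('k, 'd \<Rightarrow> 'v) nspace" where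
  "function_space D V M N =
    \<lparr>carr = M,
     vadd = (\<lambda>f g. \<lambda>x\<in>D. vadd V (f x) (g x)),
     vzero = (\<lambda>x\<in>D. vzero V),
     vscale = (\<lambda>a f. \<lambda>x\<in>D. vscale V a (f x)),
     vnorm = N\<rparr>"


section \<open>Lipschitz maps and bounded operators\<close>

definition lip_maps :: "'x pointed \<Rightarrow> 'y pointed \<Rightarrow> ('x \<Rightarrow> 'y) set" where
  "lip_maps X Y = {T \<in> extensional (points X).
     Lipschitz_continuous_map (fst X) (fst Y) T \<and> T (base X) = base Y}"

definition lip_const :: "'x pointed \<Rightarrow> 'y pointed \<Rightarrow> ('x \<Rightarrow> 'y) \<Rightarrow> real" where
  "lip_const X Y T = Inf {L. 0 \<le> L \<and>
     (\<forall>x\<in>points X. \<forall>y\<in>points X. pdist Y (T x) (T y) \<le> L * pdist X x y)}"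

definition sharp :: "'x pointed \<Rightarrow> ('k :: real_normed_field, 'x \<Rightarrow> 'k) nspace" where
  "sharp X = function_space (points X) scalars
     (lip_maps X (origin_pointed (scalars :: ('k, 'k) nspace)))
     (lip_const X (origin_pointed (scalars :: ('k, 'k) nspace)))"

definition bounded_ops ::
  "('k :: real_normed_field, 'v) nspace \<Rightarrow> ('k, 'w) nspace \<Rightarrow> ('v \<Rightarrow> 'w) set" where
  "bounded_ops V W = {B \<in> carr V \<rightarrow>\<^sub>E carr W.
     (\<forall>u\<in>carr V. \<forall>v\<in>carr V. B (vadd V u v) = vadd W (B u) (B v)) \<and>
     (\<forall>a. \<forall>u\<in>carr V. B (vscale V a u) = vscale W a (B u)) \<and>
     (\<exists>c. \<forall>u\<in>carr V. vnorm W (B u) \<le> c * vnorm V u)}"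

definition op_norm ::
  "('k :: real_normed_field, 'v) nspace \<Rightarrow> ('k, 'w) nspace \<Rightarrow> ('v \<Rightarrow> 'w) \<Rightarrow> real" where
  "op_norm V W B = Inf {c. 0 \<le> c \<and> (\<forall>u\<in>carr V. vnorm W (B u) \<le> c * vnorm V u)}"

definition dual :: "('k :: real_normed_field, 'v) nspace \<Rightarrow> ('k, 'v \<Rightarrow> 'k) nspace" where
  "dual V = function_space (carr V) scalars (bounded_ops V scalars) (op_norm V scalars)"

definition unit_ball :: "('k, 'v) nspace \<Rightarrow> 'v set" where
  "unit_ball V = {v \<in> carr V. vnorm V v \<le> 1}"


section \<open>Summing maps\<close>

definition summing_consts ::
  "real \<Rightarrow> ('k :: real_normed_field, 'v) nspace \<Rightarrow> ('k, 'w) nspace \<Rightarrow> ('v \<Rightarrow> 'w) \<Rightarrow> real set" where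
  "summing_consts q E H R = {C. 0 \<le> C \<and>
     (\<forall>(n :: nat) u. (\<forall>j<n. u j \<in> carr E) \<longrightarrow>
        (\<Sum>j<n. vnorm H (R (u j)) powr q) powr (1 / q)
        \<le> C * (SUP \<phi>\<in>unit_ball (dual E). (\<Sum>j<n. norm (\<phi> (u j)) powr q) powr (1 / q)))}"

definition summing_ops ::
  "real \<Rightarrow> ('k :: real_normed_field, 'v) nspace \<Rightarrow> ('k, 'w) nspace \<Rightarrow> ('v \<Rightarrow> 'w) set" where
  "summing_ops q E H = {R \<in> bounded_ops E H. summing_consts q E H R \<noteq> {}}"

definition summing_norm ::
  "real \<Rightarrow> ('k :: real_normed_field, 'v) nspace \<Rightarrow> ('k, 'w) nspace \<Rightarrow> ('v \<Rightarrow> 'w) \<Rightarrow> real" where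
  "summing_norm q E H R = Inf (summing_consts q E H R)"

definition lip_summing_consts ::
  "real \<Rightarrow> 'x pointed \<Rightarrow> ('k :: real_normed_field, 'v) nspace \<Rightarrow> ('x \<Rightarrow> 'v) \<Rightarrow> real set" where
  "lip_summing_consts p X G S = {C. 0 \<le> C \<and>
     (\<forall>(n :: nat) x' x'' (lam :: nat \<Rightarrow> real).
        (\<forall>j<n. x' j \<in> points X \<and> x'' j \<in> points X \<and> 0 < lam j) \<longrightarrow>
        (\<Sum>j<n. lam j powr p * vnorm G (vsub G (S (x' j)) (S (x'' j))) powr p) powr (1 / p)
        \<le> C * (SUP f\<in>unit_ball (sharp X :: ('k, 'x \<Rightarrow> 'k) nspace).
                (\<Sum>j<n. lam j powr p * norm (f (x' j) - f (x'' j)) powr p) powr (1 / p)))}"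

definition lip_summing_maps ::
  "real \<Rightarrow> 'x pointed \<Rightarrow> ('k :: real_normed_field, 'v) nspace \<Rightarrow> ('x \<Rightarrow> 'v) set" where
  "lip_summing_maps p X G =
     {S \<in> lip_maps X (origin_pointed G). lip_summing_consts p X G S \<noteq> {}}"

definition lip_summing_norm ::
  "real \<Rightarrow> 'x pointed \<Rightarrow> ('k :: real_normed_field, 'v) nspace \<Rightarrow> ('x \<Rightarrow> 'v) \<Rightarrow> real" where
  "lip_summing_norm p X G S = Inf (lip_summing_consts p X G S)"


section \<open>Dominated maps\<close>

text \<open>
  Note \<^term>\<open>(0 :: real) powr 0 = 0\<close>; this is harmless below, since for \<open>x' = x''\<close> or \<open>b = 0\<close>
  the left-hand side vanishes.
\<close>

definition dominates ::
  "real \<Rightarrow> real \<Rightarrow> real \<Rightarrow> real \<Rightarrow> 'x pointed \<Rightarrow> ('k :: real_normed_field, 'f) nspace \<Rightarrow>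
   ('x \<Rightarrow> 'f) \<Rightarrow> ('k, 'g) nspace \<Rightarrow> ('k, 'h) nspace \<Rightarrow> real \<Rightarrow> ('x \<Rightarrow> 'g) \<Rightarrow> (('f \<Rightarrow> 'k) \<Rightarrow> 'h) \<Rightarrow> bool"
where
  "dominates p \<theta> q \<nu> X F T G H C S R \<longleftrightarrow>
     banach_space G \<and> banach_space H \<and> 0 < C \<and>
     S \<in> lip_summing_maps p X G \<and> R \<in> summing_ops q (dual F) H \<and>
     (\<forall>x'\<in>points X. \<forall>x''\<in>points X. \<forall>b\<in>carr (dual F).
        norm (b (vsub F (T x') (T x'')))
        \<le> C * pdist X x' x'' powr \<theta> * vnorm G (vsub G (S x') (S x'')) powr (1 - \<theta>)
            * vnorm (dual F) b powr \<nu> * vnorm H (R b) powr (1 - \<nu>))"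

text \<open>
  The spaces \<open>G\<close> and \<open>H\<close> live in a fixed type of sequences of formal finite linear combinations of
  elements of \<open>X\<close>, respectively of \<open>F\<^sup>*\<close>.  No generality is lost: only the closed linear
  spans of \<open>S(X)\<close> and \<open>R(F\<^sup>*)\<close> matter, and each element of these is the limit of such a sequence.
  The lemmas \<open>dominates_imp_dominated\<close> and \<open>dominates_imp_dominated_norm_le\<close> below
  confirm this for Banach spaces \<open>G\<close> and \<open>H\<close> over arbitrary types.
\<close>

type_synonym ('k, 'd) seqs = "nat \<Rightarrow> ('k \<times> 'd) list"

definition dominated ::
  "real \<Rightarrow> real \<Rightarrow> real \<Rightarrow> real \<Rightarrow> 'x pointed \<Rightarrow> ('k :: real_normed_field, 'f) nspace \<Rightarrow> ('x \<Rightarrow> 'f) set"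
where
  "dominated p \<theta> q \<nu> X F = {T \<in> lip_maps X (origin_pointed F).
     \<exists>(G :: ('k, ('k, 'x) seqs) nspace) (H :: ('k, ('k, 'f \<Rightarrow> 'k) seqs) nspace) C S R.
       dominates p \<theta> q \<nu> X F T G H C S R}"

definition dominated_norm ::
  "real \<Rightarrow> real \<Rightarrow> real \<Rightarrow> real \<Rightarrow> 'x pointed \<Rightarrow> ('k :: real_normed_field, 'f) nspace \<Rightarrow>
   ('x \<Rightarrow> 'f) \<Rightarrow> real"
where
  "dominated_norm p \<theta> q \<nu> X F T =
     Inf {C * lip_summing_norm p X G S powr (1 - \<theta>) * summing_norm q (dual F) H R powr (1 - \<nu>)
       | (G :: ('k, ('k, 'x) seqs) nspace) (H :: ('k, ('k, 'f \<Rightarrow> 'k) seqs) nspace) C S R.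
       dominates p \<theta> q \<nu> X F T G H C S R}"


section \<open>Independence of the choice of the types of the dominating spaces\<close>

context normed_space
begin

lemma scale_zero: assumes u: "u \<in> carr V" shows "vscale V 0 u = vzero V"
proof -
  let ?z = "vscale V 0 u"
  have zc: "?z \<in> carr V" using u scale_closed by blast
  have zz: "vadd V ?z ?z = ?z" using scale_add_left[OF u, of 0 0] by simp
  obtain v where v: "v \<in> carr V" "vadd V ?z v = vzero V" using add_inverse[OF zc] by blast
  have "vadd V ?z (vadd V ?z v) = vadd V ?z v" using add_assoc[OF zc zc v(1)] zz by simp
  thus ?thesis using v add_zero[OF zc] by simp
qed

lemma sub_closed: "\<lbrakk>u \<in> carr V; v \<in> carr V\<rbrakk> \<Longrightarrow> vsub V u v \<in> carr V"
  by (simp add: vsub_def add_closed scale_closed)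

lemma add_neg: assumes u: "u \<in> carr V" shows "vadd V u (vscale V (-1) u) = vzero V"
  using scale_add_left[OF u, of 1 "-1"] scale_one[OF u] scale_zero[OF u] by simp

lemma sub_self: "u \<in> carr V \<Longrightarrow> vsub V u u = vzero V"
  by (simp add: vsub_def add_neg)

lemma zero_add: "u \<in> carr V \<Longrightarrow> vadd V (vzero V) u = u"
  using add_commute add_zero zero_closed by metis

lemma add_left_commute: "\<lbrakk>u \<in> carr V; v \<in> carr V; w \<in> carr V\<rbrakk> \<Longrightarrow>
    vadd V u (vadd V v w) = vadd V v (vadd V u w)"
  by (metis add_assoc add_commute)

lemmas add_ac = add_assoc add_commute add_left_commute

lemma sub_add_sub:
  assumes "u \<in> carr V" "v \<in> carr V" "w \<in> carr V"
  shows "vadd V (vsub V u v) (vsub V v w) = vsub V u w"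
proof -
  let ?v = "vscale V (-1) v" and ?w = "vscale V (-1) w"
  have c: "?v \<in> carr V" "?w \<in> carr V" using assms scale_closed by auto
  have "vadd V (vadd V u ?v) (vadd V v ?w) = vadd V u (vadd V (vadd V v ?v) ?w)"
    using assms c by (simp add: add_ac add_closed)
  thus ?thesis using assms c by (simp add: vsub_def add_neg zero_add)
qed

lemma sub_eq_zero_iff: assumes "u \<in> carr V" "v \<in> carr V" shows "vsub V u v = vzero V \<longleftrightarrow> u = v"
proof
  assume h: "vsub V u v = vzero V"
  have "vadd V (vsub V u v) v = vadd V u (vadd V v (vscale V (-1) v))"
    using assms by (simp add: vsub_def add_ac add_closed scale_closed)
  thus "u = v" using h assms by (simp add: add_neg add_zero zero_add)
qed (use assms sub_self in simp)

lemma scale_sub: "\<lbrakk>u \<in> carr V; v \<in> carr V\<rbrakk> \<Longrightarrow>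
    vscale V a (vsub V u v) = vsub V (vscale V a u) (vscale V a v)"
  by (simp add: vsub_def scale_add_right scale_closed scale_scale)

lemma sub_minus: assumes "u \<in> carr V" "v \<in> carr V" shows "vsub V v u = vscale V (-1) (vsub V u v)"
  using assms by (simp add: vsub_def scale_add_right scale_closed scale_scale scale_one add_commute)

lemma norm_sub_commute: "\<lbrakk>u \<in> carr V; v \<in> carr V\<rbrakk> \<Longrightarrow> vnorm V (vsub V u v) = vnorm V (vsub V v u)"
  using sub_minus[of u v] norm_scale[OF sub_closed, of u v "-1"] by simp

lemma norm_sub_triangle:
  assumes "u \<in> carr V" "v \<in> carr V" "w \<in> carr V"
  shows "vnorm V (vsub V u w) \<le> vnorm V (vsub V u v) + vnorm V (vsub V v w)"
  using norm_triangle[of "vsub V u v" "vsub V v w"] assms sub_closed sub_add_sub by simp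

lemma add_sub_add:
  assumes "u \<in> carr V" "v \<in> carr V" "u' \<in> carr V" "v' \<in> carr V"
  shows "vsub V (vadd V u v) (vadd V u' v') = vadd V (vsub V u u') (vsub V v v')"
  using assms by (simp add: vsub_def scale_add_right scale_closed add_closed add_ac)


lemma Metric_space_norm:
  "Metric_space (carr V) (\<lambda>u v. if u \<in> carr V \<and> v \<in> carr V then vnorm V (vsub V u v) else 0)"
proof
  fix u v w
  assume uv: "u \<in> carr V" "v \<in> carr V"
  show "(if u \<in> carr V \<and> v \<in> carr V then vnorm V (vsub V u v) else 0) = 0 \<longleftrightarrow> u = v"
    using uv norm_eq_zero sub_closed sub_eq_zero_iff by simp
  assume w: "w \<in> carr V"
  show "(if u \<in> carr V \<and> w \<in> carr V then vnorm V (vsub V u w) else 0)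
    \<le> (if u \<in> carr V \<and> v \<in> carr V then vnorm V (vsub V u v) else 0)
      + (if v \<in> carr V \<and> w \<in> carr V then vnorm V (vsub V v w) else 0)"
    using uv w norm_sub_triangle by simp
qed (auto simp: norm_nonneg sub_closed norm_sub_commute)

lemma mspace_norm_metric [simp]: "mspace (norm_metric V) = carr V"
  unfolding norm_metric_def by (rule Metric_space.mspace_metric[OF Metric_space_norm])

lemma mdist_norm_metric:
  "\<lbrakk>u \<in> carr V; v \<in> carr V\<rbrakk> \<Longrightarrow> mdist (norm_metric V) u v = vnorm V (vsub V u v)"
  unfolding norm_metric_def by (simp add: Metric_space.mdist_metric[OF Metric_space_norm])

lemma mcomplete_norm_metric_iff:
  "mcomplete_of (norm_metric V) \<longleftrightarrow>
     (\<forall>s :: nat \<Rightarrow> _. (\<forall>n. s n \<in> carr V) \<and>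
        (\<forall>e>0. \<exists>N. \<forall>m\<ge>N. \<forall>n\<ge>N. vnorm V (vsub V (s m) (s n)) < e) \<longrightarrow>
        (\<exists>l\<in>carr V. \<forall>e>0. \<exists>N. \<forall>n\<ge>N. vnorm V (vsub V (s n) l) < e))"
proof -
  interpret M: Metric_space "carr V"
    "\<lambda>u v. if u \<in> carr V \<and> v \<in> carr V then vnorm V (vsub V u v) else 0"
    by (rule Metric_space_norm)
  have c: "M.MCauchy s \<longleftrightarrow> (\<forall>n. s n \<in> carr V) \<and>
      (\<forall>e>0. \<exists>N. \<forall>m\<ge>N. \<forall>n\<ge>N. vnorm V (vsub V (s m) (s n)) < e)" for s :: "nat \<Rightarrow> _"
  proof (cases "\<forall>n. s n \<in> carr V")
    case True
    thus ?thesis unfolding M.MCauchy_def by (auto simp: image_subset_iff)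
  qed (auto simp: M.MCauchy_def)
  have l: "limitin M.mtopology s l sequentially \<longleftrightarrow>
      l \<in> carr V \<and> (\<forall>e>0. \<exists>N. \<forall>n\<ge>N. vnorm V (vsub V (s n) l) < e)"
    if "\<forall>n. s n \<in> carr V" for s :: "nat \<Rightarrow> _" and l
    using that by (auto simp: M.limit_metric_sequentially)
  have "(\<exists>l. limitin M.mtopology s l sequentially) \<longleftrightarrow>
      (\<exists>l\<in>carr V. \<forall>e>0. \<exists>N. \<forall>n\<ge>N. vnorm V (vsub V (s n) l) < e)" if "M.MCauchy s" for s :: "nat \<Rightarrow> _"
  proof -
    have "\<forall>n. s n \<in> carr V" using that c by blast
    from l[OF this] show ?thesis by (simp add: Bex_def)
  qed
  hence "M.mcomplete \<longleftrightarrow> (\<forall>s :: nat \<Rightarrow> _. M.MCauchy s \<longrightarrow>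
      (\<exists>l\<in>carr V. \<forall>e>0. \<exists>N. \<forall>n\<ge>N. vnorm V (vsub V (s n) l) < e))"
    unfolding M.mcomplete_def by (intro all_cong1 imp_cong refl) simp
  thus ?thesis
    unfolding norm_metric_def M.mcomplete_of c .
qed

end

primrec lin_comb :: "('k :: real_normed_field, 'v) nspace \<Rightarrow> ('d \<Rightarrow> 'v) \<Rightarrow> ('k \<times> 'd) list \<Rightarrow> 'v" where
  "lin_comb V f [] = vzero V"
| "lin_comb V f (t # ts) = vadd V (vscale V (fst t) (f (snd t))) (lin_comb V f ts)"

definition closed_span :: "('k :: real_normed_field, 'v) nspace \<Rightarrow> ('d \<Rightarrow> 'v) \<Rightarrow> 'd set \<Rightarrow> 'v set" where
  "closed_span V f D = {w \<in> carr V. \<forall>e>0. \<exists>ts. snd ` set ts \<subseteq> D \<and> vnorm V (vsub V w (lin_comb V f ts)) < e}"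

context normed_space
begin

lemma lin_comb_closed: "\<lbrakk>f \<in> D \<rightarrow> carr V; snd ` set ts \<subseteq> D\<rbrakk> \<Longrightarrow> lin_comb V f ts \<in> carr V"
  by (induction ts) (auto simp: zero_closed add_closed scale_closed Pi_iff)

lemma lin_comb_append: "\<lbrakk>f \<in> D \<rightarrow> carr V; snd ` set ts \<subseteq> D; snd ` set us \<subseteq> D\<rbrakk> \<Longrightarrow>
    lin_comb V f (ts @ us) = vadd V (lin_comb V f ts) (lin_comb V f us)"
proof (induction ts)
  case Nil thus ?case using lin_comb_closed[of f D us] zero_add by simp
next
  case (Cons t ts)
  hence "vscale V (fst t) (f (snd t)) \<in> carr V" "lin_comb V f ts \<in> carr V" "lin_comb V f us \<in> carr V"
    using lin_comb_closed[of f D] scale_closed by (auto simp: Pi_iff)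
  thus ?case using Cons by (simp add: add_assoc)
qed

lemma scale_vzero: "vscale V a (vzero V) = vzero V"
  using norm_scale[OF zero_closed, of a] norm_eq_zero[OF zero_closed]
    norm_eq_zero[OF scale_closed[OF zero_closed, of a]] by simp

lemma lin_comb_scale: "\<lbrakk>f \<in> D \<rightarrow> carr V; snd ` set ts \<subseteq> D\<rbrakk> \<Longrightarrow>
    lin_comb V f (map (\<lambda>t. (a * fst t, snd t)) ts) = vscale V a (lin_comb V f ts)"
proof (induction ts)
  case Nil thus ?case by (simp add: scale_vzero)
next
  case (Cons t ts)
  hence "f (snd t) \<in> carr V" "lin_comb V f ts \<in> carr V" 
    using lin_comb_closed[of f D] by (auto simp: Pi_iff)
  thus ?case using Cons by (simp add: scale_add_right scale_closed scale_scale)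
qed

lemma closed_span_carr: "closed_span V f D \<subseteq> carr V"
  by (auto simp: closed_span_def)

lemma closed_span_approx: 
  assumes "w \<in> closed_span V f D" "e > 0"
  obtains ts where "snd ` set ts \<subseteq> D" "vnorm V (vsub V w (lin_comb V f ts)) < e"
  using assms unfolding closed_span_def by blast

lemma closed_span_zero: "vzero V \<in> closed_span V f D"
  unfolding closed_span_def
  using zero_closed sub_self[OF zero_closed] norm_eq_zero[OF zero_closed] by (auto intro!: exI[of _ "[]"])

lemma closed_span_mem:
  assumes f: "f \<in> D \<rightarrow> carr V" and x: "x \<in> D" shows "f x \<in> closed_span V f D"
proof -
  have fx: "f x \<in> carr V" using f x by auto
  have "vnorm V (vsub V (f x) (lin_comb V f [(1, x)])) = 0"
    using fx by (simp add: scale_one add_zero sub_self norm_eq_zero zero_closed)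
  thus ?thesis unfolding closed_span_def using fx x by (auto intro!: exI[of _ "[(1, x)]"])
qed

lemma closed_span_add:
  assumes f: "f \<in> D \<rightarrow> carr V" and u: "u \<in> closed_span V f D" and v: "v \<in> closed_span V f D"
  shows "vadd V u v \<in> closed_span V f D"
proof -
  have uv: "u \<in> carr V" "v \<in> carr V" using u v closed_span_carr by auto
  have "\<exists>ts. snd ` set ts \<subseteq> D \<and> vnorm V (vsub V (vadd V u v) (lin_comb V f ts)) < e" if e: "e > 0" for e
  proof -
    obtain ts where ts: "snd ` set ts \<subseteq> D" "vnorm V (vsub V u (lin_comb V f ts)) < e/2"
      using closed_span_approx[OF u, of "e/2"] e by auto
    obtain us where us: "snd ` set us \<subseteq> D" "vnorm V (vsub V v (lin_comb V f us)) < e/2"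
      using closed_span_approx[OF v, of "e/2"] e by auto
    have c: "lin_comb V f ts \<in> carr V" "lin_comb V f us \<in> carr V" using lin_comb_closed f ts us by blast+
    have "vnorm V (vsub V (vadd V u v) (lin_comb V f (ts @ us)))
       \<le> vnorm V (vsub V u (lin_comb V f ts)) + vnorm V (vsub V v (lin_comb V f us))"
      using lin_comb_append[OF f ts(1) us(1)] add_sub_add[OF uv c] norm_triangle sub_closed uv c by simp
    thus ?thesis using ts us by (intro exI[of _ "ts @ us"]) auto
  qed
  thus ?thesis unfolding closed_span_def using uv add_closed by simp
qed

lemma closed_span_scale:
  assumes f: "f \<in> D \<rightarrow> carr V" and u: "u \<in> closed_span V f D"
  shows "vscale V a u \<in> closed_span V f D"
proof -
  have uc: "u \<in> carr V" using u closed_span_carr by auto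
  have "\<exists>ts. snd ` set ts \<subseteq> D \<and> vnorm V (vsub V (vscale V a u) (lin_comb V f ts)) < e" if e: "e > 0" for e
  proof -
    define k where "k = norm a + 1"
    have k: "k > 0" by (simp add: k_def add_nonneg_pos)
    obtain ts where ts: "snd ` set ts \<subseteq> D" "vnorm V (vsub V u (lin_comb V f ts)) < e/k"
      using closed_span_approx[OF u, of "e/k"] e k by auto
    have c: "lin_comb V f ts \<in> carr V" using lin_comb_closed f ts by blast
    have "vnorm V (vsub V (vscale V a u) (lin_comb V f (map (\<lambda>t. (a * fst t, snd t)) ts)))
       = norm a * vnorm V (vsub V u (lin_comb V f ts))"
      using lin_comb_scale[OF f ts(1), of a] scale_sub[OF uc c, of a] norm_scale[OF sub_closed[OF uc c]] by metis
    also have "\<dots> \<le> k * vnorm V (vsub V u (lin_comb V f ts))"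
      by (rule mult_right_mono) (auto simp: k_def norm_nonneg sub_closed uc c)
    also have "\<dots> < e" using ts k by (simp add: pos_less_divide_eq mult.commute)
    finally show ?thesis using ts(1)
      by (intro exI[of _ "map (\<lambda>t. (a * fst t, snd t)) ts"]) (simp add: image_image)
  qed
  thus ?thesis unfolding closed_span_def using uc scale_closed by simp
qed

lemma closed_span_closed:
  assumes f: "f \<in> D \<rightarrow> carr V" and s: "\<And>n. s n \<in> closed_span V f D" and l: "l \<in> carr V"
    and lim: "\<forall>e>0. \<exists>N. \<forall>n\<ge>(N::nat). vnorm V (vsub V (s n) l) < e"
  shows "l \<in> closed_span V f D"
proof -
  have "\<exists>ts. snd ` set ts \<subseteq> D \<and> vnorm V (vsub V l (lin_comb V f ts)) < e" if e: "e > 0" for e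
  proof -
    obtain n where n: "vnorm V (vsub V (s n) l) < e/2" using lim e by (meson half_gt_zero order_refl)
    have sc: "s n \<in> carr V" using s closed_span_carr by blast
    obtain ts where ts: "snd ` set ts \<subseteq> D" "vnorm V (vsub V (s n) (lin_comb V f ts)) < e/2"
      using closed_span_approx[OF s, of "e/2"] e by auto
    have c: "lin_comb V f ts \<in> carr V" using lin_comb_closed f ts by blast
    have "vnorm V (vsub V l (lin_comb V f ts)) < e"
      using norm_sub_triangle[OF l sc c] n ts norm_sub_commute[OF l sc] by simp
    thus ?thesis using ts by blast
  qed
  thus ?thesis unfolding closed_span_def using l by simp
qed

end

lemma transport_to_seqs:
  fixes V :: "('k :: real_normed_field, 'v) nspace" and f :: "'d \<Rightarrow> 'v"
  assumes V: "banach_space V" and f: "f \<in> D \<rightarrow> carr V"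
  obtains W :: "('k, ('k, 'd) seqs) nspace" and j
  where "banach_space W" "j \<in> closed_span V f D \<rightarrow> carr W"
    "\<And>u v. \<lbrakk>u \<in> closed_span V f D; v \<in> closed_span V f D\<rbrakk> \<Longrightarrow> j (vadd V u v) = vadd W (j u) (j v)"
    "\<And>a u. u \<in> closed_span V f D \<Longrightarrow> j (vscale V a u) = vscale W a (j u)"
    "\<And>u. u \<in> closed_span V f D \<Longrightarrow> vnorm W (j u) = vnorm V u"
    "j (vzero V) = vzero W"
proof -
  interpret normed_space V using V by (simp add: banach_space_def)
  let ?U = "closed_span V f D"
  define j :: "'v \<Rightarrow> ('k, 'd) seqs" where
    "j w = (SOME c. \<forall>n. snd ` set (c n) \<subseteq> D \<and> vnorm V (vsub V w (lin_comb V f (c n))) < 1 / Suc n)" for w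
  have jw: "snd ` set (j w n) \<subseteq> D \<and> vnorm V (vsub V w (lin_comb V f (j w n))) < 1 / Suc n"
    if "w \<in> ?U" for w n
  proof -
    have "\<forall>n. \<exists>ts. snd ` set ts \<subseteq> D \<and> vnorm V (vsub V w (lin_comb V f ts)) < 1 / Suc n"
      using that unfolding closed_span_def by simp
    hence "\<exists>c. \<forall>n. snd ` set (c n) \<subseteq> D \<and> vnorm V (vsub V w (lin_comb V f (c n))) < 1 / Suc n"
      by metis
    from someI_ex[OF this] show ?thesis unfolding j_def by blast
  qed
  have Uc: "u \<in> carr V" if "u \<in> ?U" for u using that closed_span_carr by blast
  have inj: "inj_on j ?U"
  proof (rule inj_onI)
    fix u v assume u: "u \<in> ?U" and v: "v \<in> ?U" and eq: "j u = j v"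
    have "vnorm V (vsub V u v) \<le> 0"
    proof (rule field_le_epsilon)
      fix e :: real assume "e > 0"
      then obtain n where n: "1 / Suc n < e / 2" using nat_approx_posE half_gt_zero by blast
      let ?l = "lin_comb V f (j u n)"
      have l: "?l \<in> carr V" using lin_comb_closed[OF f] jw[OF u] by blast
      have "vnorm V (vsub V u v) \<le> vnorm V (vsub V u ?l) + vnorm V (vsub V v ?l)"
        using norm_sub_triangle[OF Uc[OF u] l Uc[OF v]] norm_sub_commute[OF l Uc[OF v]] by simp
      thus "vnorm V (vsub V u v) \<le> 0 + e" using jw[OF u, of n] jw[OF v, of n] n eq by simp
    qed
    hence "vnorm V (vsub V u v) = 0" using norm_nonneg[OF sub_closed] Uc u v by (simp add: order_antisym)
    thus "u = v" using norm_eq_zero sub_closed sub_eq_zero_iff Uc u v by simp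
  qed
  define i where "i = inv_into ?U j"
  have ij [simp]: "i (j u) = u" if "u \<in> ?U" for u using that inj by (simp add: i_def)
  define W :: "('k, ('k, 'd) seqs) nspace" where "W =
    \<lparr>carr = j ` ?U, vadd = (\<lambda>a b. j (vadd V (i a) (i b))), vzero = j (vzero V),
     vscale = (\<lambda>a b. j (vscale V a (i b))), vnorm = (\<lambda>a. vnorm V (i a))\<rparr>"
  have Wsimps [simp]: "carr W = j ` ?U" "vzero W = j (vzero V)"
    "\<And>u v. \<lbrakk>u \<in> ?U; v \<in> ?U\<rbrakk> \<Longrightarrow> vadd W (j u) (j v) = j (vadd V u v)"
    "\<And>a u. u \<in> ?U \<Longrightarrow> vscale W a (j u) = j (vscale V a u)"
    "\<And>u. u \<in> ?U \<Longrightarrow> vnorm W (j u) = vnorm V u"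
    by (simp_all add: W_def)
  note cl [simp] = closed_span_zero closed_span_add[OF f] closed_span_scale[OF f]
  have subW: "vsub W (j u) (j v) = j (vsub V u v)" "vsub V u v \<in> ?U" if "u \<in> ?U" "v \<in> ?U" for u v
    using that by (simp_all add: vsub_def)
  have nW: "normed_space W"
  proof
    fix u assume "u \<in> carr W"
    then obtain u' where u': "u = j u'" "u' \<in> ?U" by auto
    have "vscale V (-1) u' \<in> ?U" "vadd V u' (vscale V (-1) u') = vzero V"
      using u' add_neg[OF Uc] by auto
    thus "\<exists>v\<in>carr W. vadd W u v = vzero W"
      using u' by (intro bexI[of _ "j (vscale V (-1) u')"]) auto
    show "vnorm W u = 0 \<longleftrightarrow> u = vzero W"
      using u' norm_eq_zero[OF Uc] inj_on_eq_iff[OF inj] cl(1) by auto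
  qed (auto simp: Uc add_assoc scale_add_right scale_add_left scale_scale scale_one norm_nonneg
         norm_scale norm_triangle add_zero intro!: arg_cong[of _ _ j] add_commute)
  then interpret W: normed_space W .
  have "banach_space W"
    unfolding banach_space_def W.mcomplete_norm_metric_iff
  proof (intro conjI allI impI nW)
    fix s :: "nat \<Rightarrow> ('k, 'd) seqs"
    assume s: "(\<forall>n. s n \<in> carr W) \<and> (\<forall>e>0. \<exists>N. \<forall>m\<ge>N. \<forall>n\<ge>N. vnorm W (vsub W (s m) (s n)) < e)"
    define t where "t n = i (s n)" for n
    have t: "t n \<in> ?U" "s n = j (t n)" for n
      using s inv_into_into[of "s n" j ?U] f_inv_into_f[of "s n" j ?U] by (auto simp: t_def i_def)
    have "\<forall>e>0. \<exists>N. \<forall>m\<ge>N. \<forall>n\<ge>N. vnorm V (vsub V (t m) (t n)) < e"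
      using s t subW by simp
    then obtain l where l: "l \<in> carr V" "\<forall>e>0. \<exists>N. \<forall>n\<ge>N. vnorm V (vsub V (t n) l) < e"
      using V t(1) Uc unfolding banach_space_def mcomplete_norm_metric_iff by blast
    have lU: "l \<in> ?U" using closed_span_closed[OF f t(1) l] .
    show "\<exists>l\<in>carr W. \<forall>e>0. \<exists>N. \<forall>n\<ge>N. vnorm W (vsub W (s n) l) < e"
      using l(2) lU t subW by (intro bexI[of _ "j l"]) auto
  qed
  thus ?thesis by (rule that[of W j]) auto
qed

lemma (in normed_space) dual_closed:
  assumes b: "b \<in> carr (dual V)"
  shows "c \<in> carr (dual V) \<Longrightarrow> vadd (dual V) b c \<in> carr (dual V)" "vscale (dual V) a b \<in> carr (dual V)"
proof -
  have C: "carr (dual V) = bounded_ops V scalars" by (simp add: dual_def function_space_def)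
  obtain B where B: "\<And>u. u \<in> carr V \<Longrightarrow> norm (b u) \<le> B * vnorm V u"
    using b unfolding C bounded_ops_def scalars_def by auto blast
  note d = dual_def function_space_def scalars_def bounded_ops_def
  show "vadd (dual V) b c \<in> carr (dual V)" if c: "c \<in> carr (dual V)"
  proof -
    obtain B' where B': "\<And>u. u \<in> carr V \<Longrightarrow> norm (c u) \<le> B' * vnorm V u"
      using c unfolding C bounded_ops_def scalars_def by auto blast
    have "norm (b u + c u) \<le> (B + B') * vnorm V u" if "u \<in> carr V" for u
      using norm_triangle_le[OF add_mono[OF B[OF that] B'[OF that]]] by (simp add: distrib_right)
    thus ?thesis using b c
      by (auto simp: d add_closed scale_closed distrib_left intro!: exI[of _ "B + B'"])
  qed
  have "norm (a * b u) \<le> (norm a * B) * vnorm V u" if "u \<in> carr V" for u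
    using mult_left_mono[OF B[OF that] norm_ge_zero[of a]] by (simp add: norm_mult mult.assoc)
  thus "vscale (dual V) a b \<in> carr (dual V)" using b
    by (auto simp: d add_closed scale_closed distrib_left norm_mult intro!: exI[of _ "norm a * B"])
qed

lemma dominates_transport:
  fixes X :: "'x pointed" and F :: "('k :: real_normed_field, 'f) nspace"
    and G :: "('k, 'g) nspace" and H :: "('k, 'h) nspace"
  assumes X: "pointed_metric_space X" and F: "banach_space F"
    and dom: "dominates p \<theta> q \<nu> X F T G H C S R"
  obtains G' :: "('k, ('k, 'x) seqs) nspace" and H' :: "('k, ('k, 'f \<Rightarrow> 'k) seqs) nspace" and S' R'
  where "dominates p \<theta> q \<nu> X F T G' H' C S' R'"
    "lip_summing_norm p X G' S' = lip_summing_norm p X G S"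
    "summing_norm q (dual F) H' R' = summing_norm q (dual F) H R"
proof -
  let ?E = "dual F"
  have G: "banach_space G" and H: "banach_space H" and S: "S \<in> lip_summing_maps p X G"
    and R: "R \<in> summing_ops q ?E H"
    using dom by (auto simp: dominates_def)
  interpret F: normed_space F using F by (simp add: banach_space_def)
  interpret G: normed_space G using G by (simp add: banach_space_def)
  interpret H: normed_space H using H by (simp add: banach_space_def)
  have Sl: "S \<in> lip_maps X (origin_pointed G)" using S by (simp add: lip_summing_maps_def)
  have Sf: "S \<in> points X \<rightarrow> carr G"
    using Sl by (simp add: lip_maps_def Lipschitz_continuous_map_def)
  have Rb: "R \<in> bounded_ops ?E H" using R by (simp add: summing_ops_def)
  have Rf: "R \<in> carr ?E \<rightarrow> carr H" using Rb by (auto simp: bounded_ops_def)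
  obtain G' :: "('k, ('k, 'x) seqs) nspace" and j where G': "banach_space G'"
    and j: "j \<in> closed_span G S (points X) \<rightarrow> carr G'"
    "\<And>u v. \<lbrakk>u \<in> closed_span G S (points X); v \<in> closed_span G S (points X)\<rbrakk> \<Longrightarrow>
        j (vadd G u v) = vadd G' (j u) (j v)"
    "\<And>a u. u \<in> closed_span G S (points X) \<Longrightarrow> j (vscale G a u) = vscale G' a (j u)"
    "\<And>u. u \<in> closed_span G S (points X) \<Longrightarrow> vnorm G' (j u) = vnorm G u"
    "j (vzero G) = vzero G'"
    using transport_to_seqs[OF G Sf] by metis
  obtain H' :: "('k, ('k, 'f \<Rightarrow> 'k) seqs) nspace" and k where H': "banach_space H'"
    and k: "k \<in> closed_span H R (carr ?E) \<rightarrow> carr H'"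
    "\<And>u v. \<lbrakk>u \<in> closed_span H R (carr ?E); v \<in> closed_span H R (carr ?E)\<rbrakk> \<Longrightarrow>
        k (vadd H u v) = vadd H' (k u) (k v)"
    "\<And>a u. u \<in> closed_span H R (carr ?E) \<Longrightarrow> k (vscale H a u) = vscale H' a (k u)"
    "\<And>u. u \<in> closed_span H R (carr ?E) \<Longrightarrow> vnorm H' (k u) = vnorm H u"
    using transport_to_seqs[OF H Rf] by metis
  interpret G': normed_space G' using G' by (simp add: banach_space_def)
  interpret H': normed_space H' using H' by (simp add: banach_space_def)
  define S' where "S' = (\<lambda>x\<in>points X. j (S x))"
  define R' where "R' = (\<lambda>b\<in>carr ?E. k (R b))"
  have Su: "S x \<in> closed_span G S (points X)" if "x \<in> points X" for x
    using G.closed_span_mem[OF Sf that] .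
  have Ru: "R b \<in> closed_span H R (carr ?E)" if "b \<in> carr ?E" for b
    using H.closed_span_mem[OF Rf that] .
  have S'f: "S' x \<in> carr G'" if "x \<in> points X" for x using that j(1) Su by (auto simp: S'_def)
  have R'f: "R' b \<in> carr H'" if "b \<in> carr ?E" for b using that k(1) Ru by (auto simp: R'_def)
  have nS: "vnorm G' (vsub G' (S' x) (S' y)) = vnorm G (vsub G (S x) (S y))"
    if "x \<in> points X" "y \<in> points X" for x y
  proof -
    have "vsub G (S x) (S y) \<in> closed_span G S (points X)"
      unfolding vsub_def using that Su G.closed_span_add[OF Sf] G.closed_span_scale[OF Sf] by simp
    moreover have "vsub G' (S' x) (S' y) = j (vsub G (S x) (S y))"
      unfolding vsub_def S'_def using that Su j(2,3) G.closed_span_scale[OF Sf] by simp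
    ultimately show ?thesis using j(4) by simp
  qed
  have nR: "vnorm H' (R' b) = vnorm H (R b)" if "b \<in> carr ?E" for b
    using that Ru k(4) by (simp add: R'_def)
  have cS: "lip_summing_consts p X G' S' = lip_summing_consts p X G S"
  proof -
    have "(\<Sum>j<n. lam j powr p * vnorm G' (vsub G' (S' (x' j)) (S' (x'' j))) powr p)
        = (\<Sum>j<n. lam j powr p * vnorm G (vsub G (S (x' j)) (S (x'' j))) powr p)"
      if "\<forall>j<n. x' j \<in> points X \<and> x'' j \<in> points X \<and> 0 < lam j" for n :: nat and x' x'' lam
      using that by (intro sum.cong) (auto simp: nS)
    thus ?thesis unfolding lip_summing_consts_def by (auto cong: conj_cong imp_cong)
  qed
  have cR: "summing_consts q ?E H' R' = summing_consts q ?E H R"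
  proof -
    have "(\<Sum>j<n. vnorm H' (R' (u j)) powr q) = (\<Sum>j<n. vnorm H (R (u j)) powr q)"
      if "\<forall>j<n. u j \<in> carr ?E" for n :: nat and u
      using that by (intro sum.cong) (auto simp: nR)
    thus ?thesis unfolding summing_consts_def by (auto cong: conj_cong imp_cong)
  qed
  have "S' \<in> lip_maps X (origin_pointed G')"
  proof -
    obtain B where B: "\<And>x y. \<lbrakk>x \<in> points X; y \<in> points X\<rbrakk> \<Longrightarrow>
        mdist (norm_metric G) (S x) (S y) \<le> B * pdist X x y"
      using Sl unfolding lip_maps_def Lipschitz_continuous_map_def by auto
    have "mdist (norm_metric G') (S' x) (S' y) \<le> B * pdist X x y"
      if "x \<in> points X" "y \<in> points X" for x y
      using B[OF that] that S'f nS Sf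
      by (simp add: G.mdist_norm_metric G'.mdist_norm_metric Pi_iff)
    moreover have "S' (base X) = vzero G'"
      using X Sl j(5) by (simp add: S'_def lip_maps_def pointed_metric_space_def)
    ultimately show ?thesis
      unfolding lip_maps_def Lipschitz_continuous_map_def using S'f
      by (auto simp: S'_def)
  qed
  hence S': "S' \<in> lip_summing_maps p X G'"
    using S cS by (simp add: lip_summing_maps_def)
  have "R' \<in> bounded_ops ?E H'"
  proof -
    obtain c where c: "\<And>b. b \<in> carr ?E \<Longrightarrow> vnorm H (R b) \<le> c * vnorm ?E b"
      using Rb unfolding bounded_ops_def by blast
    have "R' (vadd ?E b b') = vadd H' (R' b) (R' b')" if "b \<in> carr ?E" "b' \<in> carr ?E" for b b'
      using that Rb Ru k(2) F.dual_closed(1) by (simp add: R'_def bounded_ops_def)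
    moreover have "R' (vscale ?E a b) = vscale H' a (R' b)" if "b \<in> carr ?E" for a b
      using that Rb Ru k(3) F.dual_closed(2) by (simp add: R'_def bounded_ops_def)
    moreover have "R' \<in> carr ?E \<rightarrow>\<^sub>E carr H'" using R'f by (auto simp: R'_def)
    ultimately show ?thesis using c nR unfolding bounded_ops_def by (auto intro!: exI[of _ c])
  qed
  hence R': "R' \<in> summing_ops q ?E H'"
    using R cR by (simp add: summing_ops_def)
  have "dominates p \<theta> q \<nu> X F T G' H' C S' R'"
    using dom G' H' S' R' nS nR by (simp add: dominates_def)
  thus ?thesis using cS cR by (intro that[of G' H' S' R']) (simp_all add: lip_summing_norm_def summing_norm_def)
qed

theorem dominates_imp_dominated:
  assumes "pointed_metric_space X" "banach_space F" "T \<in> lip_maps X (origin_pointed F)"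
    and "dominates p \<theta> q \<nu> X F T G H C S R"
  shows "T \<in> dominated p \<theta> q \<nu> X F"
  by (rule dominates_transport[OF assms(1,2,4)]) (unfold dominated_def, use assms(3) in blast)

theorem dominates_imp_dominated_norm_le:
  fixes F :: "('k :: real_normed_field, 'f) nspace"
  assumes "pointed_metric_space X" "banach_space F"
    and dom: "dominates p \<theta> q \<nu> X F T G H C S R"
  shows "dominated_norm p \<theta> q \<nu> X F T
    \<le> C * lip_summing_norm p X G S powr (1 - \<theta>) * summing_norm q (dual F) H R powr (1 - \<nu>)"
proof -
  obtain G' :: "('k, ('k, 'a) seqs) nspace" and H' :: "('k, ('k, 'f \<Rightarrow> 'k) seqs) nspace" and S' R'
    where t: "dominates p \<theta> q \<nu> X F T G' H' C S' R'"
      "lip_summing_norm p X G' S' = lip_summing_norm p X G S"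
      "summing_norm q (dual F) H' R' = summing_norm q (dual F) H R"
    using dominates_transport[OF assms] by metis
  show ?thesis unfolding dominated_norm_def
  proof (rule cInf_lower)
    show "bdd_below {C * lip_summing_norm p X G S powr (1 - \<theta>) * summing_norm q (dual F) H R powr (1 - \<nu>)
       | (G :: ('k, ('k, 'a) seqs) nspace) (H :: ('k, ('k, 'f \<Rightarrow> 'k) seqs) nspace) C S R.
       dominates p \<theta> q \<nu> X F T G H C S R}"
      by (rule bdd_belowI[of _ 0]) (auto simp: dominates_def)
  qed (use t in force)
qed

section \<open>Banach nonlinear ideals\<close>

text \<open>
  The metric spaces are those with points in an arbitrary type \<open>'x\<close>, the Banach spaces over
  \<open>'k\<close> those with vectors in an arbitrary type \<open>'f\<close>.
\<close>

definition banach_nonlinear_ideal ::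
  "('x pointed \<Rightarrow> ('k :: real_normed_field, 'f) nspace \<Rightarrow> ('x \<Rightarrow> 'f) set) \<Rightarrow>
   ('x pointed \<Rightarrow> ('k, 'f) nspace \<Rightarrow> ('x \<Rightarrow> 'f) \<Rightarrow> real) \<Rightarrow> bool"
where
  "banach_nonlinear_ideal A N \<longleftrightarrow>
     (\<forall>X F. pointed_metric_space X \<and> banach_space F \<longrightarrow>
        A X F \<subseteq> lip_maps X (origin_pointed F) \<and>
        (\<forall>T\<in>A X F. 0 \<le> N X F T) \<and>
        (\<forall>g\<in>carr (sharp X). \<forall>e\<in>carr F.
           (\<lambda>x\<in>points X. vscale F (g x) e) \<in> A X F \<and>
           N X F (\<lambda>x\<in>points X. vscale F (g x) e) = vnorm (sharp X) g * vnorm F e) \<and>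
        (\<forall>S\<in>A X F. \<forall>T\<in>A X F.
           (\<lambda>x\<in>points X. vadd F (S x) (T x)) \<in> A X F \<and>
           N X F (\<lambda>x\<in>points X. vadd F (S x) (T x)) \<le> N X F S + N X F T) \<and>
        banach_space (function_space (points X) F (A X F) (N X F))) \<and>
     (\<forall>X0 X F F0. pointed_metric_space X0 \<and> pointed_metric_space X \<and>
        banach_space F \<and> banach_space F0 \<longrightarrow>
        (\<forall>P\<in>lip_maps X0 X. \<forall>T\<in>A X F. \<forall>B\<in>bounded_ops F F0.
           (\<lambda>x\<in>points X0. B (T (P x))) \<in> A X0 F0 \<and>
           N X0 F0 (\<lambda>x\<in>points X0. B (T (P x))) \<le> op_norm F F0 B * N X F T * lip_const X0 X P))"

end

theory Submission
  imports Defs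
begin

text \<open>
  The number \<open>D T\<close> is best handled through normalised dominations
  \<open>\<bar>\<langle>Tx - Ty, b\<rangle>\<bar> \<le> c d(x,y)\<^sup>\<theta> (\<parallel>Sx - Sy\<parallel>/\<sigma>)\<^bsup>1-\<theta>\<^esup> \<parallel>b\<parallel>\<^sup>\<nu> (\<parallel>Rb\<parallel>/\<rho>)\<^bsup>1-\<nu>\<^esup>\<close>, in which \<open>\<sigma>\<close> and \<open>\<rho>\<close>
  are positive summing constants of \<open>S\<close> and \<open>R\<close>: the map \<open>T\<close> has such a domination for every
  \<open>c > D T\<close>, and a domination with constant \<open>c\<close> gives \<open>D T \<le> c\<close>.  The strict slack in \<open>c\<close> leaves room
  to take \<open>\<sigma>\<close> and \<open>\<rho>\<close> positive, so that maps with vanishing constants need no separate treatment.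

  Since \<open>\<parallel>Sx - Sy\<parallel> \<le> \<sigma> d(x,y)\<close> and \<open>\<parallel>Rb\<parallel> \<le> \<rho> \<parallel>b\<parallel>\<close>, such a domination forces
  \<open>\<bar>\<langle>Tx - Ty, b\<rangle>\<bar> \<le> c d(x,y) \<parallel>b\<parallel>\<close>, and the Hahn-Banach theorem turns this into \<open>Lip(T) \<le> D T\<close>.  This
  gives definiteness of \<open>D\<close>, the lower bound in \<open>D (g \<boxdot> e) = Lip(g) \<parallel>e\<parallel>\<close>, and pointwise limits of
  \<open>D\<close>-Cauchy sequences.  The upper bound for \<open>g \<boxdot> e\<close> comes from \<open>S = g\<close> and \<open>R b = \<langle>e, b\<rangle>\<close>, and the ideal
  inequality from the pair \<open>S P\<close>, \<open>R B\<^sup>*\<close>.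

  The triangle inequality and completeness both follow from one statement on series,
  \<open>dominated_series\<close>: if \<open>D T\<^sub>n < c\<^sub>n\<close> and \<open>\<Sum>c\<^sub>n = C < \<infinity>\<close>, then \<open>D (\<Sum>T\<^sub>n) \<le> C\<close>.  Choose
  normalised dominations of the \<open>T\<^sub>n\<close> by \<open>S\<^sub>n\<close> and \<open>R\<^sub>n\<close>, put \<open>w\<^sub>n = c\<^sub>n/C\<close>, and combine them into one
  map \<open>x \<mapsto> (S\<^sub>n x)\<^sub>n\<close> into an \<open>\<ell>\<^sub>p\<close>-sum with weights \<open>w\<^sub>n/\<sigma>\<^sub>n\<^sup>p\<close> and one operator \<open>b \<mapsto> (R\<^sub>n b)\<^sub>n\<close>
  into an \<open>\<ell>\<^sub>q\<close>-sum with weights \<open>w\<^sub>n/\<rho>\<^sub>n\<^sup>q\<close>.  Both have summing constant \<open>1\<close> because \<open>\<Sum>w\<^sub>n = 1\<close>, and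
  Hoelder's inequality with weights \<open>w\<^sub>n\<close> and exponents \<open>r\<close>, \<open>p/(1-\<theta>)\<close>, \<open>q/(1-\<nu>)\<close>, whose reciprocals
  add up to \<open>1\<close> by hypothesis, bounds the sum of the dominations by \<open>C\<close> times the domination by the
  combined pair.
\<close>

section \<open>Minkowski and Hoelder inequalities for weighted series\<close>

lemma powr_mean_convex:
  assumes "p \<ge> 1" "0 \<le> t" "t \<le> (1::real)" "0 \<le> u" "0 \<le> v"
  shows "(t * u + (1 - t) * v) powr p \<le> t * u powr p + (1 - t) * v powr p"
proof -
  \<comment> \<open>For the case in which one of \<open>u\<close> and \<open>v\<close> vanishes, so that a single scaled term remains.\<close>
  have scaled: "(c * w) powr p \<le> c * w powr p" if "0 \<le> c" "c \<le> 1" "0 \<le> w" for c w :: real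
  proof -
    have "c powr p \<le> c" using that assms(1) by (metis powr_mono' powr_one)
    thus ?thesis using that by (simp add: powr_mult mult_right_mono)
  qed
  show ?thesis
  proof (cases "0 < u \<and> 0 < v")
    case True
    thus ?thesis using convex_onD[OF powr_convex[OF assms(1)], of "1-t" u v] assms by simp
  next
    case False
    hence "u = 0 \<or> v = 0" using assms by auto
    thus ?thesis using scaled[of t u] scaled[of "1-t" v] assms by auto
  qed
qed

lemma Young_nonneg:
  assumes "0 \<le> \<alpha>" "0 \<le> \<beta>" "\<alpha> + \<beta> = (1::real)" "0 \<le> a" "0 \<le> b"
  shows "a powr \<alpha> * b powr \<beta> \<le> \<alpha> * a + \<beta> * b"
proof (cases "0 < a \<and> 0 < b")
  case True thus ?thesis using Youngs_inequality_0 assms by blast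
next
  case False
  hence "a = 0 \<or> b = 0" using assms by auto
  thus ?thesis using assms by auto
qed

text \<open>
  Convexity applied to \<open>f\<^sub>n + g\<^sub>n = (A' + B') (t f\<^sub>n/A' + (1 - t) g\<^sub>n/B')\<close> with \<open>t = A'/(A' + B')\<close> bounds
  the left-hand side by \<open>A' + B'\<close> whenever \<open>A'\<close> and \<open>B'\<close> exceed the norms of \<open>f\<close> and \<open>g\<close>.  Strict
  excess keeps the divisors positive; the case \<open>A' = B' = 1\<close> already gives summability.
\<close>

lemma Minkowski_suminf:
  fixes a f g :: "nat \<Rightarrow> real"
  assumes p: "p \<ge> 1" and a: "\<And>n. 0 \<le> a n" and f: "\<And>n. 0 \<le> f n" and g: "\<And>n. 0 \<le> g n"
    and sf: "summable (\<lambda>n. a n * f n powr p)" and sg: "summable (\<lambda>n. a n * g n powr p)"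
  shows "summable (\<lambda>n. a n * (f n + g n) powr p)"
    and "(\<Sum>n. a n * (f n + g n) powr p) powr (1/p)
      \<le> (\<Sum>n. a n * f n powr p) powr (1/p) + (\<Sum>n. a n * g n powr p) powr (1/p)"
proof -
  define A B where "A = (\<Sum>n. a n * f n powr p) powr (1/p)" and "B = (\<Sum>n. a n * g n powr p) powr (1/p)"
  have A0: "0 \<le> A" "0 \<le> B" by (auto simp: A_def B_def)
  have Ap: "(\<Sum>n. a n * f n powr p) = A powr p" "(\<Sum>n. a n * g n powr p) = B powr p"
    using p a suminf_nonneg[OF sf] suminf_nonneg[OF sg] by (auto simp: A_def B_def powr_powr)
  have ptw: "a n * (f n + g n) powr p \<le>
      (A' + B') powr p * (A' / (A' + B') / A' powr p * (a n * f n powr p) + B' / (A' + B') / B' powr p * (a n * g n powr p))"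
    if AB: "A' > 0" "B' > 0" for A' B' n
  proof -
    define t where "t = A' / (A' + B')"
    have t: "0 \<le> t" "t \<le> 1" "1 - t = B' / (A' + B')" using AB by (auto simp: t_def field_simps)
    have "f n + g n = (A' + B') * (t * (f n / A') + (1 - t) * (g n / B'))"
      using AB t(3) by (simp add: t_def distrib_left)
    hence "(f n + g n) powr p = (A' + B') powr p * (t * (f n / A') + (1 - t) * (g n / B')) powr p"
      using AB t f[of n] g[of n] by (simp add: powr_mult)
    also have "\<dots> \<le> (A' + B') powr p * (t * (f n / A') powr p + (1 - t) * (g n / B') powr p)"
      using powr_mean_convex[OF p t(1,2), of "f n / A'" "g n / B'"] AB f g by (intro mult_left_mono) auto
    finally have "a n * (f n + g n) powr p \<le> a n * ((A' + B') powr p * (t * (f n / A') powr p + (1 - t) * (g n / B') powr p))"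
      using a mult_left_mono by blast
    also have "\<dots> = (A' + B') powr p * (t / A' powr p * (a n * f n powr p) + (1 - t) / B' powr p * (a n * g n powr p))"
      using AB f g by (simp add: powr_divide algebra_simps)
    finally show ?thesis unfolding t(3) by (simp add: t_def)
  qed
  let ?h = "\<lambda>A' B' n. (A' + B') powr p * (A' / (A' + B') / A' powr p * (a n * f n powr p) + B' / (A' + B') / B' powr p * (a n * g n powr p))"
  have hs: "?h A' B' sums ((A' + B') powr p * (A' / (A' + B') / A' powr p * A powr p + B' / (A' + B') / B' powr p * B powr p))" for A' B'
    by (intro sums_mult sums_add) (use sf sg Ap in \<open>auto simp: sums_iff\<close>)
  note sh = sums_summable[OF hs]
  have "norm (a n * (f n + g n) powr p) \<le> ?h 1 1 n" for n
    using ptw[of 1 1 n] a[of n] by simp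
  thus s: "summable (\<lambda>n. a n * (f n + g n) powr p)"
    by (intro summable_comparison_test[OF _ sh[of 1 1]]) blast
  show "(\<Sum>n. a n * (f n + g n) powr p) powr (1/p) \<le> A + B"
  proof (rule field_le_epsilon)
    fix e :: real assume e: "e > 0"
    define A' B' where "A' = A + e/2" and "B' = B + e/2"
    have AB: "A' > 0" "B' > 0" using A0 e by (auto simp: A'_def B'_def)
    have "A powr p \<le> A' powr p" "B powr p \<le> B' powr p"
      using p e A0 by (auto simp: A'_def B'_def intro!: powr_mono2)
    hence q: "A powr p / A' powr p \<le> 1" "B powr p / B' powr p \<le> 1" using AB by auto
    have "(\<Sum>n. a n * (f n + g n) powr p) \<le> (\<Sum>n. ?h A' B' n)"
      by (intro suminf_le s sh ptw AB)
    also have "\<dots> = (A' + B') powr p * (A' / (A' + B') / A' powr p * A powr p + B' / (A' + B') / B' powr p * B powr p)"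
      using hs by (simp add: sums_iff)
    also have "\<dots> = (A' + B') powr p * (A' / (A' + B') * (A powr p / A' powr p) + B' / (A' + B') * (B powr p / B' powr p))"
      by simp
    also have "\<dots> \<le> (A' + B') powr p * (A' / (A' + B') * 1 + B' / (A' + B') * 1)"
      using AB q by (intro mult_left_mono add_mono) auto
    also have "\<dots> = (A' + B') powr p" using AB by (simp flip: add_divide_distrib)
    finally have "(\<Sum>n. a n * (f n + g n) powr p) powr (1/p) \<le> ((A' + B') powr p) powr (1/p)"
      using p a by (intro powr_mono2 suminf_nonneg s) auto
    also have "\<dots> = A + B + e" using AB p by (simp add: powr_powr A'_def B'_def)
    finally show "(\<Sum>n. a n * (f n + g n) powr p) powr (1/p) \<le> A + B + e" .
  qed
qed

text \<open>
  The weighted mean inequality for the three numbers \<open>x\<close>, \<open>y\<close>, \<open>1\<close>, by two applications of Young's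
  inequality.
\<close>

lemma weighted_amgm_with_one:
  assumes x: "0 \<le> x" and y: "0 \<le> y" and "0 < \<alpha>" "0 < \<beta>" "\<alpha> + \<beta> + \<gamma> = (1::real)" "0 \<le> \<gamma>"
  shows "x powr \<alpha> * y powr \<beta> \<le> \<alpha> * x + \<beta> * y + \<gamma>"
proof -
  define s where "s = \<alpha> + \<beta>"
  define z where "z = x powr (\<alpha>/s) * y powr (\<beta>/s)"
  have s: "s > 0" "s + \<gamma> = 1" "\<alpha>/s + \<beta>/s = 1"
    using assms by (auto simp: s_def simp flip: add_divide_distrib)
  have "z \<le> \<alpha>/s * x + \<beta>/s * y"
    unfolding z_def using assms s by (intro Young_nonneg) auto
  hence "s * z \<le> s * (\<alpha>/s * x + \<beta>/s * y)" using s by simp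
  hence z: "s * z \<le> \<alpha> * x + \<beta> * y" using s by (simp add: distrib_left)
  have "x powr \<alpha> * y powr \<beta> = z powr s * 1 powr \<gamma>"
    using s assms by (simp add: z_def powr_mult powr_powr)
  also have "\<dots> \<le> s * z + \<gamma> * 1"
    using s assms by (intro Young_nonneg) (auto simp: z_def)
  finally show ?thesis using z by simp
qed

text \<open>
  Hoelder's inequality for \<open>u\<close>, \<open>v\<close> and the constant function \<open>1\<close>, whose exponent takes up whatever
  \<open>\<alpha>/p + \<beta>/q\<close> leaves below \<open>1\<close>.  It is the sum of the mean inequality for
  \<open>u\<^sub>n\<^sup>p/A\<close>, \<open>v\<^sub>n\<^sup>q/B\<close> and \<open>1\<close>, where \<open>A\<close> and \<open>B\<close> are the two series.
\<close>

lemma Holder_suminf: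
  fixes w u v :: "nat \<Rightarrow> real"
  assumes pq: "0 < p" "0 < q" "0 < \<alpha>" "0 < \<beta>" and ex: "\<alpha> / p + \<beta> / q \<le> 1"
    and w: "\<And>n. 0 < w n" and sw: "summable w" "suminf w \<le> 1"
    and u: "\<And>n. 0 \<le> u n" and su: "summable (\<lambda>n. w n * u n powr p)"
    and v: "\<And>n. 0 \<le> v n" and sv: "summable (\<lambda>n. w n * v n powr q)"
  shows "summable (\<lambda>n. w n * (u n powr \<alpha> * v n powr \<beta>))"
    and "(\<Sum>n. w n * (u n powr \<alpha> * v n powr \<beta>))
      \<le> ((\<Sum>n. w n * u n powr p) powr (1/p)) powr \<alpha> * ((\<Sum>n. w n * v n powr q) powr (1/q)) powr \<beta>"
proof -
  define A B where "A = (\<Sum>n. w n * u n powr p)" and "B = (\<Sum>n. w n * v n powr q)"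
  have A0: "0 \<le> A" "0 \<le> B" using w su sv unfolding A_def B_def by (auto intro!: suminf_nonneg simp: less_imp_le)
  define \<gamma> where "\<gamma> = 1 - \<alpha>/p - \<beta>/q"
  have ptw: "u n powr \<alpha> * v n powr \<beta> \<le> (A' powr (\<alpha>/p) * B' powr (\<beta>/q)) *
        (\<alpha>/p * (u n powr p / A') + \<beta>/q * (v n powr q / B') + \<gamma>)"
    if AB: "A' > 0" "B' > 0" for A' B' n
  proof -
    have "u n powr \<alpha> * v n powr \<beta> = (A' powr (\<alpha>/p) * B' powr (\<beta>/q)) *
        ((u n powr p / A') powr (\<alpha>/p) * (v n powr q / B') powr (\<beta>/q))"
      using AB pq u v by (simp add: powr_divide powr_powr)
    also have "\<dots> \<le> (A' powr (\<alpha>/p) * B' powr (\<beta>/q)) * (\<alpha>/p * (u n powr p / A') + \<beta>/q * (v n powr q / B') + \<gamma>)"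
      using AB pq ex by (intro mult_left_mono weighted_amgm_with_one) (auto simp: \<gamma>_def)
    finally show ?thesis .
  qed
  let ?h = "\<lambda>A' B' n. (A' powr (\<alpha>/p) * B' powr (\<beta>/q)) *
     (\<alpha>/p/A' * (w n * u n powr p) + \<beta>/q/B' * (w n * v n powr q) + \<gamma> * w n)"
  have le: "w n * (u n powr \<alpha> * v n powr \<beta>) \<le> ?h A' B' n" if AB: "A' > 0" "B' > 0" for A' B' n
    using mult_left_mono[OF ptw[OF AB, of n], of "w n"] w[of n] by (simp add: algebra_simps)
  have hs: "?h A' B' sums ((A' powr (\<alpha>/p) * B' powr (\<beta>/q)) * (\<alpha>/p/A' * A + \<beta>/q/B' * B + \<gamma> * suminf w))" for A' B'
    by (intro sums_mult sums_add) (use su sv sw in \<open>auto simp: sums_iff A_def B_def\<close>)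
  note sh = sums_summable[OF hs]
  have "norm (w n * (u n powr \<alpha> * v n powr \<beta>)) \<le> ?h 1 1 n" for n
    using le[of 1 1 n] w[of n] by simp
  thus s: "summable (\<lambda>n. w n * (u n powr \<alpha> * v n powr \<beta>))"
    by (intro summable_comparison_test[OF _ sh[of 1 1]]) blast
  have zero: "\<forall>n. x n = 0" if "summable (\<lambda>n. w n * x n powr t)" "(\<Sum>n. w n * x n powr t) = 0" for x t
  proof -
    have "\<forall>n. w n * x n powr t = 0"
      using that suminf_eq_zero_iff[OF that(1)] w by (simp add: less_imp_le)
    thus ?thesis using w by (metis less_irrefl mult_eq_0_iff powr_eq_0_iff)
  qed
  show "(\<Sum>n. w n * (u n powr \<alpha> * v n powr \<beta>)) \<le> (A powr (1/p)) powr \<alpha> * (B powr (1/q)) powr \<beta>"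
  proof (cases "A = 0 \<or> B = 0")
    case True
    hence "(\<forall>n. u n = 0) \<or> (\<forall>n. v n = 0)"
      using zero[OF su] zero[OF sv] by (auto simp: A_def B_def)
    thus ?thesis by auto
  next
    case False
    hence AB: "A > 0" "B > 0" using A0 by auto
    have "(\<Sum>n. w n * (u n powr \<alpha> * v n powr \<beta>)) \<le> (\<Sum>n. ?h A B n)"
      by (intro suminf_le s sh le AB)
    also have "\<dots> = (A powr (\<alpha>/p) * B powr (\<beta>/q)) * (\<alpha>/p/A * A + \<beta>/q/B * B + \<gamma> * suminf w)"
      using hs by (simp add: sums_iff)
    also have "\<dots> \<le> (A powr (\<alpha>/p) * B powr (\<beta>/q)) * (\<alpha>/p + \<beta>/q + \<gamma> * 1)"
      using AB sw ex by (intro mult_left_mono add_mono) (auto simp: \<gamma>_def)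
    also have "\<dots> = (A powr (1/p)) powr \<alpha> * (B powr (1/q)) powr \<beta>"
      by (simp add: \<gamma>_def powr_powr)
    finally show ?thesis .
  qed
qed

section \<open>The Hahn-Banach theorem\<close>

text \<open>
  Functionals are extensional on the carrier so that the pointwise order is antisymmetric.  Only real
  scalars enter: the argument treats any normed space as a real one.
\<close>

definition sublinear :: "('k :: real_normed_field, 'v) nspace \<Rightarrow> ('v \<Rightarrow> real) \<Rightarrow> bool" where
  "sublinear V g \<longleftrightarrow> g \<in> extensional (carr V) \<and>
     (\<forall>u\<in>carr V. \<forall>v\<in>carr V. g (vadd V u v) \<le> g u + g v) \<and>
     (\<forall>t\<ge>0. \<forall>u\<in>carr V. g (vscale V (of_real t) u) = t * g u)"

text \<open>
  The functional \<open>u \<mapsto> inf\<^bsub>t\<ge>0\<^esub> g(u + ta) - t g(a)\<close>.  It is sublinear, lies below \<open>g\<close>, and takes at \<open>-a\<close>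
  a value of at most \<open>-g(a)\<close>.  Hence a minimal sublinear functional satisfies \<open>g(-a) = -g(a)\<close> for
  all \<open>a\<close> and is linear, which replaces the usual extension by one dimension at a time.
\<close>

definition tilt :: "('k :: real_normed_field, 'v) nspace \<Rightarrow> 'v \<Rightarrow> ('v \<Rightarrow> real) \<Rightarrow> 'v \<Rightarrow> real" where
  "tilt V a g = (\<lambda>u\<in>carr V. INF t\<in>{0..}. g (vadd V u (vscale V (of_real t) a)) - t * g a)"

context normed_space
begin

abbreviation neg :: "'v \<Rightarrow> 'v" where "neg \<equiv> vscale V (-1)"

lemma sublinear_add: "\<lbrakk>sublinear V g; u \<in> carr V; v \<in> carr V\<rbrakk> \<Longrightarrow> g (vadd V u v) \<le> g u + g v"
  and sublinear_scale: "\<lbrakk>sublinear V g; u \<in> carr V; 0 \<le> t\<rbrakk> \<Longrightarrow> g (vscale V (of_real t) u) = t * g u"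
  and sublinear_ext: "sublinear V g \<Longrightarrow> g \<in> extensional (carr V)"
  by (auto simp: sublinear_def)

lemma sublinear_zero: "sublinear V g \<Longrightarrow> g (vzero V) = 0"
  using sublinear_scale[of g "vzero V" 0] zero_closed scale_zero by simp

lemma neg_add: "u \<in> carr V \<Longrightarrow> vadd V (neg u) u = vzero V"
  using add_neg add_commute scale_closed by metis

lemma sublinear_neg: assumes "sublinear V g" "u \<in> carr V" shows "- g (neg u) \<le> g u"
  using sublinear_add[OF assms(1) assms(2) scale_closed[OF assms(2)], of "-1"]
    sublinear_zero[OF assms(1)] add_neg[OF assms(2)] by simp

lemma sublinear_norm: "sublinear V (restrict (vnorm V) (carr V))"
  by (simp add: sublinear_def norm_triangle norm_scale add_closed scale_closed)

lemma tilt_le: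
  assumes g: "sublinear V g" and a: "a \<in> carr V" and u: "u \<in> carr V" and t: "0 \<le> t"
  shows "tilt V a g u \<le> g (vadd V u (vscale V (of_real t) a)) - t * g a"
proof -
  have "- g (neg u) \<le> g (vadd V u (vscale V (of_real s) a)) - s * g a" if "0 \<le> s" for s
  proof -
    let ?a = "vscale V (of_real s) a"
    have c: "?a \<in> carr V" "neg u \<in> carr V" using a u scale_closed by auto
    have "vadd V (neg u) (vadd V u ?a) = ?a"
      using c u add_assoc[of "neg u" u ?a] by (simp add: neg_add zero_add)
    thus ?thesis
      using sublinear_add[OF g c(2) add_closed[OF u c(1)]] sublinear_scale[OF g a that] by simp
  qed
  hence "bdd_below ((\<lambda>s. g (vadd V u (vscale V (of_real s) a)) - s * g a) ` {0..})"
    by (intro bdd_belowI[of _ "- g (neg u)"]) auto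
  thus ?thesis unfolding tilt_def using u t by (auto intro: cINF_lower)
qed

lemma tilt_greatest:
  assumes "u \<in> carr V" "\<And>t. 0 \<le> t \<Longrightarrow> c \<le> g (vadd V u (vscale V (of_real t) a)) - t * g a"
  shows "c \<le> tilt V a g u"
  unfolding tilt_def using assms by (auto intro: cINF_greatest)

lemma sublinear_tilt:
  assumes g: "sublinear V g" and a: "a \<in> carr V"
  shows "sublinear V (tilt V a g)"
  unfolding sublinear_def
proof (intro conjI ballI allI impI)
  show "tilt V a g \<in> extensional (carr V)" by (simp add: tilt_def)
  note ac = scale_closed[OF a]
  fix u assume u: "u \<in> carr V"
  show "tilt V a g (vadd V u v) \<le> tilt V a g u + tilt V a g v" if v: "v \<in> carr V" for v
  proof -
    have "tilt V a g (vadd V u v) - tilt V a g v \<le> g (vadd V u (vscale V (of_real s) a)) - s * g a"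
      if s: "0 \<le> s" for s
    proof -
      have "tilt V a g (vadd V u v) - (g (vadd V u (vscale V (of_real s) a)) - s * g a)
          \<le> g (vadd V v (vscale V (of_real t) a)) - t * g a" if t: "0 \<le> t" for t
      proof -
        let ?s = "vscale V (of_real s) a" and ?t = "vscale V (of_real t) a"
        have "vadd V (vadd V u v) (vscale V (of_real (s + t)) a) = vadd V (vadd V u ?s) (vadd V v ?t)"
          using u v ac[of "of_real s"] ac[of "of_real t"] a
          by (simp add: scale_add_left add_ac add_closed)
        hence "tilt V a g (vadd V u v) \<le> g (vadd V (vadd V u ?s) (vadd V v ?t)) - (s + t) * g a"
          using tilt_le[OF g a add_closed[OF u v], of "s + t"] s t by simp
        thus ?thesis
          using sublinear_add[OF g add_closed[OF u ac[of "of_real s"]] add_closed[OF v ac[of "of_real t"]]]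
          by (simp add: algebra_simps)
      qed
      from tilt_greatest[OF v this] show ?thesis by simp
    qed
    from tilt_greatest[OF u this] show ?thesis by simp
  qed
  have le: "tilt V a g (vscale V (of_real c) u) \<le> c * tilt V a g u" if c: "0 < c" and u: "u \<in> carr V" for c u
  proof -
    have "tilt V a g (vscale V (of_real c) u) / c \<le> g (vadd V u (vscale V (of_real t) a)) - t * g a"
      if t: "0 \<le> t" for t
    proof -
      have "vadd V (vscale V (of_real c) u) (vscale V (of_real (c * t)) a)
          = vscale V (of_real c) (vadd V u (vscale V (of_real t) a))"
        using u a ac by (simp add: scale_add_right scale_scale)
      hence "tilt V a g (vscale V (of_real c) u)
          \<le> c * (g (vadd V u (vscale V (of_real t) a)) - t * g a)"
        using tilt_le[OF g a scale_closed[OF u], of "c * t" "of_real c"] c t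
          sublinear_scale[OF g add_closed[OF u ac], of c "of_real t"] by (simp add: algebra_simps)
      thus ?thesis using c by (simp add: field_simps)
    qed
    from tilt_greatest[OF u this] show ?thesis using c by (simp add: field_simps)
  qed
  fix t :: real assume t: "0 \<le> t"
  show "tilt V a g (vscale V (of_real t) u) = t * tilt V a g u"
  proof (cases "t = 0")
    case True
    have "0 \<le> tilt V a g (vzero V)"
      using sublinear_scale[OF g a] ac by (intro tilt_greatest zero_closed) (simp add: zero_add)
    moreover have "tilt V a g (vzero V) \<le> 0"
      using tilt_le[OF g a zero_closed, of 0] sublinear_zero[OF g] scale_zero[OF a] add_zero[OF zero_closed] by simp
    ultimately show ?thesis using True u by (simp add: scale_zero)
  next
    case False
    hence t: "0 < t" using t by simp
    have "vscale V (of_real (1 / t)) (vscale V (of_real t) u) = u"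
      using u t by (simp add: scale_scale scale_one flip: of_real_mult)
    with le[of "1 / t" "vscale V (of_real t) u"] have "t * tilt V a g u \<le> tilt V a g (vscale V (of_real t) u)"
      using t u scale_closed by (simp add: field_simps)
    thus ?thesis using le[OF t u] by simp
  qed
qed

lemma tilt_le_self:
  assumes "sublinear V g" "a \<in> carr V" "u \<in> carr V" shows "tilt V a g u \<le> g u"
  using tilt_le[OF assms, of 0] assms scale_zero add_zero by simp

lemma tilt_neg: assumes "sublinear V g" "a \<in> carr V" shows "tilt V a g (neg a) \<le> - g a"
  using tilt_le[OF assms scale_closed[OF assms(2)], of 1 "-1"] sublinear_zero[OF assms(1)]
  by (simp add: assms neg_add scale_one)

text \<open>
  Zorn's lemma, with the pointwise infimum as lower bound of a chain; it is finite because every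
  sublinear \<open>g \<le> g0\<close> satisfies \<open>g(u) \<ge> -g(-u) \<ge> -g0(-u)\<close>.
\<close>

lemma minimal_sublinear:
  assumes g0: "sublinear V g0"
  obtains f where "sublinear V f" "\<And>u. u \<in> carr V \<Longrightarrow> f u \<le> g0 u"
    "\<And>g. \<lbrakk>sublinear V g; \<And>u. u \<in> carr V \<Longrightarrow> g u \<le> f u\<rbrakk> \<Longrightarrow> g = f"
proof -
  define A where "A = {g. sublinear V g \<and> (\<forall>u\<in>carr V. g u \<le> g0 u)}"
  define P where "P g h \<longleftrightarrow> (\<forall>u\<in>carr V. h u \<le> g u)" for g h :: "'v \<Rightarrow> real"
  have "\<exists>m\<in>A. \<forall>g\<in>A. P m g \<longrightarrow> g = m"
  proof (rule predicate_Zorn)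
    show "partial_order_on A (relation_of P A)"
    proof (rule partial_order_on_relation_ofI)
      fix g h assume "g \<in> A" "h \<in> A" "P g h" "P h g"
      thus "g = h" unfolding A_def P_def
        by (intro extensionalityI[of _ "carr V"]) (auto intro: antisym simp: sublinear_ext)
    qed (auto simp: P_def intro: order_trans)
    fix C assume C: "C \<in> Chains (relation_of P A)"
    hence CA: "g \<in> A" if "g \<in> C" for g using that by (auto simp: Chains_def relation_of_def)
    have lin: "P g h \<or> P h g" if "g \<in> C" "h \<in> C" for g h
      using C that by (auto simp: Chains_def relation_of_def)
    show "\<exists>m\<in>A. \<forall>g\<in>C. P g m"
    proof (cases "C = {}")
      case True thus ?thesis using g0 by (auto simp: A_def)
    next
      case False
      define m where "m = (\<lambda>u\<in>carr V. INF g\<in>C. g u)"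
      have low: "m u \<le> g u" if g: "g \<in> C" and u: "u \<in> carr V" for g u
      proof -
        have "- g0 (neg u) \<le> g u" if "g \<in> C" for g
          using CA[OF that] sublinear_neg[of g u] u scale_closed[OF u, of "-1"] unfolding A_def by force
        hence "bdd_below ((\<lambda>g. g u) ` C)" by (intro bdd_belowI[of _ "- g0 (neg u)"]) auto
        thus ?thesis unfolding m_def using g u by (auto intro: cINF_lower)
      qed
      have great: "c \<le> m u" if "u \<in> carr V" "\<And>g. g \<in> C \<Longrightarrow> c \<le> g u" for c u
        unfolding m_def using that False by (auto intro: cINF_greatest)
      have "sublinear V m"
        unfolding sublinear_def
      proof (intro conjI ballI allI impI)
        show "m \<in> extensional (carr V)" by (simp add: m_def)
        fix u assume u: "u \<in> carr V"
        show "m (vadd V u v) \<le> m u + m v" if v: "v \<in> carr V" for v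
        proof -
          \<comment> \<open>Two members of the chain are comparable, so the smaller one serves for both arguments.\<close>
          have gh: "m (vadd V u v) \<le> g u + h v" if gh: "g \<in> C" "h \<in> C" for g h
          proof -
            have s: "sublinear V g" "sublinear V h" using CA gh by (auto simp: A_def)
            show ?thesis
              using lin[OF gh] low[OF gh(1) add_closed[OF u v]] low[OF gh(2) add_closed[OF u v]]
                sublinear_add[OF s(1) u v] sublinear_add[OF s(2) u v] u v unfolding P_def by force
          qed
          have "m (vadd V u v) - g u \<le> m v" if "g \<in> C" for g
            using gh[OF that] by (intro great v) (simp add: diff_le_eq add.commute)
          hence "m (vadd V u v) - m v \<le> m u" by (intro great u) (simp add: diff_le_eq add.commute)
          thus ?thesis by simp
        qed
        fix t :: real assume t: "0 \<le> t"
        have tu: "vscale V (of_real t) u \<in> carr V" using u scale_closed by blast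
        have sc: "g (vscale V (of_real t) u) = t * g u" if "g \<in> C" for g
          using CA[OF that] sublinear_scale u t by (auto simp: A_def)
        show "m (vscale V (of_real t) u) = t * m u"
        proof (rule antisym)
          show "t * m u \<le> m (vscale V (of_real t) u)"
            by (intro great tu) (use low[OF _ u] t sc in \<open>metis mult_left_mono\<close>)
          show "m (vscale V (of_real t) u) \<le> t * m u"
          proof (cases "t = 0")
            case True
            obtain g where "g \<in> C" using False by blast
            thus ?thesis using low[OF _ tu] sc True by fastforce
          next
            case False
            hence "m (vscale V (of_real t) u) / t \<le> m u"
              using t low[OF _ tu] sc by (intro great u) (auto simp: field_simps)
            thus ?thesis using t False by (simp add: field_simps)
          qed
        qed
      qed
      moreover have "m u \<le> g0 u" if "u \<in> carr V" for u
      proof -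
        obtain g where g: "g \<in> C" using False by blast
        show ?thesis using low[OF g that] CA[OF g] that by (force simp: A_def)
      qed
      ultimately show ?thesis using low by (auto simp: A_def P_def)
    qed
  qed
  then obtain f where "f \<in> A" "\<forall>g\<in>A. P f g \<longrightarrow> g = f" by blast
  thus ?thesis
    by (intro that[of f]) (auto simp: A_def P_def, meson order_trans)
qed

text \<open>
  Tilting the norm at \<open>e\<close> before passing to a minimal functional \<open>f\<close> ensures \<open>f(-e) \<le> -\<parallel>e\<parallel>\<close>.
\<close>

lemma norming_real_functional:
  assumes e: "e \<in> carr V"
  obtains f where "\<And>u v. \<lbrakk>u \<in> carr V; v \<in> carr V\<rbrakk> \<Longrightarrow> f (vadd V u v) = f u + f v"
    "\<And>t u. u \<in> carr V \<Longrightarrow> f (vscale V (of_real t) u) = t * f u"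
    "\<And>u. u \<in> carr V \<Longrightarrow> f u \<le> vnorm V u" "vnorm V e \<le> f e"
proof -
  let ?n = "restrict (vnorm V) (carr V)"
  obtain f where f: "sublinear V f" and le: "\<And>u. u \<in> carr V \<Longrightarrow> f u \<le> tilt V e ?n u"
    and min: "\<And>g. \<lbrakk>sublinear V g; \<And>u. u \<in> carr V \<Longrightarrow> g u \<le> f u\<rbrakk> \<Longrightarrow> g = f"
    using minimal_sublinear[OF sublinear_tilt[OF sublinear_norm e]] by blast
  have neg: "f (neg u) = - f u" if u: "u \<in> carr V" for u
  proof -
    have "tilt V u f = f" using sublinear_tilt[OF f u] tilt_le_self[OF f u] by (rule min)
    thus ?thesis using tilt_neg[OF f u] sublinear_neg[OF f u] by simp
  qed
  show ?thesis
  proof (rule that[of f])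
    show "f (vadd V u v) = f u + f v" if uv: "u \<in> carr V" "v \<in> carr V" for u v
      using sublinear_add[OF f uv] sublinear_add[OF f scale_closed[OF uv(1), of "-1"] scale_closed[OF uv(2), of "-1"]]
        neg[OF uv(1)] neg[OF uv(2)] neg[OF add_closed[OF uv]] scale_add_right[OF uv, of "-1"] by simp
    show "f (vscale V (of_real t) u) = t * f u" if u: "u \<in> carr V" for t u
    proof (cases "0 \<le> t")
      case False
      have "vscale V (of_real t) u = neg (vscale V (of_real (- t)) u)" using u by (simp add: scale_scale)
      thus ?thesis
        using neg[OF scale_closed[OF u, of "of_real (- t)"]] sublinear_scale[OF f u, of "- t"] False by simp
    qed (simp add: sublinear_scale f u)
    show "f u \<le> vnorm V u" if "u \<in> carr V" for u
      using le[OF that] tilt_le_self[OF sublinear_norm e that] that by simp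
    show "vnorm V e \<le> f e"
      using le[OF scale_closed[OF e], of "-1"] tilt_neg[OF sublinear_norm e] neg[OF e] e by simp
  qed
qed

end

text \<open>
  The consequence of the Hahn-Banach theorem that the rest of the proof rests on.  It is a hypothesis
  on the space below, so that real and complex scalars are treated together.
\<close>

definition norming :: "('k :: real_normed_field, 'v) nspace \<Rightarrow> bool" where
  "norming V \<longleftrightarrow> (\<forall>e\<in>carr V. \<exists>b\<in>carr (dual V). vnorm (dual V) b \<le> 1 \<and> vnorm V e \<le> norm (b e))"

lemma op_norm_le:
  assumes "0 \<le> c" "\<And>u. u \<in> carr V \<Longrightarrow> vnorm W (B u) \<le> c * vnorm V u"
  shows "op_norm V W B \<le> c"
  unfolding op_norm_def using assms by (intro cInf_lower bdd_belowI[of _ 0]) auto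

lemma scalars_simps [simp]:
  "carr scalars = UNIV" "vadd scalars = (+)" "vzero scalars = 0" "vscale scalars = (*)" "vnorm scalars = norm"
  by (simp_all add: scalars_def)

lemma dual_simps:
  "carr (dual V) = bounded_ops V scalars" "vnorm (dual V) = op_norm V scalars"
  by (simp_all add: dual_def function_space_def)

lemma norming_real:
  fixes V :: "(real, 'v) nspace"
  assumes "normed_space V" shows "norming V"
  unfolding norming_def
proof
  interpret normed_space V by fact
  fix e assume e: "e \<in> carr V"
  obtain f where f: "\<And>u v. \<lbrakk>u \<in> carr V; v \<in> carr V\<rbrakk> \<Longrightarrow> f (vadd V u v) = f u + f v"
    "\<And>t u. u \<in> carr V \<Longrightarrow> f (vscale V (of_real t) u) = t * f u"
    "\<And>u. u \<in> carr V \<Longrightarrow> f u \<le> vnorm V u" "vnorm V e \<le> f e"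
    using norming_real_functional[OF e] by blast
  have bound: "norm (f u) \<le> 1 * vnorm V u" if "u \<in> carr V" for u
    using f(3)[OF that] f(3)[OF scale_closed[OF that, of "-1"]] f(2)[OF that, of "-1"] norm_scale[OF that, of "-1"]
    by (simp add: abs_le_iff)
  let ?b = "restrict f (carr V)"
  have "?b \<in> bounded_ops V scalars"
    using f(1) f(2) bound by (auto simp: bounded_ops_def add_closed scale_closed intro!: exI[of _ 1])
  moreover have "op_norm V scalars ?b \<le> 1"
    using bound by (intro op_norm_le) auto
  ultimately show "\<exists>b\<in>carr (dual V). vnorm (dual V) b \<le> 1 \<and> vnorm V e \<le> norm (b e)"
    using f(4) e by (intro bexI[of _ ?b]) (auto simp: dual_simps)
qed

text \<open>
  A real functional \<open>f\<close> is the real part of the complex functional \<open>u \<mapsto> f(u) - i f(iu)\<close>, whose modulus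
  at \<open>u\<close> is a value of \<open>f\<close> at a unimodular multiple of \<open>u\<close>.
\<close>

lemma norming_complex:
  fixes V :: "(complex, 'v) nspace"
  assumes "normed_space V" shows "norming V"
  unfolding norming_def
proof
  interpret normed_space V by fact
  fix e assume e: "e \<in> carr V"
  obtain f where f: "\<And>u v. \<lbrakk>u \<in> carr V; v \<in> carr V\<rbrakk> \<Longrightarrow> f (vadd V u v) = f u + f v"
    "\<And>t u. u \<in> carr V \<Longrightarrow> f (vscale V (of_real t) u) = t * f u"
    "\<And>u. u \<in> carr V \<Longrightarrow> f u \<le> vnorm V u" "vnorm V e \<le> f e"
    using norming_real_functional[OF e] by blast
  define F where "F = (\<lambda>u\<in>carr V. Complex (f u) (- f (vscale V \<i> u)))"
  have add: "F (vadd V u v) = F u + F v" if "u \<in> carr V" "v \<in> carr V" for u v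
    using that f(1) by (simp add: F_def add_closed scale_closed scale_add_right complex_eq_iff)
  have scale: "F (vscale V a u) = a * F u" if u: "u \<in> carr V" for a u
  proof -
    have iu: "vscale V \<i> u \<in> carr V" using u scale_closed by blast
    have "vscale V a u = vadd V (vscale V (of_real (Re a)) u) (vscale V (of_real (Im a)) (vscale V \<i> u))"
      using scale_add_left[OF u, of "of_real (Re a)" "of_real (Im a) * \<i>"] scale_scale[OF u]
        complex_eq[of a] by (simp add: mult.commute)
    hence 1: "f (vscale V a u) = Re a * f u + Im a * f (vscale V \<i> u)"
      using f(1,2) u iu scale_closed by simp
    have "vscale V \<i> (vscale V a u) = vadd V (vscale V (of_real (Re a)) (vscale V \<i> u)) (vscale V (of_real (- Im a)) u)"
      using scale_add_left[OF u, of "of_real (Re a) * \<i>" "of_real (- Im a)"] scale_scale[OF u]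
        complex_eq[of "\<i> * a"] by (simp add: mult.commute add.commute)
    hence 2: "f (vscale V \<i> (vscale V a u)) = Re a * f (vscale V \<i> u) - Im a * f u"
      using f(1) f(2)[OF u, of "- Im a"] f(2)[OF iu] u iu scale_closed by simp
    show ?thesis using 1 2 u by (simp add: F_def scale_closed complex_eq_iff algebra_simps)
  qed
  have bound: "norm (F u) \<le> 1 * vnorm V u" if u: "u \<in> carr V" for u
  proof (cases "F u = 0")
    case False
    define a where "a = cnj (F u) / norm (F u)"
    have "norm a = 1" using False by (simp add: a_def norm_divide)
    moreover have "a * F u = norm (F u)"
      using False by (simp add: a_def complex_norm_square[symmetric] power2_eq_square mult.commute[of "cnj _"])
    hence "f (vscale V a u) = norm (F u)"
      using scale[OF u, of a] u scale_closed by (simp add: F_def complex_eq_iff)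
    ultimately show ?thesis using f(3)[OF scale_closed[OF u, of a]] norm_scale[OF u, of a] by simp
  qed (simp add: norm_nonneg u)
  have "F \<in> bounded_ops V scalars"
    using add scale bound by (auto simp: bounded_ops_def intro!: exI[of _ 1]) (auto simp: F_def)
  moreover have "op_norm V scalars F \<le> 1"
    using bound by (intro op_norm_le) auto
  moreover have "vnorm V e \<le> norm (F e)"
    using f(4) e complex_Re_le_cmod[of "F e"] by (simp add: F_def)
  ultimately show "\<exists>b\<in>carr (dual V). vnorm (dual V) b \<le> 1 \<and> vnorm V e \<le> norm (b e)"
    by (intro bexI[of _ F]) (auto simp: dual_simps)
qed

section \<open>The scalar field as a Banach space\<close>

lemma normed_space_scalars: "normed_space (scalars :: ('k :: real_normed_field, 'k) nspace)"
  by standard (auto simp: algebra_simps norm_mult norm_triangle_ineq intro: exI[of _ "- _"])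

lemma scalars_vsub [simp]: "vsub scalars a b = a - b"
  by (simp add: vsub_def)

lemma scalars_mdist [simp]: "mdist (norm_metric scalars) a b = norm (a - b)"
  using normed_space.mdist_norm_metric[OF normed_space_scalars] by simp

lemma scalars_mspace [simp]: "mspace (norm_metric scalars) = UNIV"
  using normed_space.mspace_norm_metric[OF normed_space_scalars] by simp

lemma banach_scalars: "banach_space (scalars :: ('k :: {real_normed_field, banach}, 'k) nspace)"
  unfolding banach_space_def normed_space.mcomplete_norm_metric_iff[OF normed_space_scalars]
proof (intro conjI normed_space_scalars allI impI)
  fix s :: "nat \<Rightarrow> 'k"
  assume "(\<forall>n. s n \<in> carr scalars) \<and> (\<forall>e>0. \<exists>N. \<forall>m\<ge>N. \<forall>n\<ge>N. vnorm scalars (vsub scalars (s m) (s n)) < e)"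
  hence "Cauchy s" by (simp add: Cauchy_def dist_norm)
  then obtain l where "s \<longlonglongrightarrow> l" using Cauchy_convergent_iff convergent_def by blast
  thus "\<exists>l\<in>carr scalars. \<forall>e>0. \<exists>N. \<forall>n\<ge>N. vnorm scalars (vsub scalars (s n) l) < e"
    by (auto simp: LIMSEQ_iff)
qed

section \<open>Lipschitz maps and bounded operators\<close>

lemma lip_maps_closed: "\<lbrakk>T \<in> lip_maps X Y; x \<in> points X\<rbrakk> \<Longrightarrow> T x \<in> points Y"
  and lip_maps_base: "T \<in> lip_maps X Y \<Longrightarrow> T (base X) = base Y"
  and lip_maps_ext: "T \<in> lip_maps X Y \<Longrightarrow> T \<in> extensional (points X)"
  by (auto simp: lip_maps_def Lipschitz_continuous_map_def)

lemma lip_mapsI: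
  assumes "T \<in> extensional (points X)" "\<And>x. x \<in> points X \<Longrightarrow> T x \<in> points Y" "T (base X) = base Y"
    "\<And>x y. \<lbrakk>x \<in> points X; y \<in> points X\<rbrakk> \<Longrightarrow> pdist Y (T x) (T y) \<le> L * pdist X x y"
  shows "T \<in> lip_maps X Y"
  using assms by (auto simp: lip_maps_def Lipschitz_continuous_map_def)

lemma lip_const_le:
  assumes "0 \<le> L" "\<And>x y. \<lbrakk>x \<in> points X; y \<in> points X\<rbrakk> \<Longrightarrow> pdist Y (T x) (T y) \<le> L * pdist X x y"
  shows "lip_const X Y T \<le> L"
  unfolding lip_const_def using assms by (intro cInf_lower bdd_belowI[of _ 0]) auto

lemma Inf_mult_le:
  assumes "S \<noteq> {}" "\<And>L. L \<in> S \<Longrightarrow> a \<le> L * d" "0 \<le> (d::real)"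
  shows "a \<le> Inf S * d"
proof (cases "d = 0")
  case False
  hence "a / d \<le> Inf S" using assms by (intro cInf_greatest) (auto simp: field_simps)
  thus ?thesis using False assms by (simp add: field_simps)
qed (use assms in auto)

lemma lip_maps_bound:
  assumes T: "T \<in> lip_maps X Y"
  shows "0 \<le> lip_const X Y T"
    and "\<lbrakk>x \<in> points X; y \<in> points X\<rbrakk> \<Longrightarrow> pdist Y (T x) (T y) \<le> lip_const X Y T * pdist X x y"
proof -
  let ?S = "{L. 0 \<le> L \<and> (\<forall>x\<in>points X. \<forall>y\<in>points X. pdist Y (T x) (T y) \<le> L * pdist X x y)}"
  obtain B where "B > 0" "\<forall>x\<in>points X. \<forall>y\<in>points X. pdist Y (T x) (T y) \<le> B * pdist X x y"
    using T unfolding lip_maps_def Lipschitz_continuous_map_pos by blast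
  hence ne: "?S \<noteq> {}" by (auto intro: exI[of _ B])
  show "0 \<le> lip_const X Y T" unfolding lip_const_def using ne by (intro cInf_greatest) auto
  show "pdist Y (T x) (T y) \<le> lip_const X Y T * pdist X x y" if "x \<in> points X" "y \<in> points X"
    unfolding lip_const_def using that by (intro Inf_mult_le ne) auto
qed

lemma sharp_simps:
  "carr (sharp X) = lip_maps X (origin_pointed scalars)" "vnorm (sharp X) = lip_const X (origin_pointed scalars)"
  by (simp_all add: sharp_def function_space_def)

lemma sharp_ball_bound:
  assumes "f \<in> unit_ball (sharp X)" "x \<in> points X" "y \<in> points X"
  shows "norm (f x - f y) \<le> pdist X x y"
proof -
  have f: "f \<in> lip_maps X (origin_pointed scalars)" "lip_const X (origin_pointed scalars) f \<le> 1"
    using assms(1) by (auto simp: unit_ball_def sharp_simps)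
  have "norm (f x - f y) \<le> lip_const X (origin_pointed scalars) f * pdist X x y"
    using lip_maps_bound(2)[OF f(1) assms(2,3)] by simp
  also have "\<dots> \<le> 1 * pdist X x y" using f(2) by (intro mult_right_mono) auto
  finally show ?thesis by simp
qed

lemma sharp_ballI:
  assumes "f \<in> extensional (points X)" "f (base X) = 0"
    "\<And>x y. \<lbrakk>x \<in> points X; y \<in> points X\<rbrakk> \<Longrightarrow> norm (f x - f y) \<le> pdist X x y"
  shows "f \<in> unit_ball (sharp X)"
  using assms lip_mapsI[of f X "origin_pointed scalars" 1] lip_const_le[of 1 X "origin_pointed scalars" f]
  by (simp add: unit_ball_def sharp_simps)

lemma zero_in_sharp_ball:
  "pointed_metric_space X \<Longrightarrow> (\<lambda>x\<in>points X. 0) \<in> unit_ball (sharp X)"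
  by (rule sharp_ballI) (auto simp: pointed_metric_space_def)

lemma bounded_opsD:
  assumes "B \<in> bounded_ops V W"
  shows "B \<in> extensional (carr V)" "u \<in> carr V \<Longrightarrow> B u \<in> carr W"
    "\<lbrakk>u \<in> carr V; v \<in> carr V\<rbrakk> \<Longrightarrow> B (vadd V u v) = vadd W (B u) (B v)"
    "u \<in> carr V \<Longrightarrow> B (vscale V a u) = vscale W a (B u)"
  using assms by (auto simp: bounded_ops_def PiE_iff)

lemma bounded_opsI:
  assumes "B \<in> extensional (carr V)" "\<And>u. u \<in> carr V \<Longrightarrow> B u \<in> carr W"
    "\<And>u v. \<lbrakk>u \<in> carr V; v \<in> carr V\<rbrakk> \<Longrightarrow> B (vadd V u v) = vadd W (B u) (B v)"
    "\<And>a u. u \<in> carr V \<Longrightarrow> B (vscale V a u) = vscale W a (B u)"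
    "\<And>u. u \<in> carr V \<Longrightarrow> vnorm W (B u) \<le> c * vnorm V u"
  shows "B \<in> bounded_ops V W"
  using assms by (auto simp: bounded_ops_def PiE_iff intro!: exI[of _ c])

lemma bounded_ops_sub:
  assumes "B \<in> bounded_ops V W" "normed_space V" "u \<in> carr V" "v \<in> carr V"
  shows "B (vsub V u v) = vsub W (B u) (B v)"
  using assms bounded_opsD[OF assms(1)] normed_space.scale_closed[OF assms(2)] by (simp add: vsub_def)

text \<open>
  The hypothesis on \<open>vnorm V\<close> is stated in a form that is immediate when \<open>V\<close> is a dual space.
\<close>

lemma op_norm_bound:
  assumes B: "B \<in> bounded_ops V W" and nonneg: "\<And>u. u \<in> carr V \<Longrightarrow> 0 \<le> vnorm V u"
  shows "0 \<le> op_norm V W B" and "u \<in> carr V \<Longrightarrow> vnorm W (B u) \<le> op_norm V W B * vnorm V u"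
proof -
  let ?S = "{c. 0 \<le> c \<and> (\<forall>u\<in>carr V. vnorm W (B u) \<le> c * vnorm V u)}"
  obtain c where c: "\<And>u. u \<in> carr V \<Longrightarrow> vnorm W (B u) \<le> c * vnorm V u"
    using B unfolding bounded_ops_def by blast
  have "vnorm W (B u) \<le> \<bar>c\<bar> * vnorm V u" if "u \<in> carr V" for u
    using c[OF that] mult_right_mono[OF abs_ge_self, of "vnorm V u" c] nonneg[OF that] by linarith
  hence ne: "?S \<noteq> {}" by (auto intro!: exI[of _ "\<bar>c\<bar>"])
  show "0 \<le> op_norm V W B" unfolding op_norm_def using ne by (intro cInf_greatest) auto
  show "vnorm W (B u) \<le> op_norm V W B * vnorm V u" if "u \<in> carr V"
    unfolding op_norm_def using that nonneg[OF that] by (intro Inf_mult_le ne) auto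
qed

lemma dual_norm_nonneg: "\<lbrakk>b \<in> carr (dual V); normed_space V\<rbrakk> \<Longrightarrow> 0 \<le> vnorm (dual V) b"
  using op_norm_bound(1)[of b V scalars] normed_space.norm_nonneg[of V] by (simp add: dual_simps)

lemma dual_bound:
  assumes "b \<in> carr (dual V)" "\<And>u. u \<in> carr V \<Longrightarrow> 0 \<le> vnorm V u" "u \<in> carr V"
  shows "norm (b u) \<le> vnorm (dual V) b * vnorm V u"
  using op_norm_bound(2)[of b V scalars u] assms by (simp add: dual_simps)

lemma dual_ball_bound:
  assumes "b \<in> unit_ball (dual V)" "\<And>u. u \<in> carr V \<Longrightarrow> 0 \<le> vnorm V u" "u \<in> carr V"
  shows "norm (b u) \<le> vnorm V u"
proof -
  have b: "b \<in> carr (dual V)" "vnorm (dual V) b \<le> 1" using assms(1) by (auto simp: unit_ball_def)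
  have "norm (b u) \<le> vnorm (dual V) b * vnorm V u" using dual_bound[OF b(1) assms(2,3)] .
  also have "\<dots> \<le> 1 * vnorm V u" using b(2) assms(2,3) by (intro mult_right_mono) auto
  finally show ?thesis by simp
qed

lemma dual_ballI:
  assumes "b \<in> bounded_ops V scalars" "\<And>u. u \<in> carr V \<Longrightarrow> norm (b u) \<le> vnorm V u"
  shows "b \<in> unit_ball (dual V)"
  using assms op_norm_le[of 1 V scalars b] by (simp add: unit_ball_def dual_simps)

lemma dual_ops:
  "vadd (dual V) f g = (\<lambda>x\<in>carr V. f x + g x)" "vscale (dual V) a f = (\<lambda>x\<in>carr V. a * f x)"
  "vzero (dual V) = (\<lambda>x\<in>carr V. 0)"
  by (simp_all add: dual_def function_space_def)

section \<open>Summing constants\<close>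

lemma powr_le_powr_inverse_iff:
  "\<lbrakk>0 < p; 0 \<le> a; 0 \<le> b\<rbrakk> \<Longrightarrow> a powr (1 / p) \<le> b \<longleftrightarrow> a \<le> b powr (p::real)"
  using powr_mono2[of p "a powr (1/p)" b] powr_mono2[of "1/p" a "b powr p"] by (auto simp: powr_powr)

text \<open>
  The suprema on the right-hand sides of the two definitions of summing maps.  The scalar field occurs
  only in the functions over which the supremum is taken, so \<open>weak_lip\<close> receives it as a type argument.
\<close>

definition weak_lip :: "'k :: real_normed_field itself \<Rightarrow> real \<Rightarrow> 'x pointed \<Rightarrow> nat \<Rightarrow> (nat \<Rightarrow> 'x) \<Rightarrow> (nat \<Rightarrow> 'x) \<Rightarrow> (nat \<Rightarrow> real) \<Rightarrow> real" where
  "weak_lip k p X n x y lam =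
     (SUP f\<in>unit_ball (sharp X :: ('k, 'x \<Rightarrow> 'k) nspace).
        (\<Sum>j<n. lam j powr p * norm (f (x j) - f (y j)) powr p) powr (1 / p))"

definition weak_norm :: "real \<Rightarrow> ('k :: real_normed_field, 'v) nspace \<Rightarrow> nat \<Rightarrow> (nat \<Rightarrow> 'v) \<Rightarrow> real" where
  "weak_norm q E n u = (SUP \<phi>\<in>unit_ball (dual E). (\<Sum>j<n. norm (\<phi> (u j)) powr q) powr (1 / q))"

lemma weak_lip_upper:
  fixes f :: "'x \<Rightarrow> 'k :: real_normed_field"
  assumes "1 \<le> p" "f \<in> unit_ball (sharp X)" "\<forall>j<n. x j \<in> points X \<and> y j \<in> points X \<and> 0 < lam j"
  shows "(\<Sum>j<n. lam j powr p * norm (f (x j) - f (y j)) powr p) powr (1 / p) \<le> weak_lip TYPE('k) p X n x y lam"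
proof -
  have "(\<Sum>j<n. lam j powr p * norm (f (x j) - f (y j)) powr p) powr (1 / p)
     \<le> (\<Sum>j<n. lam j powr p * pdist X (x j) (y j) powr p) powr (1 / p)"
    if "f \<in> unit_ball (sharp X)" for f :: "'x \<Rightarrow> 'k"
    using assms(1,3) sharp_ball_bound[OF that]
    by (intro powr_mono2 sum_mono sum_nonneg mult_left_mono) auto
  thus ?thesis unfolding weak_lip_def using assms(2)
    by (intro cSUP_upper bdd_aboveI[of _ "(\<Sum>j<n. lam j powr p * pdist X (x j) (y j) powr p) powr (1 / p)"]) auto
qed

lemma weak_lip_nonneg:
  assumes "1 \<le> p" "pointed_metric_space X" "\<forall>j<n. x j \<in> points X \<and> y j \<in> points X \<and> 0 < lam j"
  shows "0 \<le> weak_lip TYPE('k :: real_normed_field) p X n x y lam"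
  by (rule order_trans[OF _ weak_lip_upper[OF assms(1) zero_in_sharp_ball[OF assms(2)] assms(3)]]) simp

text \<open>
  Evaluations are the elements of the bidual ball through which a summing operator on a dual space
  is tested.
\<close>

lemma bidual_ball_eval:
  fixes F :: "('k :: real_normed_field, 'f) nspace"
  assumes F: "normed_space F" and e: "e \<in> carr F" and t: "vnorm F e \<le> t" "0 < t"
  shows "(\<lambda>b\<in>carr (dual F). b e / of_real t) \<in> unit_ball (dual (dual F))"
proof (rule dual_ballI)
  interpret normed_space F by fact
  have bound: "norm (b e / of_real t) \<le> vnorm (dual F) b" if b: "b \<in> carr (dual F)" for b
  proof -
    have "norm (b e) \<le> vnorm (dual F) b * vnorm F e" using dual_bound[OF b norm_nonneg e] .
    also have "\<dots> \<le> vnorm (dual F) b * t" using dual_norm_nonneg[OF b F] t by (intro mult_left_mono)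
    finally show ?thesis using t by (simp add: norm_divide field_simps)
  qed
  thus "\<And>b. b \<in> carr (dual F) \<Longrightarrow> norm ((\<lambda>b\<in>carr (dual F). b e / of_real t) b) \<le> vnorm (dual F) b" by simp
  show "(\<lambda>b\<in>carr (dual F). b e / of_real t) \<in> bounded_ops (dual F) scalars"
    using bound e by (intro bounded_opsI[of _ _ _ 1]) (auto simp: dual_closed[unfolded dual_ops] dual_ops add_divide_distrib)
qed

lemma bidual_ball_nonempty: assumes F: "normed_space F" shows "unit_ball (dual (dual F)) \<noteq> {}"
proof -
  interpret normed_space F by fact
  have "vnorm F (vzero F) \<le> 1" using norm_eq_zero[OF zero_closed] by simp
  from bidual_ball_eval[OF F zero_closed this] show ?thesis by auto
qed

lemma weak_norm_upper:
  assumes "1 \<le> q" "\<phi> \<in> unit_ball (dual E)" "\<forall>j<n. u j \<in> carr E" and nn: "\<And>u. u \<in> carr E \<Longrightarrow> 0 \<le> vnorm E u"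
  shows "(\<Sum>j<n. norm (\<phi> (u j)) powr q) powr (1 / q) \<le> weak_norm q E n u"
proof -
  have "(\<Sum>j<n. norm (\<phi> (u j)) powr q) powr (1 / q) \<le> (\<Sum>j<n. vnorm E (u j) powr q) powr (1 / q)"
    if "\<phi> \<in> unit_ball (dual E)" for \<phi>
    using assms(1,3) dual_ball_bound[OF that nn]
    by (intro powr_mono2 sum_mono sum_nonneg) auto
  thus ?thesis unfolding weak_norm_def using assms(2)
    by (intro cSUP_upper bdd_aboveI[of _ "(\<Sum>j<n. vnorm E (u j) powr q) powr (1 / q)"]) auto
qed

lemma weak_norm_nonneg:
  assumes "1 \<le> q" "normed_space F" "\<forall>j<n. u j \<in> carr (dual F)"
  shows "0 \<le> weak_norm q (dual F) n u"
proof -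
  obtain \<phi> where "\<phi> \<in> unit_ball (dual (dual F))"
    using bidual_ball_nonempty[OF assms(2)] by blast
  from weak_norm_upper[OF assms(1) this assms(3)] show ?thesis
    using dual_norm_nonneg[OF _ assms(2)] by (metis order_trans powr_ge_zero)
qed

lemma lip_summing_consts_iff:
  fixes G :: "('k :: real_normed_field, 'v) nspace"
  shows "C \<in> lip_summing_consts p X G S \<longleftrightarrow> 0 \<le> C \<and>
    (\<forall>n x y lam. (\<forall>j<n. x j \<in> points X \<and> y j \<in> points X \<and> 0 < lam j) \<longrightarrow>
       (\<Sum>j<n. lam j powr p * vnorm G (vsub G (S (x j)) (S (y j))) powr p) powr (1 / p)
       \<le> C * weak_lip TYPE('k) p X n x y lam)"
  by (simp add: lip_summing_consts_def weak_lip_def)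

lemma lip_summing_constsD:
  fixes G :: "('k :: real_normed_field, 'v) nspace"
  assumes "C \<in> lip_summing_consts p X G S" "\<forall>j<n. x j \<in> points X \<and> y j \<in> points X \<and> 0 < lam j"
  shows "(\<Sum>j<n. lam j powr p * vnorm G (vsub G (S (x j)) (S (y j))) powr p) powr (1 / p)
    \<le> C * weak_lip TYPE('k) p X n x y lam"
  using assms by (simp add: lip_summing_consts_iff)

lemma summing_consts_iff:
  "C \<in> summing_consts q E H R \<longleftrightarrow> 0 \<le> C \<and>
    (\<forall>n u. (\<forall>j<n. u j \<in> carr E) \<longrightarrow>
       (\<Sum>j<n. vnorm H (R (u j)) powr q) powr (1 / q) \<le> C * weak_norm q E n u)"
  by (simp add: summing_consts_def weak_norm_def)

lemma summing_constsD:
  assumes "C \<in> summing_consts q E H R" "\<forall>j<n. u j \<in> carr E"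
  shows "(\<Sum>j<n. vnorm H (R (u j)) powr q) powr (1 / q) \<le> C * weak_norm q E n u"
  using assms by (simp add: summing_consts_iff)

lemma lip_summing_consts_mono:
  assumes C: "C \<in> lip_summing_consts p X G S" "C \<le> D" and "1 \<le> p" "pointed_metric_space X"
  shows "D \<in> lip_summing_consts p X G S"
  unfolding lip_summing_consts_iff
proof (intro conjI allI impI)
  show "0 \<le> D" using C by (simp add: lip_summing_consts_iff)
  fix n :: nat and x y and lam :: "nat \<Rightarrow> real" assume h: "\<forall>j<n. x j \<in> points X \<and> y j \<in> points X \<and> 0 < lam j"
  show "(\<Sum>j<n. lam j powr p * vnorm G (vsub G (S (x j)) (S (y j))) powr p) powr (1 / p)
       \<le> D * weak_lip TYPE('b) p X n x y lam"
    by (rule order_trans[OF lip_summing_constsD[OF C(1) h] mult_right_mono[OF C(2) weak_lip_nonneg[OF assms(3,4) h]]])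
qed

lemma summing_consts_mono:
  assumes C: "C \<in> summing_consts q (dual F) H R" "C \<le> D" and "1 \<le> q" "normed_space F"
  shows "D \<in> summing_consts q (dual F) H R"
  unfolding summing_consts_iff
proof (intro conjI allI impI)
  show "0 \<le> D" using C by (simp add: summing_consts_iff)
  fix n :: nat and u assume h: "\<forall>j<n. u j \<in> carr (dual F)"
  show "(\<Sum>j<n. vnorm H (R (u j)) powr q) powr (1 / q) \<le> D * weak_norm q (dual F) n u"
    by (rule order_trans[OF summing_constsD[OF C(1) h] mult_right_mono[OF C(2) weak_norm_nonneg[OF assms(3,4) h]]])
qed

text \<open>
  The case of a single pair of points in the summing inequality.
\<close>

lemma lip_summing_lipschitz:
  fixes G :: "('k :: real_normed_field, 'v) nspace"
  assumes C: "C \<in> lip_summing_consts p X G S" and p: "1 \<le> p" and X: "pointed_metric_space X"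
    and G: "normed_space G" and S: "S \<in> points X \<rightarrow> carr G" and x: "x \<in> points X" "y \<in> points X"
  shows "vnorm G (vsub G (S x) (S y)) \<le> C * pdist X x y"
proof -
  have "weak_lip TYPE('k) p X 1 (\<lambda>_. x) (\<lambda>_. y) (\<lambda>_. 1) \<le> pdist X x y"
    unfolding weak_lip_def using zero_in_sharp_ball[OF X] p sharp_ball_bound[of _ X x y] x
    by (intro cSUP_least) (auto simp: powr_powr)
  hence "C * weak_lip TYPE('k) p X 1 (\<lambda>_. x) (\<lambda>_. y) (\<lambda>_. 1) \<le> C * pdist X x y"
    using C by (intro mult_left_mono) (auto simp: lip_summing_consts_iff)
  moreover have "(\<Sum>j<1::nat. 1 powr p * vnorm G (vsub G (S x) (S y)) powr p) powr (1 / p)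
      \<le> C * weak_lip TYPE('k) p X 1 (\<lambda>_. x) (\<lambda>_. y) (\<lambda>_. 1)"
    using lip_summing_constsD[OF C, of 1 "\<lambda>_. x" "\<lambda>_. y" "\<lambda>_. 1"] x by simp
  moreover have "0 \<le> vnorm G (vsub G (S x) (S y))"
    using S x normed_space.norm_nonneg[OF G normed_space.sub_closed[OF G]] by auto
  ultimately show ?thesis using p by (simp add: powr_powr)
qed

lemma summing_bounded:
  assumes C: "C \<in> summing_consts q (dual F) H R" and q: "1 \<le> q"
    and F: "normed_space F" and H: "normed_space H" and R: "R \<in> carr (dual F) \<rightarrow> carr H" and b: "b \<in> carr (dual F)"
  shows "vnorm H (R b) \<le> C * vnorm (dual F) b"
proof -
  have "weak_norm q (dual F) 1 (\<lambda>_. b) \<le> vnorm (dual F) b"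
    unfolding weak_norm_def using bidual_ball_nonempty[OF F] q dual_ball_bound[of _ "dual F" b] dual_norm_nonneg[OF _ F] b
    by (intro cSUP_least) (auto simp: powr_powr)
  hence "C * weak_norm q (dual F) 1 (\<lambda>_. b) \<le> C * vnorm (dual F) b"
    using C by (intro mult_left_mono) (auto simp: summing_consts_iff)
  moreover have "(\<Sum>j<1::nat. vnorm H (R b) powr q) powr (1 / q) \<le> C * weak_norm q (dual F) 1 (\<lambda>_. b)"
    using summing_constsD[OF C, of 1 "\<lambda>_. b"] b by simp
  moreover have "0 \<le> vnorm H (R b)"
    using R b normed_space.norm_nonneg[OF H] by auto
  ultimately show ?thesis using q by (simp add: powr_powr)
qed

section \<open>Weighted sums of Banach spaces\<close>

lemma (in normed_space) abs_norm_sub_le: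
  assumes "u \<in> carr V" "v \<in> carr V" "w \<in> carr V"
  shows "\<bar>vnorm V (vsub V u v) - vnorm V (vsub V u w)\<bar> \<le> vnorm V (vsub V v w)"
  using norm_sub_triangle[OF assms(1,2,3)] norm_sub_triangle[OF assms(1,3,2)] norm_sub_commute[OF assms(2,3)] by simp

lemma (in normed_space) tendsto_norm_sub:
  assumes s: "\<And>n::nat. s n \<in> carr V" and l: "l \<in> carr V" and u: "u \<in> carr V"
    and lim: "(\<lambda>n. vnorm V (vsub V (s n) l)) \<longlonglongrightarrow> 0"
  shows "(\<lambda>n. vnorm V (vsub V u (s n))) \<longlonglongrightarrow> vnorm V (vsub V u l)"
proof (rule Lim_transform[OF tendsto_const])
  show "(\<lambda>n. vnorm V (vsub V u (s n)) - vnorm V (vsub V u l)) \<longlonglongrightarrow> 0"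
    using abs_norm_sub_le[OF u s l]
    by (intro Lim_null_comparison[OF _ lim]) simp
qed

lemma (in normed_space) tendsto_norm_sub_iff:
  assumes "\<And>n::nat. s n \<in> carr V" "l \<in> carr V"
  shows "(\<lambda>n. vnorm V (vsub V (s n) l)) \<longlonglongrightarrow> 0 \<longleftrightarrow> (\<forall>e>0. \<exists>N. \<forall>n\<ge>N. vnorm V (vsub V (s n) l) < e)"
  using norm_nonneg[OF sub_closed[OF assms]] by (simp add: LIMSEQ_iff)

lemma banach_space_limit:
  assumes "banach_space V" "\<And>n::nat. s n \<in> carr V"
    "\<forall>e>0. \<exists>N. \<forall>m\<ge>N. \<forall>n\<ge>N. vnorm V (vsub V (s m) (s n)) < e"
  obtains l where "l \<in> carr V" "(\<lambda>n. vnorm V (vsub V (s n) l)) \<longlonglongrightarrow> 0"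
proof -
  interpret normed_space V using assms(1) by (simp add: banach_space_def)
  show ?thesis
    using assms that unfolding banach_space_def mcomplete_norm_metric_iff
    by (metis tendsto_norm_sub_iff)
qed

lemma banach_spaceI:
  assumes V: "normed_space V"
    and lim: "\<And>s. \<lbrakk>\<And>n::nat. s n \<in> carr V; \<forall>e>0. \<exists>N. \<forall>m\<ge>N. \<forall>n\<ge>N. vnorm V (vsub V (s m) (s n)) < e\<rbrakk>
      \<Longrightarrow> \<exists>l\<in>carr V. (\<lambda>n. vnorm V (vsub V (s n) l)) \<longlonglongrightarrow> 0"
  shows "banach_space V"
  unfolding banach_space_def normed_space.mcomplete_norm_metric_iff[OF V]
proof (intro conjI V allI impI, elim conjE)
  fix s :: "nat \<Rightarrow> 'b" assume s: "\<forall>n. s n \<in> carr V" "\<forall>e>0. \<exists>N. \<forall>m\<ge>N. \<forall>n\<ge>N. vnorm V (vsub V (s m) (s n)) < e"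
  then obtain l where "l \<in> carr V" "(\<lambda>n. vnorm V (vsub V (s n) l)) \<longlonglongrightarrow> 0"
    using lim[of s] by blast
  thus "\<exists>l\<in>carr V. \<forall>e>0. \<exists>N. \<forall>n\<ge>N. vnorm V (vsub V (s n) l) < e"
    using normed_space.tendsto_norm_sub_iff[OF V, of s l] s by blast
qed

text \<open>
  The weights are absorbed into the norm rather than into the maps, so that the combination of maps
  \<open>S\<^sub>n\<close> is the plain sequence \<open>(S\<^sub>n x)\<^sub>n\<close>.
\<close>

definition lp_sum ::
  "real \<Rightarrow> (nat \<Rightarrow> real) \<Rightarrow> (nat \<Rightarrow> ('k :: real_normed_field, 'v) nspace) \<Rightarrow> ('k, nat \<Rightarrow> 'v) nspace" where
  "lp_sum p a V =
    \<lparr>carr = {u. (\<forall>n. u n \<in> carr (V n)) \<and> summable (\<lambda>n. a n * vnorm (V n) (u n) powr p)},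
     vadd = (\<lambda>u v n. vadd (V n) (u n) (v n)),
     vzero = (\<lambda>n. vzero (V n)),
     vscale = (\<lambda>c u n. vscale (V n) c (u n)),
     vnorm = (\<lambda>u. (\<Sum>n. a n * vnorm (V n) (u n) powr p) powr (1 / p))\<rparr>"

lemma lp_sum_simps:
  "u \<in> carr (lp_sum p a V) \<longleftrightarrow> (\<forall>n. u n \<in> carr (V n)) \<and> summable (\<lambda>n. a n * vnorm (V n) (u n) powr p)"
  "vadd (lp_sum p a V) u v = (\<lambda>n. vadd (V n) (u n) (v n))"
  "vzero (lp_sum p a V) = (\<lambda>n. vzero (V n))"
  "vscale (lp_sum p a V) c u = (\<lambda>n. vscale (V n) c (u n))"
  "vnorm (lp_sum p a V) u = (\<Sum>n. a n * vnorm (V n) (u n) powr p) powr (1 / p)"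
  "vsub (lp_sum p a V) u v = (\<lambda>n. vsub (V n) (u n) (v n))"
  by (simp_all add: lp_sum_def vsub_def)

lemma normed_space_lp_sum:
  assumes p: "1 \<le> p" and a: "\<And>n. 0 < a n" and V: "\<And>n. normed_space (V n)"
  shows "normed_space (lp_sum p a V)"
proof -
  interpret V: normed_space "V n" for n by fact
  note a0 = less_imp_le[OF a]
  have add: "vadd (lp_sum p a V) u v \<in> carr (lp_sum p a V)"
    "vnorm (lp_sum p a V) (vadd (lp_sum p a V) u v) \<le> vnorm (lp_sum p a V) u + vnorm (lp_sum p a V) v"
    if u: "u \<in> carr (lp_sum p a V)" and v: "v \<in> carr (lp_sum p a V)" for u v
  proof -
    have c: "u n \<in> carr (V n)" "v n \<in> carr (V n)" for n using u v by (auto simp: lp_sum_simps)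
    have su: "summable (\<lambda>n. a n * vnorm (V n) (u n) powr p)" "summable (\<lambda>n. a n * vnorm (V n) (v n) powr p)"
      using u v by (auto simp: lp_sum_simps)
    note M = Minkowski_suminf[of p a, OF p a0 V.norm_nonneg[OF c(1)] V.norm_nonneg[OF c(2)] su]
    have le: "a n * vnorm (V n) (vadd (V n) (u n) (v n)) powr p \<le> a n * (vnorm (V n) (u n) + vnorm (V n) (v n)) powr p" for n
      using p a0 c by (intro mult_left_mono powr_mono2) (auto simp: V.norm_nonneg V.add_closed V.norm_triangle)
    have s: "summable (\<lambda>n. a n * vnorm (V n) (vadd (V n) (u n) (v n)) powr p)"
      using le a0 by (intro summable_comparison_test[OF _ M(1)]) simp
    show "vadd (lp_sum p a V) u v \<in> carr (lp_sum p a V)" using s c by (simp add: lp_sum_simps V.add_closed)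
    have "(\<Sum>n. a n * vnorm (V n) (vadd (V n) (u n) (v n)) powr p) powr (1/p)
        \<le> (\<Sum>n. a n * (vnorm (V n) (u n) + vnorm (V n) (v n)) powr p) powr (1/p)"
      using p a0 by (intro powr_mono2 suminf_le suminf_nonneg s M(1) le) auto
    thus "vnorm (lp_sum p a V) (vadd (lp_sum p a V) u v) \<le> vnorm (lp_sum p a V) u + vnorm (lp_sum p a V) v"
      using M(2) by (simp add: lp_sum_simps)
  qed
  have sc: "(\<lambda>n. a n * vnorm (V n) (vscale (V n) c (u n)) powr p)
      = (\<lambda>n. norm c powr p * (a n * vnorm (V n) (u n) powr p))" if "u \<in> carr (lp_sum p a V)" for u c
    using that by (auto simp: lp_sum_simps V.norm_scale powr_mult V.norm_nonneg)
  have scale: "vscale (lp_sum p a V) c u \<in> carr (lp_sum p a V)" if u: "u \<in> carr (lp_sum p a V)" for u c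
    using u unfolding lp_sum_simps sc[OF u] by (auto intro: summable_mult V.scale_closed)
  show ?thesis
  proof
    show "vzero (lp_sum p a V) \<in> carr (lp_sum p a V)"
      using V.norm_eq_zero[OF V.zero_closed] by (simp add: lp_sum_simps V.zero_closed)
    fix u assume u: "u \<in> carr (lp_sum p a V)"
    have c: "u n \<in> carr (V n)" for n using u by (auto simp: lp_sum_simps)
    have su: "summable (\<lambda>n. a n * vnorm (V n) (u n) powr p)" using u by (auto simp: lp_sum_simps)
    show "vadd (lp_sum p a V) u (vzero (lp_sum p a V)) = u" "vscale (lp_sum p a V) 1 u = u"
      using c by (simp_all add: lp_sum_simps V.add_zero V.scale_one)
    show "vscale (lp_sum p a V) (x + y) u = vadd (lp_sum p a V) (vscale (lp_sum p a V) x u) (vscale (lp_sum p a V) y u)"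
      "vscale (lp_sum p a V) x (vscale (lp_sum p a V) y u) = vscale (lp_sum p a V) (x * y) u" for x y
      using c by (simp_all add: lp_sum_simps V.scale_add_left V.scale_scale)
    show "\<exists>v\<in>carr (lp_sum p a V). vadd (lp_sum p a V) u v = vzero (lp_sum p a V)"
      using scale[OF u, of "-1"] c by (intro bexI[of _ "vscale (lp_sum p a V) (-1) u"]) (simp_all add: lp_sum_simps V.add_neg)
    show "0 \<le> vnorm (lp_sum p a V) u" by (simp add: lp_sum_simps)
    show "vnorm (lp_sum p a V) u = 0 \<longleftrightarrow> u = vzero (lp_sum p a V)"
    proof -
      have "vnorm (lp_sum p a V) u = 0 \<longleftrightarrow> (\<forall>n. a n * vnorm (V n) (u n) powr p = 0)"
        using suminf_eq_zero_iff[OF su] a0 by (simp add: lp_sum_simps)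
      also have "\<dots> \<longleftrightarrow> (\<forall>n. u n = vzero (V n))"
        using a V.norm_eq_zero[OF c] by (simp add: less_imp_neq[THEN not_sym])
      finally show ?thesis by (auto simp: lp_sum_simps)
    qed
    show "vnorm (lp_sum p a V) (vscale (lp_sum p a V) x u) = norm x * vnorm (lp_sum p a V) u" for x
      using p su a0 unfolding lp_sum_simps sc[OF u]
      by (simp add: suminf_mult powr_mult powr_powr suminf_nonneg)
    fix v assume v: "v \<in> carr (lp_sum p a V)"
    have d: "v n \<in> carr (V n)" for n using v by (auto simp: lp_sum_simps)
    show "vadd (lp_sum p a V) u v = vadd (lp_sum p a V) v u"
      using c d V.add_commute by (simp add: lp_sum_simps)
    show "vscale (lp_sum p a V) x (vadd (lp_sum p a V) u v) = vadd (lp_sum p a V) (vscale (lp_sum p a V) x u) (vscale (lp_sum p a V) x v)" for x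
      using c d by (simp add: lp_sum_simps V.scale_add_right)
    fix w assume w: "w \<in> carr (lp_sum p a V)"
    show "vadd (lp_sum p a V) (vadd (lp_sum p a V) u v) w = vadd (lp_sum p a V) u (vadd (lp_sum p a V) v w)"
      using c d w by (simp add: lp_sum_simps V.add_assoc)
  qed (fact add scale)+
qed

lemma lp_sum_coordinate:
  assumes p: "1 \<le> p" and a: "\<And>n. 0 < a n" and V: "\<And>n. normed_space (V n)" and u: "u \<in> carr (lp_sum p a V)"
  shows "a n powr (1 / p) * vnorm (V n) (u n) \<le> vnorm (lp_sum p a V) u"
proof -
  have c: "u n \<in> carr (V n)" for n using u by (auto simp: lp_sum_simps)
  have "a n * vnorm (V n) (u n) powr p \<le> (\<Sum>n. a n * vnorm (V n) (u n) powr p)"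
    using u less_imp_le[OF a] sum_le_suminf[of "\<lambda>n. a n * vnorm (V n) (u n) powr p" "{n}"] by (simp add: lp_sum_simps)
  hence "(a n * vnorm (V n) (u n) powr p) powr (1 / p) \<le> vnorm (lp_sum p a V) u"
    unfolding lp_sum_simps using p less_imp_le[OF a] by (intro powr_mono2) auto
  thus ?thesis using p less_imp_le[OF a, of n] normed_space.norm_nonneg[OF V c] by (simp add: powr_mult powr_powr)
qed

text \<open>
  A Cauchy sequence converges in each coordinate.  Finite partial sums of the norm pass to the
  coordinatewise limit, which gives both membership of the limit and convergence in norm.
\<close>

lemma banach_lp_sum:
  assumes p: "1 \<le> p" and a: "\<And>n. 0 < a n" and V: "\<And>n. banach_space (V n)"
  shows "banach_space (lp_sum p a V)"
proof (rule banach_spaceI)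
  let ?W = "lp_sum p a V"
  have nV: "normed_space (V n)" for n using V by (simp add: banach_space_def)
  interpret V: normed_space "V n" for n by (fact nV)
  interpret W: normed_space ?W by (rule normed_space_lp_sum[OF p a nV])
  show "normed_space ?W" by (fact W.normed_space_axioms)
  fix s :: "nat \<Rightarrow> nat \<Rightarrow> 'b"
  assume s: "\<And>n. s n \<in> carr ?W" and C: "\<forall>e>0. \<exists>N. \<forall>m\<ge>N. \<forall>n\<ge>N. vnorm ?W (vsub ?W (s m) (s n)) < e"
  have sc: "s m n \<in> carr (V n)" for m n using s by (auto simp: lp_sum_simps)
  have "\<exists>l. l \<in> carr (V n) \<and> (\<lambda>m. vnorm (V n) (vsub (V n) (s m n) l)) \<longlonglongrightarrow> 0" for n
  proof -
    have "\<exists>N. \<forall>m\<ge>N. \<forall>k\<ge>N. vnorm (V n) (vsub (V n) (s m n) (s k n)) < e" if e: "e > 0" for e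
    proof -
      have pos: "a n powr (1/p) > 0" using a[of n] by simp
      then obtain N where "\<forall>m\<ge>N. \<forall>k\<ge>N. vnorm ?W (vsub ?W (s m) (s k)) < a n powr (1/p) * e"
        using C e by (meson mult_pos_pos)
      moreover have "a n powr (1/p) * vnorm (V n) (vsub (V n) (s m n) (s k n)) \<le> vnorm ?W (vsub ?W (s m) (s k))" for m k
        using lp_sum_coordinate[where V=V and a=a, OF p a nV W.sub_closed[OF s s], of n m k] by (simp add: lp_sum_simps)
      ultimately have "\<forall>m\<ge>N. \<forall>k\<ge>N. a n powr (1/p) * vnorm (V n) (vsub (V n) (s m n) (s k n)) < a n powr (1/p) * e"
        by (meson le_less_trans)
      thus ?thesis using pos by auto
    qed
    hence cau: "\<forall>e>0. \<exists>N. \<forall>m\<ge>N. \<forall>k\<ge>N. vnorm (V n) (vsub (V n) (s m n) (s k n)) < e" by blast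
    show ?thesis by (rule banach_space_limit[OF V, of "\<lambda>m. s m n" n]) (use sc cau in auto)
  qed
  then obtain l where l: "\<And>n. l n \<in> carr (V n)" "\<And>n. (\<lambda>m. vnorm (V n) (vsub (V n) (s m n) (l n))) \<longlonglongrightarrow> 0"
    by metis
  have near: "vsub ?W (s m) l \<in> carr ?W \<and> vnorm ?W (vsub ?W (s m) l) \<le> e"
    if e: "0 < e" and N: "\<forall>k\<ge>N. vnorm ?W (vsub ?W (s m) (s k)) < e" for e m N
  proof -
    let ?f = "\<lambda>n. a n * vnorm (V n) (vsub (V n) (s m n) (l n)) powr p"
    have nn: "0 \<le> ?f n" for n using less_imp_le[OF a] by simp
    have part: "(\<Sum>n<M. ?f n) \<le> e powr p" for M
    proof (rule LIMSEQ_le_const2)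
      show "(\<lambda>k. \<Sum>n<M. a n * vnorm (V n) (vsub (V n) (s m n) (s k n)) powr p) \<longlonglongrightarrow> (\<Sum>n<M. ?f n)"
        using p sc l V.norm_nonneg[OF V.sub_closed]
        by (intro tendsto_sum tendsto_mult tendsto_const tendsto_powr' V.tendsto_norm_sub) auto
      have "(\<Sum>n<M. a n * vnorm (V n) (vsub (V n) (s m n) (s k n)) powr p) \<le> e powr p" if k: "k \<ge> N" for k
      proof -
        have sm: "summable (\<lambda>n. a n * vnorm (V n) (vsub (V n) (s m n) (s k n)) powr p)"
          using W.sub_closed[OF s s, of m k] by (simp add: lp_sum_simps)
        have "(\<Sum>n. a n * vnorm (V n) (vsub (V n) (s m n) (s k n)) powr p) powr (1/p) \<le> e"
          using N k by (auto simp: lp_sum_simps less_imp_le)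
        hence "(\<Sum>n. a n * vnorm (V n) (vsub (V n) (s m n) (s k n)) powr p) \<le> e powr p"
          using powr_le_powr_inverse_iff[of p _ e] p e suminf_nonneg[OF sm] less_imp_le[OF a] by simp
        thus ?thesis
          using sum_le_suminf[OF sm, of "{..<M}"] less_imp_le[OF a] by simp
      qed
      thus "\<exists>N. \<forall>k\<ge>N. (\<Sum>n<M. a n * vnorm (V n) (vsub (V n) (s m n) (s k n)) powr p) \<le> e powr p" by blast
    qed
    have sm: "summable ?f" by (rule summableI_nonneg_bounded[OF nn part])
    have "suminf ?f \<le> e powr p" using suminf_le_const[OF sm part] .
    hence "suminf ?f powr (1/p) \<le> e"
      using powr_le_powr_inverse_iff[of p "suminf ?f" e] p e suminf_nonneg[OF sm nn] by simp
    thus ?thesis using sm sc l V.sub_closed by (simp add: lp_sum_simps)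
  qed
  obtain N1 where "\<forall>k\<ge>N1. vnorm ?W (vsub ?W (s N1) (s k)) < 1" using C zero_less_one by (meson order_refl)
  hence d: "vsub ?W (s N1) l \<in> carr ?W" using near[of 1 N1 N1] by simp
  \<comment> \<open>The limit \<open>l = s - (s - l)\<close> is in the sum because \<open>s\<close> and \<open>s - l\<close> are.\<close>
  have "vsub (V n) (s N1 n) (vsub (V n) (s N1 n) (l n)) = l n" for n
  proof -
    have c: "s N1 n \<in> carr (V n)" "l n \<in> carr (V n)" using sc l by auto
    have "vsub (V n) (s N1 n) (vsub (V n) (s N1 n) (l n)) = vadd (V n) (s N1 n) (vadd (V n) (vscale (V n) (-1) (s N1 n)) (l n))"
      using c by (simp add: vsub_def V.scale_add_right V.scale_closed V.scale_scale V.scale_one)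
    also have "\<dots> = l n"
      using c by (simp add: V.add_assoc[symmetric] V.scale_closed V.add_neg V.zero_add)
    finally show ?thesis .
  qed
  hence lW: "l \<in> carr ?W" using W.sub_closed[OF s[of N1] d] by (simp add: lp_sum_simps(6))
  have "\<exists>N. \<forall>m\<ge>N. vnorm ?W (vsub ?W (s m) l) < e" if e: "e > 0" for e
  proof -
    obtain N where "\<forall>m\<ge>N. \<forall>k\<ge>N. vnorm ?W (vsub ?W (s m) (s k)) < e/2" using C e half_gt_zero by blast
    hence "vnorm ?W (vsub ?W (s m) l) \<le> e/2" if "m \<ge> N" for m using near[of "e/2" N m] e that by simp
    thus ?thesis using e by (intro exI[of _ N]) force
  qed
  thus "\<exists>l\<in>carr ?W. (\<lambda>n. vnorm ?W (vsub ?W (s n) l)) \<longlonglongrightarrow> 0"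
    using W.tendsto_norm_sub_iff[of s l, OF s lW] lW by blast
qed

section \<open>Normalised dominations\<close>

text \<open>
  Dividing by \<open>\<sigma>\<close> and \<open>\<rho>\<close> makes \<open>c\<close> correspond to \<open>C \<sigma>\<^bsup>1-\<theta>\<^esup> \<rho>\<^bsup>1-\<nu>\<^esup>\<close> for the constant \<open>C\<close> of \<^const>\<open>dominates\<close>,
  that is, to the quantity whose infimum is \<^const>\<open>dominated_norm\<close>.  In contrast to \<open>C\<close>, the value
  \<open>c = 0\<close> is possible.
\<close>

definition dominated_with ::
  "real \<Rightarrow> real \<Rightarrow> real \<Rightarrow> real \<Rightarrow> 'x pointed \<Rightarrow> ('k :: real_normed_field, 'f) nspace \<Rightarrow> ('x \<Rightarrow> 'f) \<Rightarrow> real \<Rightarrow>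
   ('k, 'g) nspace \<Rightarrow> ('k, 'h) nspace \<Rightarrow> ('x \<Rightarrow> 'g) \<Rightarrow> (('f \<Rightarrow> 'k) \<Rightarrow> 'h) \<Rightarrow> real \<Rightarrow> real \<Rightarrow> bool"
where
  "dominated_with p \<theta> q \<nu> X F T c G H S R \<sigma> \<rho> \<longleftrightarrow>
     banach_space G \<and> banach_space H \<and> S \<in> lip_maps X (origin_pointed G) \<and> R \<in> bounded_ops (dual F) H \<and>
     0 < \<sigma> \<and> \<sigma> \<in> lip_summing_consts p X G S \<and> 0 < \<rho> \<and> \<rho> \<in> summing_consts q (dual F) H R \<and>
     (\<forall>x\<in>points X. \<forall>y\<in>points X. \<forall>b\<in>carr (dual F).
        norm (b (vsub F (T x) (T y)))
        \<le> c * (pdist X x y powr \<theta> * (vnorm G (vsub G (S x) (S y)) / \<sigma>) powr (1 - \<theta>)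
               * (vnorm (dual F) b powr \<nu> * (vnorm H (R b) / \<rho>) powr (1 - \<nu>))))"

lemma powr_convex_split: "0 \<le> (x::real) \<Longrightarrow> x powr t * x powr (1 - t) = x"
  by (simp flip: powr_add)

lemma lip_maps_origin_closed:
  assumes "normed_space G" "S \<in> lip_maps X (origin_pointed G)" shows "S \<in> points X \<rightarrow> carr G"
  using lip_maps_closed[OF assms(2)] normed_space.mspace_norm_metric[OF assms(1)] by auto

lemma lip_summing_norm_le: "C \<in> lip_summing_consts p X G S \<Longrightarrow> lip_summing_norm p X G S \<le> C"
  unfolding lip_summing_norm_def by (intro cInf_lower bdd_belowI[of _ 0]) (auto simp: lip_summing_consts_def)

lemma summing_norm_le: "C \<in> summing_consts q E H R \<Longrightarrow> summing_norm q E H R \<le> C"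
  unfolding summing_norm_def by (intro cInf_lower bdd_belowI[of _ 0]) (auto simp: summing_consts_def)

lemma lip_summing_norm_nonneg: "lip_summing_consts p X G S \<noteq> {} \<Longrightarrow> 0 \<le> lip_summing_norm p X G S"
  unfolding lip_summing_norm_def by (intro cInf_greatest) (auto simp: lip_summing_consts_def)

lemma summing_norm_nonneg: "summing_consts q E H R \<noteq> {} \<Longrightarrow> 0 \<le> summing_norm q E H R"
  unfolding summing_norm_def by (intro cInf_greatest) (auto simp: summing_consts_def)

locale domination_setting =
  fixes p \<theta> q \<nu> :: real and X :: "'x pointed" and F :: "('k :: {real_normed_field, banach}, 'f) nspace"
  assumes p: "1 \<le> p" and q: "1 \<le> q" and \<theta>: "0 \<le> \<theta>" "\<theta> < 1" and \<nu>: "0 \<le> \<nu>" "\<nu> < 1"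
    and exponents: "(1 - \<theta>) / p + (1 - \<nu>) / q \<le> 1"
    and X: "pointed_metric_space X" and banach_F: "banach_space F" and norming_F: "norming F"
begin

sublocale F: normed_space F using banach_F by (simp add: banach_space_def)

abbreviation "Dom \<equiv> dominated p \<theta> q \<nu> X F"
abbreviation "D \<equiv> dominated_norm p \<theta> q \<nu> X F"

definition pointed_map :: "('x \<Rightarrow> 'f) \<Rightarrow> bool" where
  "pointed_map T \<longleftrightarrow> T \<in> extensional (points X) \<and> T \<in> points X \<rightarrow> carr F \<and> T (base X) = vzero F"

lemma norm_le_dual:
  assumes u: "u \<in> carr F" and c: "0 \<le> c" and b: "\<And>b. b \<in> carr (dual F) \<Longrightarrow> norm (b u) \<le> c * vnorm (dual F) b"
  shows "vnorm F u \<le> c"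
proof -
  obtain b where "b \<in> carr (dual F)" "vnorm (dual F) b \<le> 1" "vnorm F u \<le> norm (b u)"
    using norming_F u by (auto simp: norming_def)
  thus ?thesis using b[of b] mult_left_le[OF _ c, of "vnorm (dual F) b"] by linarith
qed

text \<open>
  Replace \<open>\<parallel>Sx - Sy\<parallel>/\<sigma>\<close> by \<open>d(x,y)\<close> and \<open>\<parallel>Rb\<parallel>/\<rho>\<close> by \<open>\<parallel>b\<parallel>\<close>: the powers combine to exponent \<open>1\<close>.
\<close>

lemma dominated_with_functional_bound:
  assumes d: "dominated_with p \<theta> q \<nu> X F T c G H S R \<sigma> \<rho>" and c: "0 \<le> c"
    and x: "x \<in> points X" "y \<in> points X" and b: "b \<in> carr (dual F)"
  shows "norm (b (vsub F (T x) (T y))) \<le> c * (pdist X x y * vnorm (dual F) b)"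
proof -
  note d' = d[unfolded dominated_with_def]
  have nG: "normed_space G" and nH: "normed_space H" using d' by (auto simp: banach_space_def)
  have S: "S \<in> points X \<rightarrow> carr G" using d' lip_maps_origin_closed[OF nG] by blast
  have R: "R \<in> carr (dual F) \<rightarrow> carr H" by (intro Pi_I bounded_opsD(2)[of R]) (use d' in blast)+
  have \<sigma>: "0 < \<sigma>" "0 < \<rho>" using d' by auto
  have "vnorm G (vsub G (S x) (S y)) \<le> \<sigma> * pdist X x y"
    using d' by (intro lip_summing_lipschitz[OF _ p X nG S x]) blast
  hence s: "vnorm G (vsub G (S x) (S y)) / \<sigma> \<le> pdist X x y" using \<sigma> by (simp add: field_simps)
  have "vnorm H (R b) \<le> \<rho> * vnorm (dual F) b"
    using d' by (intro summing_bounded[OF _ q F.normed_space_axioms nH R b]) blast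
  hence r: "vnorm H (R b) / \<rho> \<le> vnorm (dual F) b" using \<sigma> by (simp add: field_simps)
  have s0: "0 \<le> vnorm G (vsub G (S x) (S y))"
    using S x normed_space.norm_nonneg[OF nG normed_space.sub_closed[OF nG]] by blast
  have r0: "0 \<le> vnorm H (R b)" using R b normed_space.norm_nonneg[OF nH] by blast
  have "norm (b (vsub F (T x) (T y)))
        \<le> c * (pdist X x y powr \<theta> * (vnorm G (vsub G (S x) (S y)) / \<sigma>) powr (1 - \<theta>)
               * (vnorm (dual F) b powr \<nu> * (vnorm H (R b) / \<rho>) powr (1 - \<nu>)))"
    using d' x b by blast
  also have "\<dots> \<le> c * (pdist X x y powr \<theta> * pdist X x y powr (1 - \<theta>)
               * (vnorm (dual F) b powr \<nu> * vnorm (dual F) b powr (1 - \<nu>)))"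
    using c s s0 r r0 \<sigma> \<theta> \<nu> by (intro mult_left_mono mult_mono powr_mono2) auto
  also have "\<dots> = c * (pdist X x y * vnorm (dual F) b)"
    using dual_norm_nonneg[OF b F.normed_space_axioms] by (simp add: powr_convex_split)
  finally show ?thesis .
qed

lemma dominated_with_lipschitz:
  assumes d: "dominated_with p \<theta> q \<nu> X F T c G H S R \<sigma> \<rho>" and c: "0 \<le> c"
    and T: "T \<in> points X \<rightarrow> carr F" and x: "x \<in> points X" "y \<in> points X"
  shows "vnorm F (vsub F (T x) (T y)) \<le> c * pdist X x y"
  using dominated_with_functional_bound[OF d c x] T x c
  by (intro norm_le_dual) (auto simp: F.sub_closed mult.assoc Pi_iff)

text \<open>
  The Lipschitz property of \<open>T\<close> is itself a consequence of the domination.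
  Enlarging \<open>c\<close> to \<open>c' > c\<close> provides the positive constant that \<^const>\<open>dominates\<close> requires.
\<close>

lemma dominated_with_imp_dominated:
  assumes d: "dominated_with p \<theta> q \<nu> X F T c G H S R \<sigma> \<rho>" and c: "0 \<le> c" and T: "pointed_map T"
  shows "T \<in> Dom" and "D T \<le> c"
proof -
  note d' = d[unfolded dominated_with_def]
  have nG: "normed_space G" and nH: "normed_space H" using d' by (auto simp: banach_space_def)
  have \<sigma>: "0 < \<sigma>" "0 < \<rho>" using d' by auto
  have ne: "lip_summing_consts p X G S \<noteq> {}" "summing_consts q (dual F) H R \<noteq> {}" using d' by auto
  have S: "S \<in> points X \<rightarrow> carr G" using d' lip_maps_origin_closed[OF nG] by blast
  have R: "R \<in> carr (dual F) \<rightarrow> carr H" by (intro Pi_I bounded_opsD(2)[of R]) (use d' in blast)+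
  have Tlip: "T \<in> lip_maps X (origin_pointed F)"
    using T dominated_with_lipschitz[OF d c]
    by (intro lip_mapsI[where L=c]) (auto simp: pointed_map_def F.mdist_norm_metric Pi_iff)
  have dom: "dominates p \<theta> q \<nu> X F T G H (c' / (\<sigma> powr (1 - \<theta>) * \<rho> powr (1 - \<nu>))) S R" (is "dominates _ _ _ _ _ _ _ _ _ ?C _ _")
    if c': "c < c'" for c'
    unfolding dominates_def
  proof (intro conjI ballI)
    show "banach_space G" "banach_space H" using d' by auto
    show "0 < ?C" using c c' \<sigma> by simp
    show "S \<in> lip_summing_maps p X G" "R \<in> summing_ops q (dual F) H"
      using d' by (auto simp: lip_summing_maps_def summing_ops_def)
    fix x y b assume x: "x \<in> points X" "y \<in> points X" and b: "b \<in> carr (dual F)"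
    have s0: "0 \<le> vnorm G (vsub G (S x) (S y))"
      using S x normed_space.norm_nonneg[OF nG normed_space.sub_closed[OF nG]] by blast
    have r0: "0 \<le> vnorm H (R b)" using R b normed_space.norm_nonneg[OF nH] by blast
    have "norm (b (vsub F (T x) (T y)))
        \<le> c * (pdist X x y powr \<theta> * (vnorm G (vsub G (S x) (S y)) / \<sigma>) powr (1 - \<theta>)
               * (vnorm (dual F) b powr \<nu> * (vnorm H (R b) / \<rho>) powr (1 - \<nu>)))"
      using d' x b by blast
    also have "\<dots> \<le> c' * (pdist X x y powr \<theta> * (vnorm G (vsub G (S x) (S y)) / \<sigma>) powr (1 - \<theta>)
               * (vnorm (dual F) b powr \<nu> * (vnorm H (R b) / \<rho>) powr (1 - \<nu>)))"
      using c' by (intro mult_right_mono) auto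
    also have "\<dots> = ?C * pdist X x y powr \<theta> * vnorm G (vsub G (S x) (S y)) powr (1 - \<theta>)
               * vnorm (dual F) b powr \<nu> * vnorm H (R b) powr (1 - \<nu>)"
      using s0 r0 \<sigma> by (simp add: powr_divide)
    finally show "norm (b (vsub F (T x) (T y))) \<le> \<dots>" .
  qed
  have "c < c + 1" by simp
  from dominates_imp_dominated[OF X banach_F Tlip dom[OF this]] show "T \<in> Dom" .
  show "D T \<le> c"
  proof (rule field_le_epsilon)
    fix e :: real assume e: "0 < e"
    hence ce: "c < c + e" by simp
    have "D T \<le> (c + e) / (\<sigma> powr (1 - \<theta>) * \<rho> powr (1 - \<nu>)) * lip_summing_norm p X G S powr (1 - \<theta>)
        * summing_norm q (dual F) H R powr (1 - \<nu>)"
      by (rule dominates_imp_dominated_norm_le[OF X banach_F dom[OF ce]])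
    also have "\<dots> \<le> (c + e) / (\<sigma> powr (1 - \<theta>) * \<rho> powr (1 - \<nu>)) * \<sigma> powr (1 - \<theta>) * \<rho> powr (1 - \<nu>)"
      using lip_summing_norm_le[of \<sigma> p X G S] summing_norm_le[of \<rho> q "dual F" H R] lip_summing_norm_nonneg[OF ne(1)] summing_norm_nonneg[OF ne(2)] d' c e \<theta> \<nu>
      by (intro mult_mono powr_mono2 mult_left_mono) auto
    also have "\<dots> = c + e" using \<sigma> by simp
    finally show "D T \<le> c + e" .
  qed
qed

lemma dominated_pointed_map: "T \<in> Dom \<Longrightarrow> pointed_map T"
  using lip_maps_origin_closed[OF F.normed_space_axioms, of T X]
  by (auto simp: dominated_def pointed_map_def lip_maps_base lip_maps_ext)

lemma dominated_norm_nonneg: "T \<in> Dom \<Longrightarrow> 0 \<le> D T"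
  unfolding dominated_norm_def
proof (rule cInf_greatest)
  show "{C * lip_summing_norm p X G S powr (1 - \<theta>) * summing_norm q (dual F) H R powr (1 - \<nu>)
       | (G :: ('k, ('k, 'x) seqs) nspace) (H :: ('k, ('k, 'f \<Rightarrow> 'k) seqs) nspace) C S R.
       dominates p \<theta> q \<nu> X F T G H C S R} \<noteq> {}" if "T \<in> Dom"
    using that unfolding dominated_def by blast
qed (auto simp: dominates_def)

text \<open>
  The summing norms of \<open>S\<close> and \<open>R\<close> may vanish.  By continuity of the powers at \<open>0\<close>, both can be
  increased by a small \<open>t > 0\<close> without the constant reaching \<open>c\<close>.
\<close>

lemma less_dominated_norm_imp_dominated_with:
  assumes T: "T \<in> Dom" and c: "D T < c"
  obtains G :: "('k, ('k, 'x) seqs) nspace" and H :: "('k, ('k, 'f \<Rightarrow> 'k) seqs) nspace" and S R \<sigma> \<rho>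
  where "dominated_with p \<theta> q \<nu> X F T c G H S R \<sigma> \<rho>"
proof -
  obtain G :: "('k, ('k, 'x) seqs) nspace" and H :: "('k, ('k, 'f \<Rightarrow> 'k) seqs) nspace" and C S R
    where dom: "dominates p \<theta> q \<nu> X F T G H C S R"
      and less: "C * lip_summing_norm p X G S powr (1 - \<theta>) * summing_norm q (dual F) H R powr (1 - \<nu>) < c"
  proof -
    let ?A = "{C * lip_summing_norm p X G S powr (1 - \<theta>) * summing_norm q (dual F) H R powr (1 - \<nu>)
       | (G :: ('k, ('k, 'x) seqs) nspace) (H :: ('k, ('k, 'f \<Rightarrow> 'k) seqs) nspace) C S R.
       dominates p \<theta> q \<nu> X F T G H C S R}"
    have ne: "?A \<noteq> {}" using T by (auto simp: dominated_def)
    have "Inf ?A < c" using c by (simp add: dominated_norm_def)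
    from cInf_lessD[OF ne this] obtain a where a: "a \<in> ?A" "a < c" by (rule bexE)
    from a(1) show ?thesis
      by (elim CollectE exE conjE, intro that) (use a(2) in simp_all)
  qed
  note dom' = dom[unfolded dominates_def]
  let ?s = "lip_summing_norm p X G S" and ?r = "summing_norm q (dual F) H R"
  have S: "S \<in> lip_maps X (origin_pointed G)" "lip_summing_consts p X G S \<noteq> {}"
    and R: "R \<in> bounded_ops (dual F) H" "summing_consts q (dual F) H R \<noteq> {}"
    using dom' by (auto simp: lip_summing_maps_def summing_ops_def)
  have nG: "normed_space G" and nH: "normed_space H" using dom' by (auto simp: banach_space_def)
  have s: "0 \<le> ?s" "0 \<le> ?r" using lip_summing_norm_nonneg[OF S(2)] summing_norm_nonneg[OF R(2)] by auto
  have "((\<lambda>t. C * (?s + t) powr (1 - \<theta>) * (?r + t) powr (1 - \<nu>)) \<longlongrightarrow> C * (?s + 0) powr (1 - \<theta>) * (?r + 0) powr (1 - \<nu>)) (at_right 0)"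
    using s \<theta> \<nu> by (intro tendsto_intros tendsto_powr') (auto simp: eventually_at_right_field intro!: exI[of _ 1])
  hence "eventually (\<lambda>t. C * (?s + t) powr (1 - \<theta>) * (?r + t) powr (1 - \<nu>) < c) (at_right 0)"
    using less by (intro order_tendstoD(2)) auto
  then obtain t where t: "0 < t" "C * (?s + t) powr (1 - \<theta>) * (?r + t) powr (1 - \<nu>) < c"
    unfolding eventually_at_right_field by (metis dense)
  define \<sigma> \<rho> where "\<sigma> = ?s + t" and "\<rho> = ?r + t"
  have pos: "0 < \<sigma>" "0 < \<rho>" using s t by (auto simp: \<sigma>_def \<rho>_def)
  obtain \<sigma>' where \<sigma>': "\<sigma>' \<in> lip_summing_consts p X G S" "\<sigma>' < \<sigma>"
    using cInf_lessD[OF S(2), of \<sigma>] t by (auto simp: \<sigma>_def lip_summing_norm_def)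
  obtain \<rho>' where \<rho>': "\<rho>' \<in> summing_consts q (dual F) H R" "\<rho>' < \<rho>"
    using cInf_lessD[OF R(2), of \<rho>] t by (auto simp: \<rho>_def summing_norm_def)
  have "dominated_with p \<theta> q \<nu> X F T c G H S R \<sigma> \<rho>"
    unfolding dominated_with_def
  proof (intro conjI ballI)
    show "\<sigma> \<in> lip_summing_consts p X G S" using lip_summing_consts_mono[OF \<sigma>'(1) less_imp_le[OF \<sigma>'(2)] p X] .
    show "\<rho> \<in> summing_consts q (dual F) H R" using summing_consts_mono[OF \<rho>'(1) less_imp_le[OF \<rho>'(2)] q F.normed_space_axioms] .
    fix x y b assume x: "x \<in> points X" "y \<in> points X" and b: "b \<in> carr (dual F)"
    have s0: "0 \<le> vnorm G (vsub G (S x) (S y))"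
      using lip_maps_origin_closed[OF nG S(1)] x normed_space.norm_nonneg[OF nG normed_space.sub_closed[OF nG]] by blast
    have r0: "0 \<le> vnorm H (R b)" using bounded_opsD(2)[OF R(1) b] normed_space.norm_nonneg[OF nH] by blast
    have "norm (b (vsub F (T x) (T y))) \<le> C * pdist X x y powr \<theta> * vnorm G (vsub G (S x) (S y)) powr (1 - \<theta>)
            * vnorm (dual F) b powr \<nu> * vnorm H (R b) powr (1 - \<nu>)"
      using dom' x b by blast
    also have "\<dots> = (C * \<sigma> powr (1 - \<theta>) * \<rho> powr (1 - \<nu>)) * (pdist X x y powr \<theta> * (vnorm G (vsub G (S x) (S y)) / \<sigma>) powr (1 - \<theta>)
               * (vnorm (dual F) b powr \<nu> * (vnorm H (R b) / \<rho>) powr (1 - \<nu>)))"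
      using pos s0 r0 by (simp add: powr_divide)
    also have "\<dots> \<le> c * (pdist X x y powr \<theta> * (vnorm G (vsub G (S x) (S y)) / \<sigma>) powr (1 - \<theta>)
               * (vnorm (dual F) b powr \<nu> * (vnorm H (R b) / \<rho>) powr (1 - \<nu>)))"
      using t(2) by (intro mult_right_mono) (auto simp: \<sigma>_def \<rho>_def)
    finally show "norm (b (vsub F (T x) (T y))) \<le> \<dots>" .
  qed (use dom' S R pos in auto)
  thus ?thesis by (rule that)
qed

lemma dominated_lipschitz:
  assumes T: "T \<in> Dom" and x: "x \<in> points X" "y \<in> points X"
  shows "vnorm F (vsub F (T x) (T y)) \<le> D T * pdist X x y"
proof (rule Inf_mult_le[of "{D T<..}", simplified])
  have Tc: "T \<in> points X \<rightarrow> carr F" using dominated_pointed_map[OF T] by (simp add: pointed_map_def)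
  fix c assume c: "D T < c"
  show "vnorm F (vsub F (T x) (T y)) \<le> c * pdist X x y"
    using less_dominated_norm_imp_dominated_with[OF T c] dominated_with_lipschitz[OF _ _ Tc x]
      dominated_norm_nonneg[OF T] c by (metis less_eq_real_def order_le_less_trans)
qed simp

end

section \<open>Elementary maps and compositions\<close>

lemma le_mult_of_le_greater:
  "\<lbrakk>\<And>c. a < c \<Longrightarrow> x \<le> c * d; 0 \<le> (d::real)\<rbrakk> \<Longrightarrow> x \<le> a * d"
  using Inf_mult_le[of "{a<..}" x d] by simp

lemma lp_norm_divide:
  assumes "1 \<le> p" "0 < L" "\<And>j. j < n \<Longrightarrow> 0 \<le> a j"
  shows "(\<Sum>j<n. l j powr p * (a j / L) powr p) powr (1/p) = (\<Sum>j<n. l j powr p * (a j :: real) powr p) powr (1/p) / L"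
proof -
  have "(\<Sum>j<n. l j powr p * (a j / L) powr p) = (\<Sum>j<n. l j powr p * a j powr p) / L powr p"
    unfolding sum_divide_distrib using assms by (intro sum.cong) (auto simp: powr_divide)
  thus ?thesis using assms by (simp add: powr_divide powr_powr sum_nonneg)
qed

lemma powr_interpolate:
  assumes "0 \<le> u" "u \<le> d" "0 \<le> t" shows "u \<le> (d::real) powr t * u powr (1 - t)"
proof -
  have "u powr t * u powr (1 - t) \<le> d powr t * u powr (1 - t)"
    using assms by (intro mult_right_mono powr_mono2) auto
  thus ?thesis using assms powr_convex_split[of u t] by simp
qed

context domination_setting
begin

lemma functional_sub:
  assumes "b \<in> carr (dual F)" "u \<in> carr F" "v \<in> carr F" shows "b (vsub F u v) = b u - b v"
  using bounded_ops_sub[OF _ F.normed_space_axioms assms(2,3), of b scalars] assms(1) by (simp add: dual_simps)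

lemma functional_scale:
  assumes "b \<in> carr (dual F)" "u \<in> carr F" shows "b (vscale F a u) = a * b u"
  using bounded_opsD(4)[of b F scalars u a] assms by (simp add: dual_simps)

lemma lip_summing_const_of_function:
  assumes g: "g \<in> lip_maps X (origin_pointed (scalars :: ('k, 'k) nspace))"
    and L: "lip_const X (origin_pointed (scalars :: ('k, 'k) nspace)) g < L"
  shows "L \<in> lip_summing_consts p X (scalars :: ('k, 'k) nspace) g"
  unfolding lip_summing_consts_iff
proof (intro conjI allI impI)
  have L0: "0 < L" using lip_maps_bound(1)[OF g] L by simp
  thus "0 \<le> L" by simp
  fix n :: nat and x y and lam :: "nat \<Rightarrow> real"
  assume h: "\<forall>j<n. x j \<in> points X \<and> y j \<in> points X \<and> 0 < lam j"
  let ?f = "\<lambda>x\<in>points X. g x / of_real L"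
  have "norm (g x - g y) \<le> L * pdist X x y" if "x \<in> points X" "y \<in> points X" for x y
    using lip_maps_bound(2)[OF g that] mult_right_mono[OF less_imp_le[OF L] mdist_nonneg, of "fst X" x y] by simp
  hence ball: "?f \<in> unit_ball (sharp X)"
    using L0 X lip_maps_base[OF g]
    by (intro sharp_ballI) (auto simp: pointed_metric_space_def norm_divide diff_divide_distrib[symmetric] field_simps)
  have "(\<Sum>j<n. lam j powr p * norm (g (x j) - g (y j)) powr p) powr (1 / p) / L
      = (\<Sum>j<n. lam j powr p * (norm (g (x j) - g (y j)) / L) powr p) powr (1 / p)"
    using p L0 by (simp add: lp_norm_divide)
  also have "(\<Sum>j<n. lam j powr p * (norm (g (x j) - g (y j)) / L) powr p)
      = (\<Sum>j<n. lam j powr p * norm (?f (x j) - ?f (y j)) powr p)"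
    using h L0 by (intro sum.cong) (auto simp: norm_divide diff_divide_distrib[symmetric])
  also have "(\<Sum>j<n. lam j powr p * norm (?f (x j) - ?f (y j)) powr p) powr (1 / p) \<le> weak_lip TYPE('k) p X n x y lam"
    by (rule weak_lip_upper[OF p ball h])
  finally show "(\<Sum>j<n. lam j powr p * vnorm scalars (vsub scalars (g (x j)) (g (y j))) powr p) powr (1 / p)
    \<le> L * weak_lip TYPE('k) p X n x y lam"
    using L0 by (simp add: field_simps)
qed

lemma summing_const_of_evaluation:
  assumes e: "e \<in> carr F" and t: "vnorm F e \<le> t" "0 < t"
  shows "t \<in> summing_consts q (dual F) scalars (\<lambda>b\<in>carr (dual F). b e)"
  unfolding summing_consts_iff
proof (intro conjI allI impI)
  show "0 \<le> t" using t by simp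
  fix n :: nat and u assume h: "\<forall>j<n. u j \<in> carr (dual F)"
  let ?f = "\<lambda>b\<in>carr (dual F). b e / of_real t"
  have "(\<Sum>j<n. norm (u j e) powr q) powr (1 / q) / t = (\<Sum>j<n. (norm (u j e) / t) powr q) powr (1 / q)"
    using q t lp_norm_divide[of q t n "\<lambda>j. norm (u j e)" "\<lambda>_. 1"] by simp
  also have "(\<Sum>j<n. (norm (u j e) / t) powr q) = (\<Sum>j<n. norm (?f (u j)) powr q)"
    using h t by (intro sum.cong) (auto simp: norm_divide)
  also have "(\<Sum>j<n. norm (?f (u j)) powr q) powr (1 / q) \<le> weak_norm q (dual F) n u"
    by (intro weak_norm_upper[OF q bidual_ball_eval[OF F.normed_space_axioms e t] h] dual_norm_nonneg F.normed_space_axioms)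
  finally have le: "(\<Sum>j<n. norm (u j e) powr q) powr (1 / q) \<le> t * weak_norm q (dual F) n u"
    using t by (simp add: field_simps)
  have "(\<Sum>j<n. vnorm scalars ((\<lambda>b\<in>carr (dual F). b e) (u j)) powr q) = (\<Sum>j<n. norm (u j e) powr q)"
    using h by (intro sum.cong) auto
  with le show "(\<Sum>j<n. vnorm scalars ((\<lambda>b\<in>carr (dual F). b e) (u j)) powr q) powr (1 / q) \<le> t * weak_norm q (dual F) n u"
    by simp
qed

text \<open>
  The scalar function \<open>g\<close> and the evaluation at \<open>e\<close> dominate \<open>g \<boxdot> e\<close>, with every
  \<open>L > Lip(g)\<close> and every \<open>t > \<parallel>e\<parallel>\<close> as summing constants; taking these strictly larger avoids a division
  by zero for \<open>g = 0\<close> or \<open>e = 0\<close>.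
\<close>

lemma elementary_map:
  assumes g: "g \<in> lip_maps X (origin_pointed (scalars :: ('k, 'k) nspace))" and e: "e \<in> carr F"
  defines "T \<equiv> (\<lambda>x\<in>points X. vscale F (g x) e)"
  shows "T \<in> Dom" and "D T = lip_const X (origin_pointed scalars) g * vnorm F e"
proof -
  let ?l = "lip_const X (origin_pointed (scalars :: ('k, 'k) nspace)) g"
  have l0: "0 \<le> ?l" by (rule lip_maps_bound(1)[OF g])
  have e0: "0 \<le> vnorm F e" by (rule F.norm_nonneg[OF e])
  have T: "pointed_map T"
    using e lip_maps_base[OF g] X F.scale_closed F.scale_zero
    by (auto simp: T_def pointed_map_def pointed_metric_space_def)
  have diff: "vsub F (T x) (T y) = vscale F (g x - g y) e" if "x \<in> points X" "y \<in> points X" for x y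
    using that e F.scale_add_left[OF e, of "g x" "- g y"] by (simp add: T_def vsub_def F.scale_scale)
  have dom: "dominated_with p \<theta> q \<nu> X F T (L * t) (scalars :: ('k, 'k) nspace) (scalars :: ('k, 'k) nspace) g (\<lambda>b\<in>carr (dual F). b e) L t"
    if L: "?l < L" and t: "vnorm F e < t" for L t
    unfolding dominated_with_def
  proof (intro conjI ballI banach_scalars g)
    show pos: "0 < L" "0 < t" using l0 e0 L t by auto
    show "L \<in> lip_summing_consts p X scalars g" by (rule lip_summing_const_of_function[OF g L])
    show "t \<in> summing_consts q (dual F) scalars (\<lambda>b\<in>carr (dual F). b e)"
      by (rule summing_const_of_evaluation[OF e less_imp_le[OF t] pos(2)])
    show "(\<lambda>b\<in>carr (dual F). b e) \<in> bounded_ops (dual F) scalars"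
    proof (rule bounded_opsI)
      fix b assume b: "b \<in> carr (dual F)"
      show "(\<lambda>b\<in>carr (dual F). b e) (vadd (dual F) b b') = vadd scalars ((\<lambda>b\<in>carr (dual F). b e) b) ((\<lambda>b\<in>carr (dual F). b e) b')"
        if "b' \<in> carr (dual F)" for b'
        using F.dual_closed(1)[OF b that] b that e by (simp add: dual_ops)
      show "(\<lambda>b\<in>carr (dual F). b e) (vscale (dual F) a b) = vscale scalars a ((\<lambda>b\<in>carr (dual F). b e) b)" for a
        using F.dual_closed(2)[OF b, of a] b e by (simp add: dual_ops)
      show "vnorm scalars ((\<lambda>b\<in>carr (dual F). b e) b) \<le> vnorm F e * vnorm (dual F) b"
        using dual_bound[OF b F.norm_nonneg e] b by (simp add: mult.commute)
    qed simp_all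
    fix x y b assume x: "x \<in> points X" "y \<in> points X" and b: "b \<in> carr (dual F)"
    define u where "u = norm (g x - g y) / L"
    define v where "v = norm (b e) / t"
    have "norm (g x - g y) \<le> L * pdist X x y"
      using lip_maps_bound(2)[OF g x] mult_right_mono[OF less_imp_le[OF L] mdist_nonneg, of "fst X" x y] by simp
    hence u: "0 \<le> u" "u \<le> pdist X x y" using pos by (auto simp: u_def field_simps)
    have "norm (b e) \<le> vnorm (dual F) b * t"
      using dual_bound[OF b F.norm_nonneg e] mult_left_mono[OF less_imp_le[OF t] dual_norm_nonneg[OF b F.normed_space_axioms]] by simp
    hence v: "0 \<le> v" "v \<le> vnorm (dual F) b" using pos by (auto simp: v_def field_simps)
    have "norm (b (vsub F (T x) (T y))) = L * t * (u * v)"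
      using pos e b by (simp add: diff[OF x] functional_scale norm_mult u_def v_def)
    also have "\<dots> \<le> L * t * (pdist X x y powr \<theta> * u powr (1 - \<theta>) * (vnorm (dual F) b powr \<nu> * v powr (1 - \<nu>)))"
      using u v pos \<theta> \<nu> by (intro mult_left_mono mult_mono powr_interpolate) auto
    finally show "norm (b (vsub F (T x) (T y))) \<le> L * t * (pdist X x y powr \<theta> * (vnorm scalars (vsub scalars (g x) (g y)) / L) powr (1 - \<theta>)
        * (vnorm (dual F) b powr \<nu> * (vnorm scalars ((\<lambda>b\<in>carr (dual F). b e) b) / t) powr (1 - \<nu>)))"
      using b by (simp add: u_def v_def)
  qed
  have le: "D T \<le> L * t" if "?l < L" "vnorm F e < t" for L t
    using that l0 e0 by (intro dominated_with_imp_dominated(2)[OF dom _ T]) auto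
  show TD: "T \<in> Dom"
    using l0 e0 by (intro dominated_with_imp_dominated(1)[OF dom[of "?l + 1" "vnorm F e + 1"] _ T]) auto
  show "D T = ?l * vnorm F e"
  proof (rule antisym)
    have "D T \<le> ?l * t" if "vnorm F e < t" for t
      by (rule le_mult_of_le_greater[OF le]) (use that e0 in auto)
    thus "D T \<le> ?l * vnorm F e"
      using le_mult_of_le_greater[of "vnorm F e" "D T" ?l] l0 by (simp add: mult.commute)
    show "?l * vnorm F e \<le> D T"
    proof (cases "vnorm F e = 0")
      case False
      hence ep: "0 < vnorm F e" using e0 by simp
      have "norm (g x - g y) \<le> D T / vnorm F e * pdist X x y" if x: "x \<in> points X" "y \<in> points X" for x y
        using dominated_lipschitz[OF TD x] ep by (simp add: diff[OF x] F.norm_scale e field_simps)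
      hence "?l \<le> D T / vnorm F e"
        using dominated_norm_nonneg[OF TD] e0 by (intro lip_const_le) auto
      thus ?thesis using ep by (simp add: field_simps)
    qed (simp add: dominated_norm_nonneg[OF TD])
  qed
qed

end

lemma adjoint:
  assumes F: "normed_space F" and F0: "normed_space F0" and B: "B \<in> bounded_ops F F0" and K: "op_norm F F0 B \<le> K"
    and b: "b \<in> carr (dual F0)"
  defines "adj \<equiv> \<lambda>b. \<lambda>u\<in>carr F. b (B u)"
  shows "adj b \<in> carr (dual F)" "vnorm (dual F) (adj b) \<le> K * vnorm (dual F0) b"
    "b' \<in> carr (dual F0) \<Longrightarrow> adj (vadd (dual F0) b b') = vadd (dual F) (adj b) (adj b')"
    "adj (vscale (dual F0) a b) = vscale (dual F) a (adj b)"
proof -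
  interpret F: normed_space F by fact
  interpret F0: normed_space F0 by fact
  have b': "b \<in> bounded_ops F0 scalars" using b by (simp add: dual_simps)
  have K0: "0 \<le> K" using op_norm_bound(1)[OF B F.norm_nonneg] K by simp
  have bound: "norm (adj b u) \<le> K * vnorm (dual F0) b * vnorm F u" if u: "u \<in> carr F" for u
  proof -
    have "norm (adj b u) \<le> vnorm (dual F0) b * vnorm F0 (B u)"
      using dual_bound[OF b F0.norm_nonneg bounded_opsD(2)[OF B u]] u by (simp add: adj_def)
    also have "\<dots> \<le> vnorm (dual F0) b * (K * vnorm F u)"
      using order_trans[OF op_norm_bound(2)[OF B F.norm_nonneg u] mult_right_mono[OF K F.norm_nonneg[OF u]]]
        dual_norm_nonneg[OF b F0] by (intro mult_left_mono) auto
    finally show ?thesis by (simp add: mult_ac)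
  qed
  show "adj b \<in> carr (dual F)"
    unfolding dual_simps using bound bounded_opsD[OF B] bounded_opsD[OF b']
    by (intro bounded_opsI[of _ _ _ "K * vnorm (dual F0) b"]) (auto simp: adj_def F.add_closed F.scale_closed)
  show "vnorm (dual F) (adj b) \<le> K * vnorm (dual F0) b"
    unfolding dual_simps(2)[of F] using bound K0 dual_norm_nonneg[OF b F0] by (intro op_norm_le) auto
  show "adj (vadd (dual F0) b b') = vadd (dual F) (adj b) (adj b')" if "b' \<in> carr (dual F0)"
    using bounded_opsD(2)[OF B] by (auto simp: adj_def dual_ops)
  show "adj (vscale (dual F0) a b) = vscale (dual F) a (adj b)"
    using bounded_opsD(2)[OF B] by (auto simp: adj_def dual_ops)
qed

text \<open>
  If \<open>f\<close> is in the unit ball for \<open>X\<close>, then \<open>f P/L\<close> is in the unit ball for \<open>X0\<close>.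
\<close>

lemma weak_lip_compose:
  fixes X :: "'x pointed" and X0 :: "'y pointed"
  assumes p: "1 \<le> p" and X: "pointed_metric_space X" and X0: "pointed_metric_space X0"
    and P: "P \<in> lip_maps X0 X" and L: "lip_const X0 X P < L"
    and h: "\<forall>j<n. x j \<in> points X0 \<and> y j \<in> points X0 \<and> 0 < lam j"
  shows "weak_lip TYPE('k :: real_normed_field) p X n (\<lambda>j. P (x j)) (\<lambda>j. P (y j)) lam
    \<le> L * weak_lip TYPE('k) p X0 n x y lam"
  unfolding weak_lip_def[of _ _ X]
proof (rule cSUP_least)
  show "unit_ball (sharp X :: ('k, 'x \<Rightarrow> 'k) nspace) \<noteq> {}" using zero_in_sharp_ball[OF X] by auto
  fix f :: "'x \<Rightarrow> 'k" assume f: "f \<in> unit_ball (sharp X)"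
  have L0: "0 < L" using lip_maps_bound(1)[OF P] L by simp
  note Pc = lip_maps_closed[OF P]
  let ?f = "\<lambda>x\<in>points X0. f (P x) / of_real L"
  have "norm (f (P x) - f (P y)) \<le> L * pdist X0 x y" if xy: "x \<in> points X0" "y \<in> points X0" for x y
    using sharp_ball_bound[OF f Pc[OF xy(1)] Pc[OF xy(2)]] lip_maps_bound(2)[OF P xy]
      mult_right_mono[OF less_imp_le[OF L] mdist_nonneg, of "fst X0" x y] by linarith
  moreover have "f (base X) = 0" using f lip_maps_base[of f X] by (force simp: unit_ball_def sharp_simps)
  ultimately have ball: "?f \<in> unit_ball (sharp X0)"
    using L0 X0 lip_maps_base[OF P]
    by (intro sharp_ballI) (auto simp: pointed_metric_space_def norm_divide diff_divide_distrib[symmetric] field_simps)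
  have "(\<Sum>j<n. lam j powr p * norm (f (P (x j)) - f (P (y j))) powr p) powr (1 / p) / L
      = (\<Sum>j<n. lam j powr p * (norm (f (P (x j)) - f (P (y j))) / L) powr p) powr (1 / p)"
    using p L0 by (simp add: lp_norm_divide)
  also have "(\<Sum>j<n. lam j powr p * (norm (f (P (x j)) - f (P (y j))) / L) powr p)
      = (\<Sum>j<n. lam j powr p * norm (?f (x j) - ?f (y j)) powr p)"
    using h L0 by (intro sum.cong) (auto simp: norm_divide diff_divide_distrib[symmetric])
  also have "(\<Sum>j<n. lam j powr p * norm (?f (x j) - ?f (y j)) powr p) powr (1 / p) \<le> weak_lip TYPE('k) p X0 n x y lam"
    by (rule weak_lip_upper[OF p ball h])
  finally show "(\<Sum>j<n. lam j powr p * norm (f (P (x j)) - f (P (y j))) powr p) powr (1 / p)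
    \<le> L * weak_lip TYPE('k) p X0 n x y lam"
    using L0 by (simp add: field_simps)
qed

text \<open>
  If \<open>\<phi>\<close> is in the bidual ball of \<open>F\<close>, then \<open>\<phi> B\<^sup>*/K\<close> is in the bidual ball of \<open>F0\<close>.
\<close>

lemma weak_norm_adjoint:
  assumes q: "1 \<le> q" and F: "normed_space F" and F0: "normed_space F0" and B: "B \<in> bounded_ops F F0" and K: "op_norm F F0 B < K"
    and h: "\<forall>j<n. b j \<in> carr (dual F0)"
  shows "weak_norm q (dual F) n (\<lambda>j. \<lambda>u\<in>carr F. b j (B u)) \<le> K * weak_norm q (dual F0) n b"
  unfolding weak_norm_def[of _ "dual F"]
proof (rule cSUP_least)
  show "unit_ball (dual (dual F)) \<noteq> {}" by (rule bidual_ball_nonempty[OF F])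
  fix \<phi> assume \<phi>: "\<phi> \<in> unit_ball (dual (dual F))"
  hence \<phi>': "\<phi> \<in> bounded_ops (dual F) scalars" by (simp add: unit_ball_def dual_simps)
  have K0: "0 < K" using op_norm_bound(1)[OF B normed_space.norm_nonneg[OF F]] K by simp
  let ?adj = "\<lambda>b. \<lambda>u\<in>carr F. b (B u)"
  note adj = adjoint[OF F F0 B less_imp_le[OF K]]
  let ?\<psi> = "\<lambda>b\<in>carr (dual F0). \<phi> (?adj b) / of_real K"
  have bound: "norm (\<phi> (?adj b)) \<le> K * vnorm (dual F0) b" if b: "b \<in> carr (dual F0)" for b
    using dual_ball_bound[OF \<phi> dual_norm_nonneg[OF _ F] adj(1)[OF b]] adj(2)[OF b] by linarith
  have ball: "?\<psi> \<in> unit_ball (dual (dual F0))"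
  proof (rule dual_ballI)
    show le: "norm (?\<psi> b) \<le> vnorm (dual F0) b" if "b \<in> carr (dual F0)" for b
      using bound[OF that] that K0 by (simp add: norm_divide field_simps)
    show "?\<psi> \<in> bounded_ops (dual F0) scalars"
    proof (rule bounded_opsI[of _ _ _ 1])
      fix b assume b: "b \<in> carr (dual F0)"
      show "?\<psi> (vadd (dual F0) b b') = vadd scalars (?\<psi> b) (?\<psi> b')" if b': "b' \<in> carr (dual F0)" for b'
        using b b' normed_space.dual_closed(1)[OF F0 b b'] adj(3)[OF b b'] bounded_opsD(3)[OF \<phi>' adj(1)[OF b] adj(1)[OF b']]
        by (simp add: add_divide_distrib)
      show "?\<psi> (vscale (dual F0) a b) = vscale scalars a (?\<psi> b)" for a
        using b normed_space.dual_closed(2)[OF F0 b] adj(4)[OF b] bounded_opsD(4)[OF \<phi>' adj(1)[OF b]] by simp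
    qed (use le in auto)
  qed
  have "(\<Sum>j<n. norm (\<phi> (?adj (b j))) powr q) powr (1 / q) / K = (\<Sum>j<n. (norm (\<phi> (?adj (b j))) / K) powr q) powr (1 / q)"
    using q K0 lp_norm_divide[of q K n "\<lambda>j. norm (\<phi> (?adj (b j)))" "\<lambda>_. 1"] by simp
  also have "(\<Sum>j<n. (norm (\<phi> (?adj (b j))) / K) powr q) = (\<Sum>j<n. norm (?\<psi> (b j)) powr q)"
    using h K0 by (intro sum.cong) (auto simp: norm_divide)
  also have "(\<Sum>j<n. norm (?\<psi> (b j)) powr q) powr (1 / q) \<le> weak_norm q (dual F0) n b"
    by (intro weak_norm_upper[OF q ball h] dual_norm_nonneg F0)
  finally show "(\<Sum>j<n. norm (\<phi> (?adj (b j))) powr q) powr (1 / q) \<le> K * weak_norm q (dual F0) n b"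
    by (simp only: pos_divide_le_eq[OF K0] mult.commute[of K])
qed

text \<open>
  The pair \<open>S P\<close>, \<open>R B\<^sup>*\<close> dominates, because \<open>\<langle>BTPx - BTPy, b\<rangle> = \<langle>TPx - TPy, B\<^sup>* b\<rangle>\<close>.  The factors
  \<open>L\<^sup>\<theta>\<close> from the distance and \<open>L\<^bsup>1-\<theta>\<^esup>\<close> from the summing constant multiply to \<open>L\<close>, and likewise for \<open>K\<close>.
\<close>

lemma dominated_with_compose:
  fixes X :: "'x pointed" and X0 :: "'y pointed"
    and F :: "('k :: {real_normed_field, banach}, 'f) nspace" and F0 :: "('k, 'e) nspace"
  assumes sX: "domination_setting p \<theta> q \<nu> X F" and sX0: "domination_setting p \<theta> q \<nu> X0 F0"
    and d: "dominated_with p \<theta> q \<nu> X F T c G H S R \<sigma> \<rho>" and c: "0 \<le> c"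
    and T: "T \<in> points X \<rightarrow> carr F"
    and P: "P \<in> lip_maps X0 X" and L: "lip_const X0 X P < L"
    and B: "B \<in> bounded_ops F F0" and K: "op_norm F F0 B < K"
  shows "dominated_with p \<theta> q \<nu> X0 F0 (\<lambda>x\<in>points X0. B (T (P x))) (c * L * K) G H
    (\<lambda>x\<in>points X0. S (P x)) (\<lambda>b\<in>carr (dual F0). R (\<lambda>u\<in>carr F. b (B u))) (\<sigma> * L) (\<rho> * K)"
proof -
  interpret A: domination_setting p \<theta> q \<nu> X F by fact
  interpret A0: domination_setting p \<theta> q \<nu> X0 F0 by fact
  note p = A.p and q = A.q and \<theta> = A.\<theta> and \<nu> = A.\<nu> and X = A.X and X0 = A0.X
  note F = A.F.normed_space_axioms and F0 = A0.F.normed_space_axioms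
  note d' = d[unfolded dominated_with_def]
  have nG: "normed_space G" and nH: "normed_space H" using d' by (auto simp: banach_space_def)
  interpret G: normed_space G by fact
  have S: "S \<in> lip_maps X (origin_pointed G)" and R: "R \<in> bounded_ops (dual F) H" using d' by auto
  have Sc: "S x \<in> carr G" if "x \<in> points X" for x using lip_maps_origin_closed[OF nG S] that by blast
  have pos: "0 < \<sigma>" "0 < \<rho>" "0 < L" "0 < K"
    using d' L K lip_maps_bound(1)[OF P] op_norm_bound(1)[OF B A.F.norm_nonneg] by auto
  note Pc = lip_maps_closed[OF P]
  have dP: "pdist X (P x) (P y) \<le> L * pdist X0 x y" if xy: "x \<in> points X0" "y \<in> points X0" for x y
    using lip_maps_bound(2)[OF P xy] mult_right_mono[OF less_imp_le[OF L] mdist_nonneg, of "fst X0" x y] by linarith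
  let ?adj = "\<lambda>b. \<lambda>u\<in>carr F. b (B u)"
  let ?S = "\<lambda>x\<in>points X0. S (P x)" and ?R = "\<lambda>b\<in>carr (dual F0). R (?adj b)" and ?T = "\<lambda>x\<in>points X0. B (T (P x))"
  note adj = adjoint[OF F F0 B less_imp_le[OF K]]
  show ?thesis
    unfolding dominated_with_def
  proof (intro conjI ballI)
    show "banach_space G" "banach_space H" "0 < \<sigma> * L" "0 < \<rho> * K" using d' pos by auto
    have lS: "vnorm G (vsub G (S x) (S y)) \<le> \<sigma> * pdist X x y" if "x \<in> points X" "y \<in> points X" for x y
      using d' that Sc by (intro lip_summing_lipschitz[OF _ p X nG]) auto
    show "?S \<in> lip_maps X0 (origin_pointed G)"
    proof (rule lip_mapsI)
      show "?S (base X0) = base (origin_pointed G)"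
        using lip_maps_base[OF P] lip_maps_base[OF S] X0 by (simp add: pointed_metric_space_def)
      fix x y assume xy: "x \<in> points X0" "y \<in> points X0"
      have "vnorm G (vsub G (S (P x)) (S (P y))) \<le> \<sigma> * (L * pdist X0 x y)"
        using order_trans[OF lS[OF Pc[OF xy(1)] Pc[OF xy(2)]] mult_left_mono[OF dP[OF xy]]] pos by simp
      thus "pdist (origin_pointed G) (?S x) (?S y) \<le> (\<sigma> * L) * pdist X0 x y"
        using xy Sc Pc by (simp add: G.mdist_norm_metric)
    qed (auto simp: Sc Pc)
    have lR: "vnorm H (R b) \<le> \<rho> * vnorm (dual F) b" if "b \<in> carr (dual F)" for b
      using d' that bounded_opsD(2)[OF R] by (intro summing_bounded[OF _ q F nH]) auto
    show "?R \<in> bounded_ops (dual F0) H"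
    proof (rule bounded_opsI)
      fix b assume b: "b \<in> carr (dual F0)"
      show "?R b \<in> carr H" using b adj(1)[OF b] bounded_opsD(2)[OF R] by simp
      show "?R (vadd (dual F0) b b') = vadd H (?R b) (?R b')" if b': "b' \<in> carr (dual F0)" for b'
        using b b' adj(3)[OF b b'] bounded_opsD(3)[OF R adj(1)[OF b] adj(1)[OF b']] A0.F.dual_closed(1)[OF b b'] by simp
      show "?R (vscale (dual F0) a b) = vscale H a (?R b)" for a
        using b adj(4)[OF b] bounded_opsD(4)[OF R adj(1)[OF b]] A0.F.dual_closed(2)[OF b] by simp
      have "vnorm H (R (?adj b)) \<le> \<rho> * (K * vnorm (dual F0) b)"
        using order_trans[OF lR[OF adj(1)[OF b]] mult_left_mono[OF adj(2)[OF b]]] pos by simp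
      thus "vnorm H (?R b) \<le> (\<rho> * K) * vnorm (dual F0) b" using b by simp
    qed simp
    show "\<sigma> * L \<in> lip_summing_consts p X0 G ?S"
      unfolding lip_summing_consts_iff
    proof (intro conjI allI impI)
      show "0 \<le> \<sigma> * L" using pos by simp
      fix n :: nat and x y and lam :: "nat \<Rightarrow> real"
      assume h: "\<forall>j<n. x j \<in> points X0 \<and> y j \<in> points X0 \<and> 0 < lam j"
      have "(\<Sum>j<n. lam j powr p * vnorm G (vsub G (?S (x j)) (?S (y j))) powr p)
          = (\<Sum>j<n. lam j powr p * vnorm G (vsub G (S (P (x j))) (S (P (y j)))) powr p)"
        using h by (intro sum.cong) auto
      also have "\<dots> powr (1 / p) \<le> \<sigma> * weak_lip TYPE('k) p X n (\<lambda>j. P (x j)) (\<lambda>j. P (y j)) lam"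
        using d' h Pc by (intro lip_summing_constsD) auto
      also have "\<dots> \<le> \<sigma> * (L * weak_lip TYPE('k) p X0 n x y lam)"
        using weak_lip_compose[OF p X X0 P L h] pos by (intro mult_left_mono) auto
      finally show "(\<Sum>j<n. lam j powr p * vnorm G (vsub G (?S (x j)) (?S (y j))) powr p) powr (1 / p)
        \<le> \<sigma> * L * weak_lip TYPE('k) p X0 n x y lam" by simp
    qed
    show "\<rho> * K \<in> summing_consts q (dual F0) H ?R"
      unfolding summing_consts_iff
    proof (intro conjI allI impI)
      show "0 \<le> \<rho> * K" using pos by simp
      fix n :: nat and u assume h: "\<forall>j<n. u j \<in> carr (dual F0)"
      have "(\<Sum>j<n. vnorm H (?R (u j)) powr q) = (\<Sum>j<n. vnorm H (R (?adj (u j))) powr q)"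
        using h by (intro sum.cong) auto
      also have "\<dots> powr (1 / q) \<le> \<rho> * weak_norm q (dual F) n (\<lambda>j. ?adj (u j))"
        by (rule summing_constsD) (use d' h adj(1) in blast)+
      also have "\<dots> \<le> \<rho> * (K * weak_norm q (dual F0) n u)"
        using weak_norm_adjoint[OF q F F0 B K h] pos by (intro mult_left_mono) auto
      finally show "(\<Sum>j<n. vnorm H (?R (u j)) powr q) powr (1 / q) \<le> \<rho> * K * weak_norm q (dual F0) n u" by simp
    qed
    fix x y b assume x: "x \<in> points X0" "y \<in> points X0" and b: "b \<in> carr (dual F0)"
    let ?s = "vnorm G (vsub G (S (P x)) (S (P y))) / \<sigma>" and ?r = "vnorm H (R (?adj b)) / \<rho>"
    have s0: "0 \<le> ?s" using Sc Pc x pos by (simp add: G.norm_nonneg G.sub_closed)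
    have r0: "0 \<le> ?r" using bounded_opsD(2)[OF R adj(1)[OF b]] normed_space.norm_nonneg[OF nH] pos by simp
    have Tc: "T (P x) \<in> carr F" "T (P y) \<in> carr F" using T Pc x by auto
    have "b (vsub F0 (?T x) (?T y)) = ?adj b (vsub F (T (P x)) (T (P y)))"
      using x Tc bounded_ops_sub[OF B F Tc] A.F.sub_closed by simp
    also have "norm \<dots> \<le> c * (pdist X (P x) (P y) powr \<theta> * ?s powr (1 - \<theta>) * (vnorm (dual F) (?adj b) powr \<nu> * ?r powr (1 - \<nu>)))"
      using d' Pc x adj(1)[OF b] by blast
    also have "\<dots> \<le> c * ((L * pdist X0 x y) powr \<theta> * (L * (?s / L)) powr (1 - \<theta>) * ((K * vnorm (dual F0) b) powr \<nu> * (K * (?r / K)) powr (1 - \<nu>)))"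
      using c dP[OF x] adj(2)[OF b] \<theta> \<nu> dual_norm_nonneg[OF adj(1)[OF b] F] pos s0 r0
      by (intro mult_left_mono mult_mono powr_mono2) auto
    also have "\<dots> = c * ((L powr \<theta> * L powr (1 - \<theta>)) * (K powr \<nu> * K powr (1 - \<nu>)) *
        (pdist X0 x y powr \<theta> * (?s / L) powr (1 - \<theta>) * (vnorm (dual F0) b powr \<nu> * (?r / K) powr (1 - \<nu>))))"
      using pos s0 r0 dual_norm_nonneg[OF b F0] by (simp only: powr_mult mult_ac)
    also have "\<dots> = c * L * K * (pdist X0 x y powr \<theta> * (?s / L) powr (1 - \<theta>) * (vnorm (dual F0) b powr \<nu> * (?r / K) powr (1 - \<nu>)))"
      using pos by (simp add: powr_convex_split)
    finally show "norm (b (vsub F0 (?T x) (?T y))) \<le> c * L * K * (pdist X0 x y powr \<theta> * (vnorm G (vsub G (?S x) (?S y)) / (\<sigma> * L)) powr (1 - \<theta>)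
       * (vnorm (dual F0) b powr \<nu> * (vnorm H (?R b) / (\<rho> * K)) powr (1 - \<nu>)))"
      using x b by simp
  qed
qed

lemma dominated_compose:
  fixes X :: "'x pointed" and X0 :: "'y pointed"
    and F :: "('k :: {real_normed_field, banach}, 'f) nspace" and F0 :: "('k, 'e) nspace"
  assumes sX: "domination_setting p \<theta> q \<nu> X F" and sX0: "domination_setting p \<theta> q \<nu> X0 F0"
    and TD: "T \<in> dominated p \<theta> q \<nu> X F" and P: "P \<in> lip_maps X0 X" and B: "B \<in> bounded_ops F F0"
  defines "T' \<equiv> (\<lambda>x\<in>points X0. B (T (P x)))"
  shows "T' \<in> dominated p \<theta> q \<nu> X0 F0"
    and "dominated_norm p \<theta> q \<nu> X0 F0 T' \<le> op_norm F F0 B * dominated_norm p \<theta> q \<nu> X F T * lip_const X0 X P"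
proof -
  interpret A: domination_setting p \<theta> q \<nu> X F by fact
  interpret A0: domination_setting p \<theta> q \<nu> X0 F0 by fact
  have T: "T \<in> points X \<rightarrow> carr F" "T (base X) = vzero F"
    using A.dominated_pointed_map[OF TD] by (auto simp: A.pointed_map_def)
  have "B (vzero F) = vzero F0"
    using bounded_opsD(4)[OF B A.F.zero_closed, of 0] bounded_opsD(2)[OF B A.F.zero_closed]
    by (simp add: A.F.scale_zero A.F.zero_closed A0.F.scale_zero)
  hence T': "A0.pointed_map T'"
    using T bounded_opsD(2)[OF B] lip_maps_closed[OF P] lip_maps_base[OF P] A0.X
    by (auto simp: A0.pointed_map_def T'_def pointed_metric_space_def)
  have n0: "0 \<le> A.D T" "0 \<le> lip_const X0 X P" "0 \<le> op_norm F F0 B"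
    using A.dominated_norm_nonneg[OF TD] lip_maps_bound(1)[OF P] op_norm_bound(1)[OF B A.F.norm_nonneg] by auto
  have D: "T' \<in> A0.Dom \<and> A0.D T' \<le> c * L * K"
    if c: "A.D T < c" and L: "lip_const X0 X P < L" and K: "op_norm F F0 B < K" for c L K
  proof -
    have c0: "0 \<le> c" "0 \<le> c * L * K" using n0 c L K by auto
    show ?thesis
    proof (rule A.less_dominated_norm_imp_dominated_with[OF TD c])
      fix G :: "('k, ('k, 'x) seqs) nspace" and H :: "('k, ('k, 'f \<Rightarrow> 'k) seqs) nspace" and S R \<sigma> \<rho>
      assume "dominated_with p \<theta> q \<nu> X F T c G H S R \<sigma> \<rho>"
      from dominated_with_compose[OF sX sX0 this c0(1) T(1) P L B K] show ?thesis
        using A0.dominated_with_imp_dominated[OF _ c0(2) T'] unfolding T'_def by blast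
    qed
  qed
  show "T' \<in> A0.Dom" using D[of "A.D T + 1" "lip_const X0 X P + 1" "op_norm F F0 B + 1"] by simp
  have LK': "A0.D T' \<le> A.D T * (L * K)" if "lip_const X0 X P < L" "op_norm F F0 B < K" for L K
    by (rule le_mult_of_le_greater) (use D that n0 in \<open>auto simp: mult.assoc\<close>)
  have LK: "A0.D T' \<le> L * (A.D T * K)" if "lip_const X0 X P < L" "op_norm F F0 B < K" for L K
    using LK'[OF that] by (simp add: mult_ac)
  have K': "A0.D T' \<le> lip_const X0 X P * (A.D T * K)" if "op_norm F F0 B < K" for K
    by (rule le_mult_of_le_greater[OF LK]) (use that n0 in auto)
  have K: "A0.D T' \<le> K * (A.D T * lip_const X0 X P)" if "op_norm F F0 B < K" for K
    using K'[OF that] by (simp add: mult_ac)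
  have "A0.D T' \<le> op_norm F F0 B * (A.D T * lip_const X0 X P)"
    by (rule le_mult_of_le_greater[OF K]) (use n0 in auto)
  thus "A0.D T' \<le> op_norm F F0 B * A.D T * lip_const X0 X P" by (simp add: mult_ac)
qed

section \<open>Series of dominated maps\<close>

lemma (in normed_space) sub_zero: "u \<in> carr V \<Longrightarrow> vsub V u (vzero V) = u"
  by (simp add: vsub_def scale_vzero add_zero)

lemma lp_sum_normalised_terms:
  assumes "1 \<le> p" "0 < \<sigma>" "0 \<le> (x::real)"
  shows "w / \<sigma> powr p * x powr p = w * (x / \<sigma>) powr p"
  using assms by (simp add: powr_divide)

lemma lp_sum_bounded_mem:
  assumes p: "1 \<le> p" and w: "\<And>n. 0 < w n" "summable w" and \<sigma>: "\<And>n. 0 < \<sigma> n" and V: "\<And>n. normed_space (V n)"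
    and v: "\<And>n. v n \<in> carr (V n)" "\<And>n. vnorm (V n) (v n) \<le> \<sigma> n * M"
  shows "v \<in> carr (lp_sum p (\<lambda>n. w n / \<sigma> n powr p) V)"
proof -
  have "norm (w n / \<sigma> n powr p * vnorm (V n) (v n) powr p) \<le> M powr p * w n" for n
  proof -
    have v0: "0 \<le> vnorm (V n) (v n)" using normed_space.norm_nonneg[OF V v(1)] .
    have "(vnorm (V n) (v n) / \<sigma> n) powr p \<le> M powr p"
      using p v(2)[of n] v0 \<sigma>[of n] by (intro powr_mono2) (auto simp: field_simps)
    hence "w n * (vnorm (V n) (v n) / \<sigma> n) powr p \<le> M powr p * w n"
      using w(1)[of n] by simp
    moreover have "0 \<le> w n * (vnorm (V n) (v n) / \<sigma> n) powr p" using w(1)[of n] by simp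
    ultimately show ?thesis
      unfolding lp_sum_normalised_terms[OF p \<sigma> v0] real_norm_def by linarith
  qed
  hence "summable (\<lambda>n. w n / \<sigma> n powr p * vnorm (V n) (v n) powr p)"
    by (intro summable_comparison_test[OF _ summable_mult[OF w(2), of "M powr p"]]) blast
  thus ?thesis using v(1) by (simp add: lp_sum_simps)
qed

text \<open>
  This is the reason for the weights \<open>w\<^sub>n/\<sigma>\<^sub>n\<^sup>p\<close>: if the \<open>n\<close>-th coordinates of finitely many vectors have
  strong norm at most \<open>\<sigma>\<^sub>n K\<close>, exchanging the two sums gives \<open>\<Sum>w\<^sub>n K\<^sup>p \<le> K\<^sup>p\<close>.  With \<open>K\<close> the weak norm of a
  finite sequence, it says that a combination of maps with summing constants \<open>\<sigma>\<^sub>n\<close> has summing constant \<open>1\<close>.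
\<close>

lemma lp_sum_strong_norm_le:
  fixes m :: nat
  assumes p: "1 \<le> p" and w: "\<And>n. 0 < w n" "summable w" "suminf w \<le> 1" and \<sigma>: "\<And>n. 0 < \<sigma> n" and V: "\<And>n. normed_space (V n)"
    and v: "\<And>j. j < m \<Longrightarrow> v j \<in> carr (lp_sum p (\<lambda>n. w n / \<sigma> n powr p) V)"
    and K: "0 \<le> K" "\<And>n. (\<Sum>j<m. l j powr p * vnorm (V n) (v j n) powr p) powr (1 / p) \<le> \<sigma> n * K"
  shows "(\<Sum>j<m. l j powr p * vnorm (lp_sum p (\<lambda>n. w n / \<sigma> n powr p) V) (v j) powr p) powr (1 / p) \<le> K"
proof -
  let ?a = "\<lambda>n. w n / \<sigma> n powr p"
  have a0: "0 \<le> ?a n" for n using w(1)[of n] by simp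
  have sm: "summable (\<lambda>n. ?a n * vnorm (V n) (v j n) powr p)" if "j < m" for j
    using v[OF that] by (simp add: lp_sum_simps)
  have "(\<Sum>j<m. l j powr p * vnorm (lp_sum p ?a V) (v j) powr p)
      = (\<Sum>j<m. \<Sum>n. l j powr p * (?a n * vnorm (V n) (v j n) powr p))"
  proof (rule sum.cong[OF refl])
    fix j assume j: "j \<in> {..<m}"
    have "0 \<le> (\<Sum>n. ?a n * vnorm (V n) (v j n) powr p)"
      using j a0 by (intro suminf_nonneg sm mult_nonneg_nonneg) auto
    hence "vnorm (lp_sum p ?a V) (v j) powr p = (\<Sum>n. ?a n * vnorm (V n) (v j n) powr p)"
      using p by (simp add: lp_sum_simps(5) powr_powr)
    thus "l j powr p * vnorm (lp_sum p ?a V) (v j) powr p = (\<Sum>n. l j powr p * (?a n * vnorm (V n) (v j n) powr p))"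
      using j by (simp only: suminf_mult[OF sm] lessThan_iff)
  qed
  also have "\<dots> = (\<Sum>n. \<Sum>j<m. l j powr p * (?a n * vnorm (V n) (v j n) powr p))"
    using sm by (intro suminf_sum[symmetric] summable_mult) auto
  also have "\<dots> \<le> (\<Sum>n. K powr p * w n)"
  proof (rule suminf_le)
    show "summable (\<lambda>n. K powr p * w n)" using w by (intro summable_mult)
    show "summable (\<lambda>n. \<Sum>j<m. l j powr p * (?a n * vnorm (V n) (v j n) powr p))"
      using sm by (intro summable_sum summable_mult) auto
    fix n
    have "(\<Sum>j<m. l j powr p * vnorm (V n) (v j n) powr p) \<le> (\<sigma> n * K) powr p"
      by (rule powr_le_powr_inverse_iff[THEN iffD1])
        (use p K less_imp_le[OF \<sigma>[of n]] in \<open>auto simp: sum_nonneg\<close>)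
    hence "?a n * (\<Sum>j<m. l j powr p * vnorm (V n) (v j n) powr p) \<le> ?a n * (\<sigma> n * K) powr p"
      using a0 by (intro mult_left_mono)
    also have "\<dots> = K powr p * w n" using \<sigma>[of n] K by (simp add: powr_mult)
    finally show "(\<Sum>j<m. l j powr p * (?a n * vnorm (V n) (v j n) powr p)) \<le> K powr p * w n"
      by (simp add: sum_distrib_left mult_ac)
  qed
  also have "\<dots> = K powr p * suminf w" using w by (intro suminf_mult)
  also have "\<dots> \<le> K powr p" using w by (intro mult_left_le) auto
  finally show ?thesis
    using powr_le_powr_inverse_iff[of p _ K] p K by (simp add: sum_nonneg)
qed

lemma lp_sum_norm_le:
  assumes p: "1 \<le> p" and w: "\<And>n. 0 < w n" "summable w" "suminf w \<le> 1" and \<sigma>: "\<And>n. 0 < \<sigma> n" and V: "\<And>n. normed_space (V n)"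
    and v: "\<And>n. v n \<in> carr (V n)" "\<And>n. vnorm (V n) (v n) \<le> \<sigma> n * M" and M: "0 \<le> M"
  shows "vnorm (lp_sum p (\<lambda>n. w n / \<sigma> n powr p) V) v \<le> M"
proof -
  have nn: "0 \<le> vnorm (V n) (v n)" for n using normed_space.norm_nonneg[OF V v(1)] .
  have "0 \<le> vnorm (lp_sum p (\<lambda>n. w n / \<sigma> n powr p) V) v" by (simp add: lp_sum_simps)
  thus ?thesis
    using lp_sum_strong_norm_le[of p w \<sigma> V 1 "\<lambda>_. v" M "\<lambda>_. 1", OF p w \<sigma> V lp_sum_bounded_mem[OF p w(1,2) \<sigma> V v] M] p v(2) nn
    by (simp add: powr_powr)
qed

context domination_setting
begin

text \<open>
  That \<open>T\<close> is the sum of the \<open>T\<^sub>n\<close> enters only through the inequality between functionals, which serves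
  finite sums and telescoping series alike.  The bounds \<open>c\<^sub>n > D T\<^sub>n\<close> are strict so that all weights are
  positive.
\<close>

lemma dominated_series:
  assumes Tn: "\<And>n. Tn n \<in> Dom" "\<And>n. D (Tn n) < c n" and c: "summable c" and T: "pointed_map T"
    and le: "\<And>x y b. \<lbrakk>x \<in> points X; y \<in> points X; b \<in> carr (dual F); summable (\<lambda>n. norm (b (vsub F (Tn n x) (Tn n y))))\<rbrakk> \<Longrightarrow>
      norm (b (vsub F (T x) (T y))) \<le> (\<Sum>n. norm (b (vsub F (Tn n x) (Tn n y))))"
  shows "T \<in> Dom" and "D T \<le> suminf c"
proof -
  have c0: "0 < c n" for n using dominated_norm_nonneg[OF Tn(1)] Tn(2) by (rule le_less_trans)
  define C where "C = suminf c"
  have C0: "0 < C" unfolding C_def using c c0 by (intro suminf_pos)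
  define w where "w n = c n / C" for n
  have w: "\<And>n. 0 < w n" "summable w" "suminf w \<le> 1"
    using c0 C0 c suminf_divide[OF c, of C] by (auto simp: w_def[abs_def] C_def summable_divide)
  have "\<forall>n. \<exists>(G :: ('k, ('k, 'x) seqs) nspace) (H :: ('k, ('k, 'f \<Rightarrow> 'k) seqs) nspace) S R \<sigma> \<rho>.
      dominated_with p \<theta> q \<nu> X F (Tn n) (c n) G H S R \<sigma> \<rho>"
    using less_dominated_norm_imp_dominated_with[OF Tn] by metis
  then obtain G :: "nat \<Rightarrow> ('k, ('k, 'x) seqs) nspace" and H :: "nat \<Rightarrow> ('k, ('k, 'f \<Rightarrow> 'k) seqs) nspace" and S R \<sigma> \<rho>
    where d: "\<And>n. dominated_with p \<theta> q \<nu> X F (Tn n) (c n) (G n) (H n) (S n) (R n) (\<sigma> n) (\<rho> n)"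
    by metis
  note d' = d[unfolded dominated_with_def]
  have bG: "banach_space (G n)" and bH: "banach_space (H n)" for n using d' by auto
  hence nG: "normed_space (G n)" and nH: "normed_space (H n)" for n by (auto simp: banach_space_def)
  have S: "S n \<in> lip_maps X (origin_pointed (G n))" and R: "R n \<in> bounded_ops (dual F) (H n)" for n using d' by auto
  have \<sigma>: "0 < \<sigma> n" "\<sigma> n \<in> lip_summing_consts p X (G n) (S n)" and \<rho>: "0 < \<rho> n" "\<rho> n \<in> summing_consts q (dual F) (H n) (R n)" for n
    using d' by auto
  have Sc: "S n x \<in> carr (G n)" if "x \<in> points X" for n x using lip_maps_origin_closed[OF nG S] that by blast
  have S0: "S n (base X) = vzero (G n)" for n using lip_maps_base[OF S] by simp
  have Rc: "R n b \<in> carr (H n)" if "b \<in> carr (dual F)" for n b using bounded_opsD(2)[OF R that] .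
  have Sl: "vnorm (G n) (vsub (G n) (S n x) (S n y)) \<le> \<sigma> n * pdist X x y" if "x \<in> points X" "y \<in> points X" for n x y
    using Sc that by (intro lip_summing_lipschitz[OF \<sigma>(2) p X nG]) auto
  have Rl: "vnorm (H n) (R n b) \<le> \<rho> n * vnorm (dual F) b" if "b \<in> carr (dual F)" for n b
    using Rc that by (intro summing_bounded[OF \<rho>(2) q F.normed_space_axioms nH]) auto
  define a a' where "a n = w n / \<sigma> n powr p" and "a' n = w n / \<rho> n powr q" for n
  have apos: "0 < a n" "0 < a' n" for n using w(1)[of n] \<sigma>(1)[of n] \<rho>(1)[of n] by (auto simp: a_def a'_def)
  let ?G = "lp_sum p a G" and ?H = "lp_sum q a' H"
  have nsG: "normed_space ?G" and nsH: "normed_space ?H"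
    using normed_space_lp_sum[OF p apos(1) nG] normed_space_lp_sum[OF q apos(2) nH] by auto
  let ?S = "\<lambda>x\<in>points X. \<lambda>n. S n x" and ?R = "\<lambda>b\<in>carr (dual F). \<lambda>n. R n b"
  have SG: "?S x \<in> carr ?G" if x: "x \<in> points X" for x
  proof -
    have base: "base X \<in> points X" using X by (simp add: pointed_metric_space_def)
    have le: "vnorm (G n) (S n x) \<le> \<sigma> n * pdist X x (base X)" for n
      using Sl[OF x base] normed_space.sub_zero[OF nG Sc[OF x]] S0 by simp
    have "(\<lambda>n. S n x) \<in> carr ?G"
      unfolding a_def by (rule lp_sum_bounded_mem[OF p w(1,2) \<sigma>(1) nG Sc[OF x] le])
    thus ?thesis using x by simp
  qed
  have RH: "?R b \<in> carr ?H" if b: "b \<in> carr (dual F)" for b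
  proof -
    have "(\<lambda>n. R n b) \<in> carr ?H"
      unfolding a'_def by (rule lp_sum_bounded_mem[OF q w(1,2) \<rho>(1) nH Rc[OF b] Rl[OF b]])
    thus ?thesis using b by simp
  qed
  have subS: "vsub ?G (?S x) (?S y) = (\<lambda>n. vsub (G n) (S n x) (S n y))" if "x \<in> points X" "y \<in> points X" for x y
    using that by (simp add: lp_sum_simps)
  have "dominated_with p \<theta> q \<nu> X F T C ?G ?H ?S ?R 1 1"
    unfolding dominated_with_def
  proof (intro conjI ballI zero_less_one)
    show "banach_space ?G" "banach_space ?H"
      using banach_lp_sum[OF p apos(1) bG] banach_lp_sum[OF q apos(2) bH] by auto
    show "?S \<in> lip_maps X (origin_pointed ?G)"
    proof (rule lip_mapsI)
      show "?S x \<in> points (origin_pointed ?G)" if "x \<in> points X" for x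
        using SG[OF that] by (simp add: normed_space.mspace_norm_metric[OF nsG])
      show "?S (base X) = base (origin_pointed ?G)"
        using X S0 by (simp add: pointed_metric_space_def lp_sum_simps)
      show "pdist (origin_pointed ?G) (?S x) (?S y) \<le> 1 * pdist X x y" if x: "x \<in> points X" "y \<in> points X" for x y
        using lp_sum_norm_le[OF p w \<sigma>(1) nG normed_space.sub_closed[OF nG Sc[OF x(1)] Sc[OF x(2)]] Sl[OF x]]
          normed_space.mdist_norm_metric[OF nsG SG[OF x(1)] SG[OF x(2)]] subS[OF x] by (simp add: a_def[abs_def])
    qed simp
    show "?R \<in> bounded_ops (dual F) ?H"
    proof (rule bounded_opsI)
      fix b assume b: "b \<in> carr (dual F)"
      show "?R b \<in> carr ?H" by (rule RH[OF b])
      show "?R (vadd (dual F) b b') = vadd ?H (?R b) (?R b')" if b': "b' \<in> carr (dual F)" for b'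
        using b b' F.dual_closed(1)[OF b b'] bounded_opsD(3)[OF R b b'] by (simp add: lp_sum_simps)
      show "?R (vscale (dual F) k b) = vscale ?H k (?R b)" for k
        using b F.dual_closed(2)[OF b] bounded_opsD(4)[OF R b] by (simp add: lp_sum_simps)
      show "vnorm ?H (?R b) \<le> 1 * vnorm (dual F) b"
        using lp_sum_norm_le[OF q w \<rho>(1) nH Rc[OF b] Rl[OF b] dual_norm_nonneg[OF b F.normed_space_axioms]] b
        by (simp add: a'_def[abs_def])
    qed simp
    show "1 \<in> lip_summing_consts p X ?G ?S"
      unfolding lip_summing_consts_iff
    proof (intro conjI allI impI zero_le_one)
      fix n :: nat and x y and lam :: "nat \<Rightarrow> real"
      assume h: "\<forall>j<n. x j \<in> points X \<and> y j \<in> points X \<and> 0 < lam j"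
      show "(\<Sum>j<n. lam j powr p * vnorm ?G (vsub ?G (?S (x j)) (?S (y j))) powr p) powr (1 / p) \<le> 1 * weak_lip TYPE('k) p X n x y lam"
        unfolding mult_1 a_def
      proof (rule lp_sum_strong_norm_le[OF p w \<sigma>(1) nG])
        show "vsub (lp_sum p (\<lambda>n. w n / \<sigma> n powr p) G) (?S (x j)) (?S (y j)) \<in> carr (lp_sum p (\<lambda>n. w n / \<sigma> n powr p) G)" if "j < n" for j
          using normed_space.sub_closed[OF nsG SG SG] h that by (simp add: a_def[abs_def])
        show "0 \<le> weak_lip TYPE('k) p X n x y lam" by (rule weak_lip_nonneg[OF p X h])
        fix i
        have "(\<Sum>j<n. lam j powr p * vnorm (G i) (vsub (lp_sum p (\<lambda>n. w n / \<sigma> n powr p) G) (?S (x j)) (?S (y j)) i) powr p)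
            = (\<Sum>j<n. lam j powr p * vnorm (G i) (vsub (G i) (S i (x j)) (S i (y j))) powr p)"
          using h by (intro sum.cong) (auto simp: lp_sum_simps)
        thus "(\<Sum>j<n. lam j powr p * vnorm (G i) (vsub (lp_sum p (\<lambda>n. w n / \<sigma> n powr p) G) (?S (x j)) (?S (y j)) i) powr p) powr (1 / p)
            \<le> \<sigma> i * weak_lip TYPE('k) p X n x y lam"
          using lip_summing_constsD[OF \<sigma>(2) h] by simp
      qed
    qed
    show "1 \<in> summing_consts q (dual F) ?H ?R"
      unfolding summing_consts_iff
    proof (intro conjI allI impI zero_le_one)
      fix n :: nat and u assume h: "\<forall>j<n. u j \<in> carr (dual F)"
      have "(\<Sum>j<n. 1 powr q * vnorm ?H (?R (u j)) powr q) powr (1 / q) \<le> weak_norm q (dual F) n u"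
        unfolding a'_def
      proof (rule lp_sum_strong_norm_le[OF q w \<rho>(1) nH])
        show "?R (u j) \<in> carr (lp_sum q (\<lambda>n. w n / \<rho> n powr q) H)" if "j < n" for j
          using RH h that by (simp add: a'_def[abs_def])
        show "0 \<le> weak_norm q (dual F) n u" by (rule weak_norm_nonneg[OF q F.normed_space_axioms h])
        fix i
        have "(\<Sum>j<n. 1 powr q * vnorm (H i) (?R (u j) i) powr q) = (\<Sum>j<n. vnorm (H i) (R i (u j)) powr q)"
          using h by (intro sum.cong) auto
        thus "(\<Sum>j<n. 1 powr q * vnorm (H i) (?R (u j) i) powr q) powr (1 / q) \<le> \<rho> i * weak_norm q (dual F) n u"
          using summing_constsD[OF \<rho>(2) h] by simp
      qed
      thus "(\<Sum>j<n. vnorm ?H (?R (u j)) powr q) powr (1 / q) \<le> 1 * weak_norm q (dual F) n u" by simp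
    qed
    fix x y b assume x: "x \<in> points X" "y \<in> points X" and b: "b \<in> carr (dual F)"
    define s where "s n = vnorm (G n) (vsub (G n) (S n x) (S n y)) / \<sigma> n" for n
    define r where "r n = vnorm (H n) (R n b) / \<rho> n" for n
    have ns: "0 \<le> vnorm (G n) (vsub (G n) (S n x) (S n y))" for n
      using normed_space.norm_nonneg[OF nG normed_space.sub_closed[OF nG Sc[OF x(1)] Sc[OF x(2)]]] .
    have nr: "0 \<le> vnorm (H n) (R n b)" for n using normed_space.norm_nonneg[OF nH Rc[OF b]] .
    have s0: "0 \<le> s n" and r0: "0 \<le> r n" for n
      using ns nr less_imp_le[OF \<sigma>(1)[of n]] less_imp_le[OF \<rho>(1)[of n]] by (auto simp: s_def r_def)
    have ts: "a n * vnorm (G n) (vsub (G n) (S n x) (S n y)) powr p = w n * s n powr p" for n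
      unfolding a_def s_def by (rule lp_sum_normalised_terms[OF p \<sigma>(1) ns])
    have tr: "a' n * vnorm (H n) (R n b) powr q = w n * r n powr q" for n
      unfolding a'_def r_def by (rule lp_sum_normalised_terms[OF q \<rho>(1) nr])
    have ss: "summable (\<lambda>n. w n * s n powr p)"
      using normed_space.sub_closed[OF nsG SG[OF x(1)] SG[OF x(2)]] x ts by (simp add: lp_sum_simps)
    have sr: "summable (\<lambda>n. w n * r n powr q)"
      using RH[OF b] b tr by (simp add: lp_sum_simps)
    have Ns: "vnorm ?G (vsub ?G (?S x) (?S y)) = (\<Sum>n. w n * s n powr p) powr (1 / p)"
      using x ts by (simp add: lp_sum_simps)
    have Nr: "vnorm ?H (?R b) = (\<Sum>n. w n * r n powr q) powr (1 / q)"
      using b tr by (simp add: lp_sum_simps)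
    have pq: "0 < p" "0 < q" "0 < 1 - \<theta>" "0 < 1 - \<nu>" using p q \<theta> \<nu> by auto
    note Hoelder = Holder_suminf[OF pq exponents w s0 ss r0 sr]
    let ?k = "C * (pdist X x y powr \<theta> * vnorm (dual F) b powr \<nu>)"
    have tm: "norm (b (vsub F (Tn n x) (Tn n y))) \<le> ?k * (w n * (s n powr (1 - \<theta>) * r n powr (1 - \<nu>)))" for n
    proof -
      have "norm (b (vsub F (Tn n x) (Tn n y))) \<le> c n * (pdist X x y powr \<theta> * s n powr (1 - \<theta>) * (vnorm (dual F) b powr \<nu> * r n powr (1 - \<nu>)))"
        unfolding s_def r_def using d'[of n] x b by blast
      also have "\<dots> = ?k * (w n * (s n powr (1 - \<theta>) * r n powr (1 - \<nu>)))"
        using C0 by (simp add: w_def)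
      finally show ?thesis .
    qed
    have sk: "summable (\<lambda>n. ?k * (w n * (s n powr (1 - \<theta>) * r n powr (1 - \<nu>))))"
      by (rule summable_mult[OF Hoelder(1)])
    have sT: "summable (\<lambda>n. norm (b (vsub F (Tn n x) (Tn n y))))"
      using tm by (intro summable_comparison_test[OF _ sk]) simp
    have "norm (b (vsub F (T x) (T y))) \<le> (\<Sum>n. norm (b (vsub F (Tn n x) (Tn n y))))"
      by (rule le[OF x b sT])
    also have "\<dots> \<le> (\<Sum>n. ?k * (w n * (s n powr (1 - \<theta>) * r n powr (1 - \<nu>))))"
      by (rule suminf_le[OF tm sT sk])
    also have "\<dots> = ?k * (\<Sum>n. w n * (s n powr (1 - \<theta>) * r n powr (1 - \<nu>)))"
      by (rule suminf_mult[OF Hoelder(1)])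
    also have "\<dots> \<le> ?k * (vnorm ?G (vsub ?G (?S x) (?S y)) powr (1 - \<theta>) * vnorm ?H (?R b) powr (1 - \<nu>))"
      unfolding Ns Nr using C0 by (intro mult_left_mono Hoelder(2)) auto
    finally show "norm (b (vsub F (T x) (T y))) \<le> C * (pdist X x y powr \<theta> * (vnorm ?G (vsub ?G (?S x) (?S y)) / 1) powr (1 - \<theta>)
       * (vnorm (dual F) b powr \<nu> * (vnorm ?H (?R b) / 1) powr (1 - \<nu>)))"
      by (simp only: div_by_1 mult_ac)
  qed
  from dominated_with_imp_dominated[OF this less_imp_le[OF C0] T]
  show "T \<in> Dom" "D T \<le> suminf c" by (simp_all add: C_def)
qed

end

section \<open>The Banach space of dominated maps\<close>

context domination_setting
begin

lemma dominated_closed: "\<lbrakk>T \<in> Dom; x \<in> points X\<rbrakk> \<Longrightarrow> T x \<in> carr F"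
  and dominated_base: "T \<in> Dom \<Longrightarrow> T (base X) = vzero F"
  and dominated_ext: "T \<in> Dom \<Longrightarrow> T \<in> extensional (points X)"
  using dominated_pointed_map by (auto simp: pointed_map_def)

lemma base_mem: "base X \<in> points X" using X by (simp add: pointed_metric_space_def)

lemma dominated_zero:
  shows "(\<lambda>x\<in>points X. vzero F) \<in> Dom" and "D (\<lambda>x\<in>points X. vzero F) = 0"
proof -
  have g: "(\<lambda>x\<in>points X. 0) \<in> lip_maps X (origin_pointed (scalars :: ('k, 'k) nspace))"
    using zero_in_sharp_ball[OF X] by (auto simp: unit_ball_def sharp_simps)
  have eq: "(\<lambda>x\<in>points X. vscale F ((\<lambda>x\<in>points X. 0) x) (vzero F)) = (\<lambda>x\<in>points X. vzero F)"
    by (auto simp: F.scale_vzero)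
  show "(\<lambda>x\<in>points X. vzero F) \<in> Dom" "D (\<lambda>x\<in>points X. vzero F) = 0"
    using elementary_map[OF g F.zero_closed, unfolded eq] F.norm_eq_zero[OF F.zero_closed] by simp_all
qed

text \<open>
  A series with the two terms \<open>S\<close> and \<open>T\<close> followed by zeros.  The summands \<open>e/2\<^bsup>n+1\<^esup>\<close> make the bounds strict
  at a total cost of \<open>e\<close>.
\<close>

lemma dominated_add:
  assumes ST: "S \<in> Dom" "T \<in> Dom"
  defines "U \<equiv> (\<lambda>x\<in>points X. vadd F (S x) (T x))"
  shows "U \<in> Dom" and "D U \<le> D S + D T"
proof -
  let ?z = "\<lambda>x\<in>points X. vzero F"
  have U: "pointed_map U"
    using ST[THEN dominated_closed] ST[THEN dominated_base] base_mem F.zero_closed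
    by (auto simp: pointed_map_def U_def F.add_closed F.add_zero)
  have main: "U \<in> Dom \<and> D U \<le> D S + D T + e" if e: "0 < e" for e
  proof -
    define Tn where "Tn n = (if n = 0 then S else if n = 1 then T else ?z)" for n :: nat
    define c where "c n = (if n = 0 then D S else if n = 1 then D T else 0) + e * (1/2) ^ Suc n" for n :: nat
    have Tn: "Tn n \<in> Dom" "D (Tn n) < c n" for n
      using ST dominated_zero e by (auto simp: Tn_def c_def)
    have "(\<lambda>n::nat. if n = 0 then D S else if n = 1 then D T else 0) sums (\<Sum>n\<in>{0, 1 :: nat}. if n = 0 then D S else if n = 1 then D T else 0)"
      by (intro sums_finite) auto
    hence sc: "c sums (D S + D T + e * 1)"
      unfolding c_def[abs_def] by (intro sums_add sums_mult power_half_series) simp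
    have le: "norm (b (vsub F (U x) (U y))) \<le> (\<Sum>n. norm (b (vsub F (Tn n x) (Tn n y))))"
      if x: "x \<in> points X" "y \<in> points X" and b: "b \<in> carr (dual F)" for x y b
    proof -
      note cl = ST[THEN dominated_closed, OF x(1)] ST[THEN dominated_closed, OF x(2)]
      have bz: "b (vzero F) = 0" using functional_scale[OF b F.zero_closed, of 0] by (simp add: F.scale_vzero)
      have "b (vsub F (U x) (U y)) = b (vsub F (S x) (S y)) + b (vsub F (T x) (T y))"
        using x cl bounded_opsD(3)[of b F scalars] b
        by (simp add: U_def F.add_sub_add F.sub_closed dual_simps)
      moreover have "(\<Sum>n. norm (b (vsub F (Tn n x) (Tn n y)))) = (\<Sum>n\<in>{0,1}. norm (b (vsub F (Tn n x) (Tn n y))))"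
        by (rule suminf_finite) (auto simp: Tn_def x F.sub_self F.zero_closed bz)
      ultimately show ?thesis by (simp add: Tn_def norm_triangle_ineq)
    qed
    show ?thesis
    proof
      show "U \<in> Dom"
        by (rule dominated_series(1)[where Tn=Tn, OF Tn sums_summable[OF sc] U]) (rule le)
      have "D U \<le> suminf c"
        by (rule dominated_series(2)[where Tn=Tn, OF Tn sums_summable[OF sc] U]) (rule le)
      thus "D U \<le> D S + D T + e" using sums_unique[OF sc] by simp
    qed
  qed
  show "U \<in> Dom" using main[of 1] by simp
  show "D U \<le> D S + D T" by (rule field_le_epsilon) (use main in blast)
qed

text \<open>
  The ideal inequality with \<open>P\<close> the identity and \<open>B\<close> the multiplication by \<open>a\<close>.
\<close>

lemma dominated_scale:
  assumes T: "T \<in> Dom"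
  shows "(\<lambda>x\<in>points X. vscale F a (T x)) \<in> Dom" and "D (\<lambda>x\<in>points X. vscale F a (T x)) \<le> norm a * D T"
proof -
  let ?P = "\<lambda>x\<in>points X. x" and ?B = "\<lambda>u\<in>carr F. vscale F a u"
  have P: "?P \<in> lip_maps X X" using base_mem by (intro lip_mapsI[of _ _ _ 1]) auto
  have P1: "lip_const X X ?P \<le> 1" by (rule lip_const_le) auto
  have B: "?B \<in> bounded_ops F F"
    by (rule bounded_opsI[of _ _ _ "norm a"])
      (auto simp: F.scale_closed F.add_closed F.scale_add_right F.scale_scale F.norm_scale mult.commute)
  have Ba: "op_norm F F ?B \<le> norm a" by (rule op_norm_le) (auto simp: F.norm_scale)
  have eq: "(\<lambda>x\<in>points X. ?B (T (?P x))) = (\<lambda>x\<in>points X. vscale F a (T x))"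
    using dominated_closed[OF T] by auto
  note comp = dominated_compose[OF domination_setting_axioms domination_setting_axioms T P B, unfolded eq]
  show "(\<lambda>x\<in>points X. vscale F a (T x)) \<in> Dom" by (rule comp(1))
  have "op_norm F F ?B * D T * lip_const X X ?P \<le> norm a * D T * 1"
    using Ba P1 dominated_norm_nonneg[OF T] lip_maps_bound(1)[OF P] by (intro mult_mono) auto
  thus "D (\<lambda>x\<in>points X. vscale F a (T x)) \<le> norm a * D T" using comp(2) by simp
qed

abbreviation "W \<equiv> function_space (points X) F Dom D"

lemma W_simps:
  "carr W = Dom" "vadd W S T = (\<lambda>x\<in>points X. vadd F (S x) (T x))" "vzero W = (\<lambda>x\<in>points X. vzero F)"
  "vscale W a T = (\<lambda>x\<in>points X. vscale F a (T x))" "vnorm W = D"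
  "vsub W S T = (\<lambda>x\<in>points X. vsub F (S x) (T x))"
  by (auto simp: function_space_def vsub_def)

lemma normed_space_dominated:
  shows "normed_space W"
proof
  show "vzero W \<in> carr W" unfolding W_simps by (rule dominated_zero)
  fix T assume T: "T \<in> carr W"
  hence TD: "T \<in> Dom" by (simp add: W_simps)
  note c = dominated_closed[OF TD]
  have ext: "restrict T (points X) = T" using dominated_ext[OF TD] by (rule extensional_restrict)
  show "vscale W a T \<in> carr W" for a unfolding W_simps by (rule dominated_scale[OF TD])
  have "vadd W T (vzero W) = restrict T (points X)" using c by (auto simp: W_simps F.add_zero)
  thus "vadd W T (vzero W) = T" using ext by simp
  have "vscale W 1 T = restrict T (points X)" using c by (auto simp: W_simps F.scale_one)
  thus one: "vscale W 1 T = T" using ext by simp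
  show "\<exists>S\<in>carr W. vadd W T S = vzero W"
    using dominated_scale(1)[OF TD, of "-1"] c
    by (intro bexI[of _ "vscale W (-1) T"]) (auto simp: W_simps F.add_neg)
  show "vscale W (a + b) T = vadd W (vscale W a T) (vscale W b T)" for a b
    using c by (auto simp: W_simps F.scale_add_left)
  show ss: "vscale W a (vscale W b T) = vscale W (a * b) T" for a b
    using c by (auto simp: W_simps F.scale_scale)
  show "0 \<le> vnorm W T" unfolding W_simps by (rule dominated_norm_nonneg[OF TD])
  show "vnorm W T = 0 \<longleftrightarrow> T = vzero W"
  proof
    assume "vnorm W T = 0"
    hence "D T = 0" by (simp add: W_simps)
    hence "vnorm F (vsub F (T x) (T (base X))) \<le> 0" if "x \<in> points X" for x
      using dominated_lipschitz[OF TD that base_mem] by simp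
    hence "T x = vzero F" if "x \<in> points X" for x
      using c[OF that] dominated_base[OF TD] F.norm_eq_zero[OF c[OF that]] F.norm_nonneg[OF c[OF that]] that
      by (force simp: F.sub_zero)
    hence "restrict T (points X) = vzero W" by (auto simp: W_simps)
    thus "T = vzero W" using ext by simp
  qed (simp add: W_simps dominated_zero)
  show "vnorm W (vscale W a T) = norm a * vnorm W T" for a
  proof (rule antisym)
    show "vnorm W (vscale W a T) \<le> norm a * vnorm W T"
      unfolding W_simps by (rule dominated_scale(2)[OF TD])
    show "norm a * vnorm W T \<le> vnorm W (vscale W a T)"
    proof (cases "a = 0")
      case True thus ?thesis using dominated_norm_nonneg[OF dominated_scale(1)[OF TD]] by (simp add: W_simps)
    next
      case False
      have "D (vscale W (inverse a) (vscale W a T)) \<le> norm (inverse a) * D (vscale W a T)"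
        using dominated_scale(2)[OF dominated_scale(1)[OF TD], of "inverse a" a] unfolding W_simps .
      moreover have "vscale W (inverse a) (vscale W a T) = T" using False by (simp add: ss one)
      ultimately have "D T \<le> inverse (norm a) * D (vscale W a T)" by (simp only: norm_inverse)
      hence "norm a * D T \<le> norm a * (inverse (norm a) * D (vscale W a T))" by (intro mult_left_mono) auto
      also have "\<dots> = D (vscale W a T)" using False by (simp add: mult.assoc[symmetric])
      finally show ?thesis unfolding W_simps(5) .
    qed
  qed
  fix S assume S: "S \<in> carr W"
  hence SD: "S \<in> Dom" by (simp add: W_simps)
  note cS = dominated_closed[OF SD]
  show "vadd W T S \<in> carr W" unfolding W_simps by (rule dominated_add[OF TD SD])
  show "vadd W T S = vadd W S T" using c cS F.add_commute by (auto simp: W_simps)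
  show "vscale W a (vadd W T S) = vadd W (vscale W a T) (vscale W a S)" for a
    using c cS by (auto simp: W_simps F.scale_add_right)
  show "vnorm W (vadd W T S) \<le> vnorm W T + vnorm W S" unfolding W_simps by (rule dominated_add[OF TD SD])
  fix R assume "R \<in> carr W"
  hence RD: "R \<in> Dom" by (simp add: W_simps)
  show "vadd W (vadd W T S) R = vadd W T (vadd W S R)"
    using c cS dominated_closed[OF RD] by (auto simp: W_simps F.add_assoc)
qed

text \<open>
  Since \<open>Lip \<le> D\<close>, a Cauchy sequence has a pointwise limit \<open>T\<close>.  Along a subsequence with
  \<open>D (s\<^bsub>k(n+1)\<^esub> - s\<^bsub>k(n)\<^esub>) < 2\<^bsup>-n\<^esup>\<close>, the difference \<open>T - s\<^bsub>k(m)\<^esub>\<close> is a telescoping series, so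
  \<open>dominated_series\<close> bounds its norm by \<open>2 \<cdot> 2\<^bsup>-m\<^esup>\<close>.
\<close>

lemma banach_space_dominated:
  shows "banach_space W"
proof (rule banach_spaceI)
  interpret W: normed_space W by (rule normed_space_dominated)
  show "normed_space W" by (rule W.normed_space_axioms)
  fix s :: "nat \<Rightarrow> 'x \<Rightarrow> 'f"
  assume sW: "\<And>n. s n \<in> carr W" and Cauchy: "\<forall>e>0. \<exists>N. \<forall>m\<ge>N. \<forall>n\<ge>N. vnorm W (vsub W (s m) (s n)) < e"
  have s: "s n \<in> Dom" for n using sW by (simp add: W_simps)
  note sc = dominated_closed[OF s]
  have subD: "vsub W (s m) (s n) \<in> Dom" for m n using W.sub_closed[OF sW sW] by (simp add: W_simps)
  have "\<exists>l. l \<in> carr F \<and> (\<lambda>n. vnorm F (vsub F (s n x) l)) \<longlonglongrightarrow> 0" if x: "x \<in> points X" for x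
  proof -
    have le: "vnorm F (vsub F (s m x) (s n x)) \<le> D (vsub W (s m) (s n)) * pdist X x (base X)" for m n
    proof -
      have "vsub W (s m) (s n) (base X) = vzero F"
        using dominated_base[OF s] by (simp add: W_simps base_mem F.sub_self F.zero_closed)
      thus ?thesis
        using dominated_lipschitz[OF subD x base_mem, of m n] x sc[OF x] by (simp add: W_simps F.sub_zero F.sub_closed)
    qed
    have "\<exists>N. \<forall>m\<ge>N. \<forall>n\<ge>N. vnorm F (vsub F (s m x) (s n x)) < e" if e: "e > 0" for e
    proof -
      let ?d = "pdist X x (base X) + 1"
      have d: "?d > 0" by (simp add: add_nonneg_pos)
      then obtain N where N: "\<forall>m\<ge>N. \<forall>n\<ge>N. vnorm W (vsub W (s m) (s n)) < e / ?d"
        using Cauchy e by (meson divide_pos_pos)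
      have "vnorm F (vsub F (s m x) (s n x)) < e" if mn: "m \<ge> N" "n \<ge> N" for m n
      proof -
        have "D (vsub W (s m) (s n)) * pdist X x (base X) \<le> D (vsub W (s m) (s n)) * ?d"
          using dominated_norm_nonneg[OF subD] by (intro mult_left_mono) auto
        also have "\<dots> < e" using N mn d by (simp add: W_simps(5) pos_less_divide_eq)
        finally show ?thesis using le[of m n] by linarith
      qed
      thus ?thesis by blast
    qed
    hence cau: "\<forall>e>0. \<exists>N. \<forall>m\<ge>N. \<forall>n\<ge>N. vnorm F (vsub F (s m x) (s n x)) < e" by blast
    show ?thesis by (rule banach_space_limit[OF banach_F, of "\<lambda>n. s n x"]) (use sc[OF x] cau in auto)
  qed
  then obtain l where l: "\<And>x. x \<in> points X \<Longrightarrow> l x \<in> carr F"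
    "\<And>x. x \<in> points X \<Longrightarrow> (\<lambda>n. vnorm F (vsub F (s n x) (l x))) \<longlonglongrightarrow> 0" by metis
  define T where "T = restrict l (points X)"
  have Tc: "T x \<in> carr F" if "x \<in> points X" for x using l that by (simp add: T_def)
  have Tb: "T (base X) = vzero F"
  proof -
    have "(\<lambda>n. vnorm F (vsub F (vzero F) (T (base X)))) \<longlonglongrightarrow> 0"
      using l(2)[OF base_mem] dominated_base[OF s] base_mem by (simp add: T_def)
    hence "vnorm F (vsub F (vzero F) (T (base X))) = 0" by (simp add: LIMSEQ_const_iff)
    thus ?thesis
      using F.norm_eq_zero[OF F.sub_closed[OF F.zero_closed Tc[OF base_mem]]]
        F.sub_eq_zero_iff[OF F.zero_closed Tc[OF base_mem]] by simp
  qed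
  have T: "pointed_map T" using Tc Tb by (auto simp: pointed_map_def T_def)
  have bl: "(\<lambda>n. b (s n x)) \<longlonglongrightarrow> b (T x)" if x: "x \<in> points X" and b: "b \<in> carr (dual F)" for x b
  proof (rule LIM_zero_cancel, rule Lim_null_comparison)
    show "(\<lambda>n. vnorm (dual F) b * vnorm F (vsub F (s n x) (T x))) \<longlonglongrightarrow> 0"
      using tendsto_mult_left[OF l(2)[OF x], of "vnorm (dual F) b"] x by (simp add: T_def)
    show "\<forall>\<^sub>F n in sequentially. norm (b (s n x) - b (T x)) \<le> vnorm (dual F) b * vnorm F (vsub F (s n x) (T x))"
      using dual_bound[OF b F.norm_nonneg F.sub_closed[OF sc[OF x] Tc[OF x]]] functional_sub[OF b sc[OF x] Tc[OF x]] by simp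
  qed
  have "\<forall>i. \<exists>N. \<forall>m\<ge>N. \<forall>n\<ge>N. D (vsub W (s m) (s n)) < (1/2) ^ i"
    using Cauchy by (simp add: W_simps(5))
  then obtain N where N: "\<And>i m n. \<lbrakk>N i \<le> m; N i \<le> n\<rbrakk> \<Longrightarrow> D (vsub W (s m) (s n)) < (1/2) ^ i" by metis
  \<comment> \<open>The sum makes \<open>k\<close> increasing and at least \<open>N\<close>; the summand \<open>i\<close> makes it unbounded.\<close>
  define k where "k i = i + (\<Sum>j\<le>i. N j)" for i :: nat
  have kN: "N i \<le> k i" "i \<le> k i" "k i \<le> k (Suc i)" for i
    using member_le_sum[of i "{..i}" N] by (auto simp: k_def)
  have tail: "vsub W T (s (k m)) \<in> Dom \<and> D (vsub W T (s (k m))) \<le> 2 * (1/2) ^ m" for m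
  proof -
    define Tn where "Tn n = vsub W (s (k (Suc (n + m)))) (s (k (n + m)))" for n
    have Tn: "Tn n \<in> Dom" "D (Tn n) < (1/2) ^ (n + m)" for n
      using subD N[of "n + m" "k (Suc (n + m))" "k (n + m)"] kN[of "n + m"] by (auto simp: Tn_def)
    have "(\<lambda>n. (1/2) ^ m * (1/2 :: real) ^ n) sums ((1/2) ^ m * (1 / (1 - 1/2)))"
      by (intro sums_mult geometric_sums) simp
    hence sums: "(\<lambda>n. (1/2 :: real) ^ (n + m)) sums (2 * (1/2) ^ m)"
      by (simp add: power_add mult.commute)
    have pm: "pointed_map (vsub W T (s (k m)))"
      using Tc sc Tb dominated_base[OF s] base_mem
      by (auto simp: pointed_map_def W_simps F.sub_closed F.sub_self F.zero_closed)
    have le: "norm (b (vsub F (vsub W T (s (k m)) x) (vsub W T (s (k m)) y))) \<le> (\<Sum>n. norm (b (vsub F (Tn n x) (Tn n y))))"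
      if x: "x \<in> points X" "y \<in> points X" and b: "b \<in> carr (dual F)"
        and sm: "summable (\<lambda>n. norm (b (vsub F (Tn n x) (Tn n y))))" for x y b
    proof -
      define f where "f n = b (s (k (n + m)) x) - b (s (k (n + m)) y)" for n
      have "filterlim (\<lambda>n. k (n + m)) sequentially sequentially"
      proof (rule filterlim_at_top_mono[OF filterlim_ident])
        show "\<forall>\<^sub>F n in sequentially. n \<le> k (n + m)" using le_trans[OF le_add1 kN(2)] by simp
      qed
      hence "f \<longlonglongrightarrow> b (T x) - b (T y)"
        unfolding f_def[abs_def]
        by (intro tendsto_diff filterlim_compose[OF bl[OF x(1) b]] filterlim_compose[OF bl[OF x(2) b]])
      hence "(\<lambda>n. f (Suc n) - f n) sums ((b (T x) - b (T y)) - f 0)" by (rule telescope_sums)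
      moreover have "f (Suc n) - f n = b (vsub F (Tn n x) (Tn n y))" for n
        using x sc[OF x(1)] sc[OF x(2)] by (simp add: f_def Tn_def W_simps functional_sub[OF b] F.sub_closed)
      moreover have "(b (T x) - b (T y)) - f 0 = b (vsub F (vsub W T (s (k m)) x) (vsub W T (s (k m)) y))"
        using x sc[OF x(1)] sc[OF x(2)] Tc[OF x(1)] Tc[OF x(2)] by (simp add: f_def W_simps functional_sub[OF b] F.sub_closed)
      ultimately have "(\<lambda>n. b (vsub F (Tn n x) (Tn n y))) sums b (vsub F (vsub W T (s (k m)) x) (vsub W T (s (k m)) y))" by simp
      from sums_unique[OF this] show ?thesis using summable_norm[OF sm] by simp
    qed
    show ?thesis
    proof
      show "vsub W T (s (k m)) \<in> Dom"
        by (rule dominated_series(1)[where Tn=Tn, OF Tn sums_summable[OF sums] pm]) (rule le)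
      show "D (vsub W T (s (k m))) \<le> 2 * (1/2) ^ m"
        unfolding sums_unique[OF sums]
        by (rule dominated_series(2)[where Tn=Tn, OF Tn sums_summable[OF sums] pm]) (rule le)
    qed
  qed
  have "vadd W (vsub W T (s (k 0))) (s (k 0)) = T"
  proof -
    have "vadd F (vsub F u v) v = u" if "u \<in> carr F" "v \<in> carr F" for u v
      using F.sub_add_sub[OF that F.zero_closed] that by (simp add: F.sub_zero)
    hence "vadd W (vsub W T (s (k 0))) (s (k 0)) = restrict T (points X)"
      using Tc sc by (auto simp: W_simps)
    thus ?thesis by (simp add: T_def)
  qed
  hence TW: "T \<in> carr W" using W.add_closed[of "vsub W T (s (k 0))" "s (k 0)"] tail[of 0] sW by (simp add: W_simps(1))
  have "\<exists>M. \<forall>n\<ge>M. vnorm W (vsub W (s n) T) < e" if e: "0 < e" for e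
  proof -
    obtain M where M: "\<forall>m\<ge>M. \<forall>n\<ge>M. vnorm W (vsub W (s m) (s n)) < e / 2" using Cauchy e half_gt_zero by blast
    obtain i where i: "(1/2 :: real) ^ i < e / 4" using real_arch_pow_inv[of "e / 4" "1/2"] e by auto
    define m where "m = max i M"
    have "(1/2 :: real) ^ m \<le> (1/2) ^ i" unfolding m_def by (intro power_decreasing) auto
    hence t: "vnorm W (vsub W T (s (k m))) < e / 2" using tail[of m] i unfolding W_simps(5) by linarith
    have "M \<le> k m" using kN(2)[of m] by (simp add: m_def)
    hence "vnorm W (vsub W (s n) T) < e" if "n \<ge> M" for n
      using W.norm_sub_triangle[OF sW sW TW, of n "k m"] W.norm_sub_commute[OF TW sW, of "k m"] M t that by force
    thus ?thesis by blast
  qed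
  thus "\<exists>l\<in>carr W. (\<lambda>n. vnorm W (vsub W (s n) l)) \<longlonglongrightarrow> 0"
    using W.tendsto_norm_sub_iff[of s T, OF sW TW] TW by blast
qed

end

text \<open>
  The real and complex cases differ only in the proof that Banach spaces have norming functionals.
\<close>

lemma banach_nonlinear_ideal_dominated:
  fixes p q r \<theta> \<nu> :: real
  assumes par: "1 \<le> p" "1 \<le> q" "1 \<le> r" "0 \<le> \<theta>" "\<theta> < 1" "0 \<le> \<nu>" "\<nu> < 1"
      "1 / r + (1 - \<theta>) / p + (1 - \<nu>) / q = 1"
    and norming: "\<And>F :: ('k :: {real_normed_field, banach}, 'f) nspace. normed_space F \<Longrightarrow> norming F"
  shows "banach_nonlinear_ideal (dominated p \<theta> q \<nu> :: 'x pointed \<Rightarrow> ('k, 'f) nspace \<Rightarrow> ('x \<Rightarrow> 'f) set) (dominated_norm p \<theta> q \<nu>)"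
proof -
  have r: "0 \<le> 1 / r" using par by simp
  have exps: "(1 - \<theta>) / p + (1 - \<nu>) / q \<le> 1" using par(8) r by linarith
  have setting: "domination_setting p \<theta> q \<nu> X F" if "pointed_metric_space X" "banach_space F"
    for X :: "'x pointed" and F :: "('k, 'f) nspace"
    using that par exps norming by unfold_locales (auto simp: banach_space_def)
  show ?thesis
    unfolding banach_nonlinear_ideal_def
  proof (intro conjI allI impI ballI; (elim conjE)?)
    fix X :: "'x pointed" and F :: "('k, 'f) nspace"
    assume XF: "pointed_metric_space X" "banach_space F"
    interpret domination_setting p \<theta> q \<nu> X F by (rule setting[OF XF])
    show "Dom \<subseteq> lip_maps X (origin_pointed F)" by (auto simp: dominated_def)
    show "0 \<le> D T" if "T \<in> Dom" for T using that by (rule dominated_norm_nonneg)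
    show "(\<lambda>x\<in>points X. vscale F (g x) e) \<in> Dom" "D (\<lambda>x\<in>points X. vscale F (g x) e) = vnorm (sharp X) g * vnorm F e"
      if "g \<in> carr (sharp X)" "e \<in> carr F" for g e
      using elementary_map[OF _ that(2)] that(1) by (auto simp: sharp_simps)
    show "(\<lambda>x\<in>points X. vadd F (S x) (T x)) \<in> Dom" "D (\<lambda>x\<in>points X. vadd F (S x) (T x)) \<le> D S + D T"
      if "S \<in> Dom" "T \<in> Dom" for S T
      using dominated_add[OF that] by auto
    show "banach_space W" by (rule banach_space_dominated)
  next
    fix X0 X :: "'x pointed" and F F0 :: "('k, 'f) nspace" and P T B
    assume h: "pointed_metric_space X0" "pointed_metric_space X" "banach_space F" "banach_space F0"
      and m: "P \<in> lip_maps X0 X" "T \<in> dominated p \<theta> q \<nu> X F" "B \<in> bounded_ops F F0"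
    note comp = dominated_compose[OF setting[OF h(2,3)] setting[OF h(1,4)] m(2,1,3)]
    show "(\<lambda>x\<in>points X0. B (T (P x))) \<in> dominated p \<theta> q \<nu> X0 F0" by (rule comp(1))
    show "dominated_norm p \<theta> q \<nu> X0 F0 (\<lambda>x\<in>points X0. B (T (P x))) \<le> op_norm F F0 B * dominated_norm p \<theta> q \<nu> X F T * lip_const X0 X P"
      by (rule comp(2))
  qed
qed

theorem proposition23:
  fixes p q r \<theta> \<nu> :: real
  assumes "1 \<le> p" "1 \<le> q" "1 \<le> r"
    and "0 \<le> \<theta>" "\<theta> < 1" "0 \<le> \<nu>" "\<nu> < 1"
    and "1 / r + (1 - \<theta>) / p + (1 - \<nu>) / q = 1"
  shows "banach_nonlinear_ideal
           (dominated p \<theta> q \<nu> :: 'x pointed \<Rightarrow> (real, 'f) nspace \<Rightarrow> ('x \<Rightarrow> 'f) set)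
           (dominated_norm p \<theta> q \<nu>) \<and>
         banach_nonlinear_ideal
           (dominated p \<theta> q \<nu> :: 'x pointed \<Rightarrow> (complex, 'f) nspace \<Rightarrow> ('x \<Rightarrow> 'f) set)
           (dominated_norm p \<theta> q \<nu>)"
  using banach_nonlinear_ideal_dominated[OF assms norming_real] banach_nonlinear_ideal_dominated[OF assms norming_complex]
  by blast

end
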